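(* Let $\Gamma$ be a decay function on $\mathbb{Z}^m$, let $U\subset \ell^\infty(\mathbb{R}^n)$ be an open set with $0\in U$, and let $\mathfrak{a}\in L(\mathbb{R}^n,\mathbb{R}^n)$ have eigenvalues $\lambda_1,\ldots,\lambda_n\in\mathbb{C}$ (with $\operatorname{Spec}(\mathfrak{a})=\{\lambda_1,\ldots,\lambda_n\}$). Put $\alpha=\min_i|\lambda_i|$, $\beta=\max_i|\lambda_i|$, $\nu=\frac{\log\alpha}{\log\beta}$ and $r_0=[\nu]+1$, where $[\cdot]$ denotes the integer part. Assume $0<|\lambda_i|<1$ for $1\le i\le n$. Let $r\ge r_0$ be an integer. Then there is $\varepsilon>0$, depending only on $\mathfrak{a}$, $\Gamma$, $r$ and the norm on $\mathbb{R}^n$, such that the following holds. Let $F\in C^r_\Gamma(U,\ell^\infty(\mathbb{R}^n))$ be of the form $F=F_0+F_1$, where $F_0$ is an uncoupled map, $F_0(0)=F_1(0)=0$, $A=DF_0(0)$, $B=DF_1(0)$, and $A_{ij}=\mathfrak{a}\,\delta_{ij}$ for all $i,j\in\mathbb{Z}^m$. If $\|B\|_\Gamma<\varepsilon$, then there exist a polynomial map with decay $H:\ell^\infty(\mathbb{R}^n)\to\ell^\infty(\mathbb{R}^n)$ of degree not larger than $r_0$ and $R\in C^r_\Gamma(\ell^\infty(\mathbb{R}^n),\ell^\infty(\mathbb{R}^n))$ such that $R(0)=0$, $DR(0)=\operatorname{Id}$ and $$R\circ F=H\circ R$$ in some neighborhood $U_1\subset U$ of $0$.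
   Context: Fix integers $n,m\ge1$ and a norm $\|\cdot\|$ on $\mathbb{R}^n$. $\ell^\infty(\mathbb{R}^n)$ is the Banach space of bounded families $x=(x_i)_{i\in\mathbb{Z}^m}$, $x_i\in\mathbb{R}^n$, with norm $\|x\|_\infty=\sup_i\|x_i\|$. Decay function: $\Gamma:\mathbb{Z}^m\to\mathbb{R}^+=(0,\infty)$ with $\sum_{k}\Gamma(k)\le1$ and $\sum_k\Gamma(i-k)\Gamma(k-j)\le\Gamma(i-j)$ for all $i,j\in\mathbb{Z}^m$. Linear maps with decay: for a bounded linear map $A$ of $\ell^\infty(\mathbb{R}^n)$ let $\|A\|$ be the operator norm, $\gamma(A)=\sup_{i,k\in\mathbb{Z}^m}\sup\{\|(Au)_i\|\,\Gamma(i-k)^{-1}: \|u\|_\infty\le1,\ u_j=0 \text{ for } j\ne k\}$ and $\|A\|_\Gamma=\max\{\|A\|,\gamma(A)\}$; $L_\Gamma$ is the set of $A$ with $\|A\|_\Gamma<\infty$. Multilinear maps with decay: $L^k_\Gamma$ is the space of bounded $k$-linear maps $A:\ell^\infty(\mathbb{R}^n)^k\to\ell^\infty(\mathbb{R}^n)$ with $\|A\|_\Gamma=\max\{\|A\|,\gamma(A)\}<\infty$, where $\gamma(A)=\max_{1\le p\le k}\sup_{i,l\in\mathbb{Z}^m}\sup\|A(v_1,\ldots,v_{p-1},w,v_p,\ldots,v_{k-1})_i\|\,\Gamma(i-l)^{-1}$, the inner supremum being over $w$ with $\|w\|_\infty\le1$, $w_j=0$ for $j\neq l$, and $v_q$ with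 $\|v_q\|_\infty\le1$. For $V\subset\ell^\infty(\mathbb{R}^n)$ open and an integer $r\ge1$, $C^r_\Gamma(V,\ell^\infty(\mathbb{R}^n))$ is the space of maps $F\in C^r(V,\ell^\infty(\mathbb{R}^n))$ (Fréchet sense) with $\sup_{x\in V}\|F(x)\|_\infty<\infty$, $D^jF(x)\in L^j_\Gamma$ for all $x\in V$ and $\sup_{x\in V}\|D^jF(x)\|_\Gamma<\infty$ for $1\le j\le r$. A polynomial map with decay of degree at most $d$ is a map $P(x)=P_0+\sum_{j=1}^{d}P_j(x,\ldots,x)$ with $P_0\in\ell^\infty(\mathbb{R}^n)$ and $P_j\in L^j_\Gamma$. A map $F_0:U\to\ell^\infty(\mathbb{R}^n)$ is uncoupled if, for each $i$, the component $(F_0(x))_i$ depends only on $x_i$. $A_{ij}=\mathrm{proj}_i A\,\mathrm{emb}_j$ is the $(i,j)$ block of $A$, where $\mathrm{proj}_i$ is projection onto the $i$-th node and $\mathrm{emb}_j$ the embedding of $\mathbb{R}^n$ as the $j$-th node; thus here $(Au)_i=\mathfrak{a}u_i$. $F_0,F_1$ are maps $U\to\ell^\infty(\mathbb{R}^n)$ differentiable at $0$. *)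

theory Defs
  imports "HOL-Analysis.Analysis"
begin

(* The lattice Z^m is the type int^'m with m = CARD('m), and R^n with an arbitrary norm is a
   normed space 'v of dimension n; since dim is 0 in infinite dimension, dim UNIV = n >= 1 includes
   finite dimensionality (see finite_spanning_set). Completeness (class banach) is then automatic.
   Since int^'m carries the discrete topology, every function on it is continuous, and the bounded
   continuous functions on it with the library's sup norm are exactly the bounded families
   (see bounded_family_in_bcontfun). *)

type_synonym ('m, 'v) ell_infty = "(int^'m) \<Rightarrow>\<^sub>C 'v"

lemma finite_spanning_set:
  assumes "dim (UNIV :: 'v::real_vector set) \<ge> 1"
  shows "\<exists>S :: 'v set. finite S \<and> independent S \<and> span S = UNIV \<and> card S = dim (UNIV :: 'v set)"
proof -
  obtain S :: "'v set" where S: "independent S" "UNIV \<subseteq> span S" "card S = dim (UNIV :: 'v set)"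
    using real_vector.basis_exists[of "UNIV :: 'v set"] by auto
  with assms have "finite S" by (intro card_ge_0_finite) simp
  with S show ?thesis by auto
qed

lemma open_singleton_int_vec: "open {i :: int^'m::finite}"
proof -
  have "{i} = {x. \<forall>k. x $ k \<in> {i $ k}}"
    by (auto simp: vec_eq_iff)
  moreover have "open {x :: int^'m. \<forall>k. x $ k \<in> {i $ k}}"
    unfolding open_vec_def by (intro ballI exI[of _ "\<lambda>k. {i $ k}"]) (auto simp: open_discrete)
  ultimately show ?thesis by simp
qed

lemma bounded_family_in_bcontfun:
  fixes f :: "int^'m::finite \<Rightarrow> 'v::metric_space"
  assumes "bounded (range f)"
  shows "f \<in> bcontfun"
proof -
  have "open S" for S :: "(int^'m) set"
    using open_UN[of S "\<lambda>i. {i}"] open_singleton_int_vec by auto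
  then have "continuous_on UNIV f"
    by (simp add: continuous_on_open_vimage)
  with assms show ?thesis by (simp add: bcontfun_def)
qed

definition proj :: "int^'m::finite \<Rightarrow> ('m, 'v::real_normed_vector) ell_infty \<Rightarrow> 'v" where
  "proj i x = apply_bcontfun x i"

definition emb :: "int^'m::finite \<Rightarrow> 'v::real_normed_vector \<Rightarrow> ('m, 'v) ell_infty" where
  "emb j v = Bcontfun (\<lambda>i. if i = j then v else 0)"

lemma proj_emb: "proj i (emb j v) = (if i = j then v else 0)"
proof -
  have "range (\<lambda>i. if i = j then v else 0) \<subseteq> {v, 0}" by auto
  then have "bounded (range (\<lambda>i. if i = j then v else 0))"
    by (rule bounded_subset[rotated]) simp
  from Bcontfun_inverse[OF bounded_family_in_bcontfun[OF this]] show ?thesis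
    by (simp add: proj_def emb_def)
qed

definition supported_at :: "('m::finite, 'v::real_normed_vector) ell_infty \<Rightarrow> int^'m \<Rightarrow> bool" where
  "supported_at u k \<longleftrightarrow> (\<forall>j. j \<noteq> k \<longrightarrow> proj j u = 0)"

(* The second series converges by the first line, as 0 < \<Gamma> \<le> 1. *)
definition decay_function :: "(int^'m::finite \<Rightarrow> real) \<Rightarrow> bool" where
  "decay_function \<Gamma> \<longleftrightarrow>
     (\<forall>k. \<Gamma> k > 0) \<and> \<Gamma> summable_on UNIV \<and> (\<Sum>\<^sub>\<infinity>k. \<Gamma> k) \<le> 1 \<and>
     (\<forall>i j. (\<Sum>\<^sub>\<infinity>k. \<Gamma> (i - k) * \<Gamma> (k - j)) \<le> \<Gamma> (i - j))"

(* All suprema below that may be infinite are taken in ennreal. *)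

definition gamma_lin ::
  "(int^'m::finite \<Rightarrow> real) \<Rightarrow>
   (('m, 'v::real_normed_vector) ell_infty \<Rightarrow>\<^sub>L ('m, 'v) ell_infty) \<Rightarrow> ennreal" where
  "gamma_lin \<Gamma> A =
     (SUP i. SUP k. SUP u\<in>{u. norm u \<le> 1 \<and> supported_at u k}.
        ennreal (norm (proj i (blinfun_apply A u)) / \<Gamma> (i - k)))"

definition norm_lin ::
  "(int^'m::finite \<Rightarrow> real) \<Rightarrow>
   (('m, 'v::real_normed_vector) ell_infty \<Rightarrow>\<^sub>L ('m, 'v) ell_infty) \<Rightarrow> ennreal" where
  "norm_lin \<Gamma> A = max (ennreal (norm A)) (gamma_lin \<Gamma> A)"

(* A k-linear map is represented by a function on argument lists; only its values on lists of
   length k are relevant. *)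

definition multilinear :: "nat \<Rightarrow> ('a::real_vector list \<Rightarrow> 'b::real_vector) \<Rightarrow> bool" where
  "multilinear k A \<longleftrightarrow> (\<forall>vs p. length vs = k \<longrightarrow> p < k \<longrightarrow> linear (\<lambda>w. A (vs[p := w])))"

definition unit_lists :: "nat \<Rightarrow> 'a::real_normed_vector list set" where
  "unit_lists k = {vs. length vs = k \<and> (\<forall>v\<in>set vs. norm v \<le> 1)}"

definition op_norm ::
  "nat \<Rightarrow> ('a::real_normed_vector list \<Rightarrow> 'b::real_normed_vector) \<Rightarrow> ennreal" where
  "op_norm k A = (SUP vs\<in>unit_lists k. ennreal (norm (A vs)))"

definition bounded_multilinear ::
  "nat \<Rightarrow> ('a::real_normed_vector list \<Rightarrow> 'b::real_normed_vector) \<Rightarrow> bool" where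
  "bounded_multilinear k A \<longleftrightarrow> multilinear k A \<and> op_norm k A < \<infinity>"

definition gamma_multi ::
  "(int^'m::finite \<Rightarrow> real) \<Rightarrow> nat \<Rightarrow>
   (('m, 'v::real_normed_vector) ell_infty list \<Rightarrow> ('m, 'v) ell_infty) \<Rightarrow> ennreal" where
  "gamma_multi \<Gamma> k A =
     (SUP p\<in>{..<k}. SUP i. SUP l. SUP w\<in>{w. norm w \<le> 1 \<and> supported_at w l}.
        SUP vs\<in>unit_lists (k - 1).
          ennreal (norm (proj i (A (take p vs @ w # drop p vs))) / \<Gamma> (i - l)))"

definition norm_multi ::
  "(int^'m::finite \<Rightarrow> real) \<Rightarrow> nat \<Rightarrow>
   (('m, 'v::real_normed_vector) ell_infty list \<Rightarrow> ('m, 'v) ell_infty) \<Rightarrow> ennreal" where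
  "norm_multi \<Gamma> k A = max (op_norm k A) (gamma_multi \<Gamma> k A)"

definition L_multi ::
  "(int^'m::finite \<Rightarrow> real) \<Rightarrow> nat \<Rightarrow>
   (('m, 'v::real_normed_vector) ell_infty list \<Rightarrow> ('m, 'v) ell_infty) set" where
  "L_multi \<Gamma> k = {A. bounded_multilinear k A \<and> norm_multi \<Gamma> k A < \<infinity>}"

(* D is the family of Frechet derivatives of F on the open set V up to order r, the r-th one being
   continuous. Bounded linear maps into the bounded j-linear maps are identified with bounded
   (j+1)-linear maps: D (j+1) x (h # vs) is the derivative of D j at x in direction h, evaluated
   at vs. Differentiability and continuity of D j are with respect to the operator norm. *)
definition frechet_derivs ::
  "nat \<Rightarrow> 'a::real_normed_vector set \<Rightarrow> ('a \<Rightarrow> 'b::real_normed_vector) \<Rightarrow>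
   (nat \<Rightarrow> 'a \<Rightarrow> 'a list \<Rightarrow> 'b) \<Rightarrow> bool" where
  "frechet_derivs r V F D \<longleftrightarrow>
     (\<forall>x\<in>V. D 0 x [] = F x) \<and>
     (\<forall>j\<le>r. \<forall>x\<in>V. bounded_multilinear j (D j x)) \<and>
     (\<forall>j<r. \<forall>x\<in>V. \<forall>e>0. \<exists>\<delta>>0. \<forall>h. norm h < \<delta> \<longrightarrow> x + h \<in> V \<longrightarrow>
        op_norm j (\<lambda>vs. D j (x + h) vs - D j x vs - D (Suc j) x (h # vs)) \<le> ennreal (e * norm h)) \<and>
     (\<forall>x\<in>V. \<forall>e>0. \<exists>\<delta>>0. \<forall>y\<in>V. norm (y - x) < \<delta> \<longrightarrow>
        op_norm r (\<lambda>vs. D r y vs - D r x vs) \<le> ennreal e)"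

definition C_decay ::
  "(int^'m::finite \<Rightarrow> real) \<Rightarrow> nat \<Rightarrow> ('m, 'v::real_normed_vector) ell_infty set \<Rightarrow>
   (('m, 'v) ell_infty \<Rightarrow> ('m, 'v) ell_infty) set" where
  "C_decay \<Gamma> r V = {F. \<exists>D. frechet_derivs r V F D \<and> bounded (F ` V) \<and>
     (\<forall>j\<in>{1..r}. (\<forall>x\<in>V. D j x \<in> L_multi \<Gamma> j) \<and> (SUP x\<in>V. norm_multi \<Gamma> j (D j x)) < \<infinity>)}"

definition polynomial_decay ::
  "(int^'m::finite \<Rightarrow> real) \<Rightarrow> nat \<Rightarrow>
   (('m, 'v::real_normed_vector) ell_infty \<Rightarrow> ('m, 'v) ell_infty) \<Rightarrow> bool" where
  "polynomial_decay \<Gamma> d H \<longleftrightarrow>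
     (\<exists>P0 P. (\<forall>j\<in>{1..d}. P j \<in> L_multi \<Gamma> j) \<and>
        (\<forall>x. H x = P0 + (\<Sum>j=1..d. P j (replicate j x))))"

definition uncoupled ::
  "('m::finite, 'v::real_normed_vector) ell_infty set \<Rightarrow>
   (('m, 'v) ell_infty \<Rightarrow> ('m, 'v) ell_infty) \<Rightarrow> bool" where
  "uncoupled U F \<longleftrightarrow> (\<forall>i. \<exists>g. \<forall>x\<in>U. proj i (F x) = g (proj i x))"

(* Complex eigenvalues of a real operator: u + iv is an eigenvector, in the complexification of 'v,
   for the eigenvalue z; the two equations are the real and imaginary part of a(u + iv) = z(u + iv). *)
definition complex_spectrum :: "('v::real_normed_vector \<Rightarrow>\<^sub>L 'v) \<Rightarrow> complex set" where
  "complex_spectrum a = {z. \<exists>u v. (u \<noteq> 0 \<or> v \<noteq> 0) \<and>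
     blinfun_apply a u = Re z *\<^sub>R u - Im z *\<^sub>R v \<and>
     blinfun_apply a v = Im z *\<^sub>R u + Re z *\<^sub>R v}"

end

theory Submission
  imports Defs "HOL-Computational_Algebra.Fundamental_Theorem_Algebra"
begin

text \<open>Let \<open>s = r\<^sub>0\<close>, so that \<open>\<beta>\<^sup>s < \<alpha>\<close>, and take for \<open>H = A + N\<close> the Taylor polynomial of degree \<open>s\<close> of \<open>F\<close>
  at \<open>0\<close>. The iteration \<open>R \<mapsto> A\<^sup>-\<^sup>1 (R \<circ> F - N \<circ> R)\<close>, started at the identity, changes \<open>R\<close> only by maps whose
  derivatives of order below \<open>s\<close> vanish at \<open>0\<close>. On such maps all derivatives are controlled by those of order
  \<open>j \<ge> s\<close>, and \<open>R \<mapsto> A\<^sup>-\<^sup>1 (R \<circ> F)\<close> contracts these by a factor close to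
  \<open>\<parallel>A\<^sup>-\<^sup>1\<parallel> \<parallel>A\<parallel>\<^sup>s < 1\<close> in a norm adapted to \<open>a\<close>; after the rescaling \<open>x \<mapsto> F (\<delta> x) / \<delta>\<close> everything
  else is a small perturbation, as is \<open>B\<close>. Decay comes along because the same estimates hold for every member of a
  family of gauges: the adapted supremum norm and, for each site \<open>l\<close>, the least \<open>c\<close> with
  \<open>|x\<^sub>i| \<le> c \<Gamma> (i - l)\<close>. A nodewise cutoff makes the local conjugacy global.\<close>

subsection \<open>Multilinear maps on lists\<close>

text \<open>On jets of low order the map taking \<open>R\<close> to \<open>B (R o F)\<close>, with
  \<open>B\<close> the inverse of \<open>A\<close>, is no contraction: a derivative of order j gains
  the factor \<open>\<theta> ^ j\<close>, and this beats the expansion \<open>\<theta>'\<close> of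
  \<open>B\<close> only from order \<open>s\<close> on. Choosing \<open>N\<close> freezes the orders
  below \<open>s\<close>. Since \<open>R o F\<close> is linear in \<open>R\<close> and
  \<open>N\<close> is a polynomial, consecutive iterates are compared without a derivative of
  \<open>R\<close> beyond order \<open>r\<close>; the additional derivative falls on
  \<open>N\<close>. The second obstacle is that finitely supported families are not dense in the
  bounded ones, so single-site bounds do not by themselves control a map on general arguments. The
  gauges test on families decaying like \<open>\<Gamma>\<close>, which are norm limits of
  truncations. Composition then has to follow just one decaying argument, and the norms with decay
  are recovered at the end because a single-site vector has finite gauge. For the same reason the
  blocks of \<open>A\<close> do not determine \<open>A\<close>; that \<open>F\<^sub>0\<close> is
  uncoupled makes \<open>A\<close> act node by node.\<close>

lemma multilinearD:
  assumes "multilinear k A" "length vs = k" "p < k"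
  shows "linear (\<lambda>w. A (vs[p := w]))"
  using assms by (auto simp: multilinear_def)

lemma multilinear_Cons_head:
  assumes "multilinear (Suc k) A" "length vs = k"
  shows "linear (\<lambda>w. A (w # vs))"
  using multilinearD[OF assms(1), of "0 # vs" 0] assms(2) by simp

lemma multilinear_Cons_tail:
  assumes "multilinear (Suc k) A"
  shows "multilinear k (\<lambda>vs. A (w # vs))"
  unfolding multilinear_def
proof (intro allI impI)
  fix vs :: "'a list" and p assume "length vs = k" "p < k"
  then show "linear (\<lambda>u. A (w # vs[p := u]))"
    using multilinearD[OF assms, of "w # vs" "Suc p"] by simp
qed

text \<open>Pulling the scalars out of all slots at once lets bounds stated on unit arguments be
  rescaled slot by slot.\<close>

lemma multilinear_scale:
  assumes "multilinear k A" "length vs = k" "length cs = k"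
  shows "A (map2 scaleR cs vs) = prod_list cs *\<^sub>R A vs"
  using assms
proof (induction k arbitrary: A vs cs)
  case 0
  then show ?case by simp
next
  case (Suc k)
  obtain v vs' c cs' where [simp]: "vs = v # vs'" "cs = c # cs'"
    using Suc.prems by (metis length_Suc_conv)
  have "A (map2 scaleR cs vs) = A (c *\<^sub>R v # map2 scaleR cs' vs')" by simp
  also have "\<dots> = c *\<^sub>R A (v # map2 scaleR cs' vs')"
    using linear_scale[OF multilinear_Cons_head[OF Suc.prems(1), of "map2 scaleR cs' vs'"]] Suc.prems
    by simp
  also have "A (v # map2 scaleR cs' vs') = prod_list cs' *\<^sub>R A (v # vs')"
    using Suc.IH[OF multilinear_Cons_tail[OF Suc.prems(1)], of vs' cs' v] Suc.prems by simp
  finally show ?case by simp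
qed

text \<open>Changing one slot at a time, from the left, makes each increment linear in the slot that
  changes.\<close>

lemma multilinear_telescope:
  assumes A: "multilinear k A" and us: "length us = k" and vs: "length vs = k"
  shows "A us - A vs = (\<Sum>q<k. A ((take q us @ drop q vs)[q := us ! q - vs ! q]))"
proof -
  define z where "z q = take q us @ drop q vs" for q
  have *: "A (z (Suc q)) - A (z q) = A ((z q)[q := us ! q - vs ! q])" if q: "q < k" for q
  proof -
    have len: "length (z q) = k" using q us vs by (simp add: z_def)
    have 1: "z (Suc q) = (z q)[q := us ! q]"
      using q us vs
      by (intro nth_equalityI) (auto simp: z_def nth_append nth_list_update min_def less_Suc_eq)
    have 2: "z q = (z q)[q := vs ! q]"
      using q us vs by (intro nth_equalityI) (auto simp: z_def nth_append nth_list_update)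
    show ?thesis
      using linear_diff[OF multilinearD[OF A len q], of "us ! q" "vs ! q"] 1 2 by simp
  qed
  have "A us - A vs = A (z k) - A (z 0)" using us vs by (simp add: z_def)
  also have "\<dots> = (\<Sum>q<k. A (z (Suc q)) - A (z q))" by (rule sum_lessThan_telescope[symmetric])
  also have "\<dots> = (\<Sum>q<k. A ((z q)[q := us ! q - vs ! q]))" by (intro sum.cong) (auto simp: *)
  finally show ?thesis by (simp add: z_def)
qed

lemma multilinear_zero_slot:
  assumes "multilinear k A" "length vs = k" "0 \<in> set vs"
  shows "A vs = 0"
proof -
  obtain p where p: "p < k" "vs ! p = 0" using assms by (metis in_set_conv_nth)
  then have "vs = vs[p := 0]" by (metis list_update_id)
  then show ?thesis using linear_0[OF multilinearD[OF assms(1,2) p(1)]] by simp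
qed

section \<open>Operator bounds and the product rule\<close>

definition op_bound :: "nat \<Rightarrow> real \<Rightarrow> ('a::real_normed_vector list \<Rightarrow> 'b::real_normed_vector) \<Rightarrow> bool" where
  "op_bound k C A \<longleftrightarrow> (\<forall>vs\<in>unit_lists k. norm (A vs) \<le> C)"

lemma zero_unit_list: "replicate k 0 \<in> unit_lists k"
  by (auto simp: unit_lists_def)

text \<open>The zero list is a unit list, so a bound is nonnegative without being assumed so.
  \<open>op_bound\<close> keeps \<open>ennreal\<close> out of the analysis.\<close>

lemma op_bound_nonneg: "op_bound k C A \<Longrightarrow> 0 \<le> C"
  using zero_unit_list norm_ge_zero order_trans unfolding op_bound_def by blast

lemma op_bound_mono: "op_bound k C A \<Longrightarrow> C \<le> D \<Longrightarrow> op_bound k D A"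
  unfolding op_bound_def by force

lemma op_bound_add:
  "op_bound k C A \<Longrightarrow> op_bound k D B \<Longrightarrow> op_bound k (C + D) (\<lambda>vs. A vs + B vs)"
  unfolding op_bound_def by (meson norm_triangle_mono)

lemma op_bound_diff:
  "op_bound k C A \<Longrightarrow> op_bound k D B \<Longrightarrow> op_bound k (C + D) (\<lambda>vs. A vs - B vs)"
  unfolding op_bound_def by (smt (verit) norm_triangle_ineq4)

lemma op_norm_le_iff: "0 \<le> C \<Longrightarrow> op_norm k A \<le> ennreal C \<longleftrightarrow> op_bound k C A"
  by (auto simp: op_norm_def op_bound_def SUP_le_iff ennreal_le_iff)

text \<open>Homogeneity: normalising every argument with \<open>sgn\<close> reduces to unit lists. A
  zero argument cannot be normalised and is treated apart, where the value is 0.\<close>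

lemma op_bound_imp:
  assumes A: "multilinear k A" and C: "op_bound k C A" and vs: "length vs = k"
  shows "norm (A vs) \<le> C * prod_list (map norm vs)"
proof (cases "0 \<in> set vs")
  case True
  moreover have "prod_list (map norm vs) \<ge> 0" by (intro prod_list_nonneg) auto
  ultimately show ?thesis using multilinear_zero_slot[OF A vs True] op_bound_nonneg[OF C] by simp
next
  case False
  define us where "us = map sgn vs"
  have eq: "vs = map2 scaleR (map norm vs) us"
    using False by (intro nth_equalityI) (auto simp: us_def sgn_div_norm in_set_conv_nth)
  have "us \<in> unit_lists k" using vs by (auto simp: us_def unit_lists_def norm_sgn)
  then have "norm (A us) \<le> C" using C by (simp add: op_bound_def)
  moreover have "A vs = prod_list (map norm vs) *\<^sub>R A us"
    by (subst eq, subst multilinear_scale[OF A]) (use vs in \<open>auto simp: us_def\<close>)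
  moreover have "prod_list (map norm vs) \<ge> 0" by (intro prod_list_nonneg) auto
  ultimately show ?thesis by (simp add: mult.commute[of C] mult_left_mono abs_of_nonneg)
qed

lemma prod_list_le_power:
  "(\<And>x. x \<in> set xs \<Longrightarrow> 0 \<le> x \<and> x \<le> (c::real)) \<Longrightarrow> prod_list xs \<le> c ^ length xs"
proof (induction xs)
  case (Cons x xs)
  then have "prod_list xs \<ge> 0" by (intro prod_list_nonneg) auto
  moreover have "0 \<le> x" "x \<le> c" using Cons.prems[of x] by auto
  ultimately show ?case using Cons mult_mono[of x c "prod_list xs" "c ^ length xs"] by force
qed simp

lemma has_derivative_zero_at:
  assumes "r x = 0" and "\<And>e. e > 0 \<Longrightarrow> \<forall>\<^sub>F y in nhds x. norm (r y) \<le> e * norm (y - x)"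
  shows "(r has_derivative (\<lambda>_. 0)) (at x)"
  unfolding has_derivative_at_alt
  using assms by (auto simp: eventually_nhds_metric dist_norm)

text \<open>The product rule for a linear map that itself depends on the base point. With the
  argument frozen at \<open>w x\<close>, differentiability of \<open>B\<close> is assumed; the cross
  term \<open>B y - B x\<close> at \<open>w y - w x\<close> is of higher order because
  \<open>w\<close> is Lipschitz at \<open>x\<close> and \<open>B\<close> is continuous there in
  operator norm.\<close>

lemma has_derivative_slot:
  fixes B :: "'a::real_normed_vector \<Rightarrow> 'c::real_normed_vector \<Rightarrow> 'b::real_normed_vector"
  assumes lin: "\<forall>\<^sub>F y in nhds x. linear (B y)" and Bx: "bounded_linear (B x)"
    and cont: "\<And>e. e > 0 \<Longrightarrow> \<forall>\<^sub>F y in nhds x. \<forall>u. norm (B y u - B x u) \<le> e * norm u"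
    and B': "((\<lambda>y. B y (w x)) has_derivative B') (at x)"
    and w: "(w has_derivative w') (at x)"
  shows "((\<lambda>y. B y (w y)) has_derivative (\<lambda>h. B' h + B x (w' h))) (at x)"
proof -
  define q where "q y = B y (w y - w x) - B x (w y - w x)" for y
  obtain L where L: "L > 0" "\<forall>\<^sub>F y in nhds x. norm (w y - w x) \<le> L * norm (y - x)"
  proof -
    from w obtain d K where "bounded_linear w'" "d > 0"
      and d: "\<And>y. norm (y - x) < d \<Longrightarrow> norm (w y - w x - w' (y - x)) \<le> 1 * norm (y - x)"
      unfolding has_derivative_at_alt by (metis zero_less_one)
    then obtain K where K: "K > 0" "\<And>h. norm (w' h) \<le> norm h * K"
      using bounded_linear.pos_bounded by blast
    have "norm (w y - w x) \<le> (1 + K) * norm (y - x)" if "norm (y - x) < d" for y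
      using d[OF that] K(2)[of "y - x"] norm_triangle_sub[of "w y - w x" "w' (y - x)"]
      by (simp add: algebra_simps)
    then have "\<forall>\<^sub>F y in nhds x. norm (w y - w x) \<le> (1 + K) * norm (y - x)"
      using \<open>d > 0\<close> by (auto simp: eventually_nhds_metric dist_norm)
    with K(1) show ?thesis by (intro that[of "1 + K"]) auto
  qed
  have "(q has_derivative (\<lambda>_. 0)) (at x)"
  proof (rule has_derivative_zero_at)
    show "q x = 0" using eventually_nhds_x_imp_x[OF lin] Bx
      by (simp add: q_def linear_0)
    fix e :: real assume "e > 0"
    then have "e / L > 0" using L by simp
    from cont[OF this] L(2) show "\<forall>\<^sub>F y in nhds x. norm (q y) \<le> e * norm (y - x)"
    proof eventually_elim
      case (elim y)
      have "norm (q y) \<le> e / L * norm (w y - w x)" using elim(1) by (simp add: q_def)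
      also have "\<dots> \<le> e / L * (L * norm (y - x))" using elim(2) \<open>e / L > 0\<close>
        by (intro mult_left_mono) auto
      finally show ?case using L by simp
    qed
  qed
  moreover have "((\<lambda>y. B x (w y - w x)) has_derivative (\<lambda>h. B x (w' h))) (at x)"
    using bounded_linear.has_derivative[OF Bx has_derivative_diff[OF w has_derivative_const[of "w x"]]] by simp
  ultimately have "((\<lambda>y. B y (w x) + (B x (w y - w x) + q y)) has_derivative (\<lambda>h. B' h + (B x (w' h) + 0))) (at x)"
    using B' by (intro has_derivative_add)
  then have der: "((\<lambda>y. B y (w x) + (B x (w y - w x) + q y)) has_derivative (\<lambda>h. B' h + B x (w' h))) (at x)" by simp
  have ev: "\<forall>\<^sub>F y in nhds x. B y (w x) + (B x (w y - w x) + q y) = B y (w y)"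
    using lin by eventually_elim (simp add: q_def linear_diff)
  then show ?thesis
    using has_derivative_transform_eventually[OF der, of "\<lambda>y. B y (w y)"]
      eventually_nhds_x_imp_x[OF ev] by (simp add: eventually_at_filter eventually_mono)
qed

lemma op_bound_Cons:
  fixes A :: "'a::real_normed_vector list \<Rightarrow> 'b::real_normed_vector"
  assumes "multilinear (Suc k) A" "op_bound (Suc k) C A"
  shows "op_bound k (C * norm w) (\<lambda>vs. A (w # vs))"
  unfolding op_bound_def
proof
  fix vs :: "'a list" assume vs: "vs \<in> unit_lists k"
  then have "norm (A (w # vs)) \<le> C * (norm w * prod_list (map norm vs))"
    using op_bound_imp[OF assms, of "w # vs"] by (simp add: unit_lists_def)
  moreover have "prod_list (map norm vs) \<le> 1 ^ length (map norm vs)"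
    using vs by (intro prod_list_le_power) (auto simp: unit_lists_def)
  ultimately show "norm (A (w # vs)) \<le> C * norm w"
    using op_bound_nonneg[OF assms(2)]
    by (smt (verit, ccfv_SIG) mult_left_mono mult_right_le_one_le norm_ge_zero power_one prod_list_nonneg
        ex_map_conv)
qed

lemma multilinear_diff:
  assumes "multilinear k A" "multilinear k B"
  shows "multilinear k (\<lambda>vs. A vs - B vs)"
  using assms by (auto simp: multilinear_def intro: linear_compose_sub)

text \<open>Induction on the number of slots. Filling the first slot with \<open>w y\<close> gives a
  family \<open>Q\<close> with one slot fewer that satisfies the same hypotheses;
  \<open>has_derivative_slot\<close> differentiates it with the other arguments frozen.\<close>

lemma has_derivative_multilinear:
  fixes P :: "'a::real_normed_vector \<Rightarrow> 'c::real_normed_vector list \<Rightarrow> 'b::real_normed_vector"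
  assumes "length ws = m" "length ws' = m"
    and "\<forall>\<^sub>F y in nhds x. multilinear m (P y)"
    and "op_bound m C (P x)"
    and "\<And>e. e > 0 \<Longrightarrow> \<forall>\<^sub>F y in nhds x. op_bound m e (\<lambda>vs. P y vs - P x vs)"
    and "\<And>vs. length vs = m \<Longrightarrow> ((\<lambda>y. P y vs) has_derivative P' vs) (at x)"
    and "\<And>q. q < m \<Longrightarrow> ((ws ! q) has_derivative (ws' ! q)) (at x)"
  shows "((\<lambda>y. P y (map (\<lambda>w. w y) ws)) has_derivative
    (\<lambda>h. P' (map (\<lambda>w. w x) ws) h + (\<Sum>q<m. P x ((map (\<lambda>w. w x) ws)[q := (ws' ! q) h])))) (at x)"
  using assms
proof (induction m arbitrary: ws ws' P P' C)
  case 0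
  then show ?case by simp
next
  case (Suc m)
  obtain w us w' us' where [simp]: "ws = w # us" "ws' = w' # us'" and len: "length us = m" "length us' = m"
    using Suc.prems(1,2) by (metis length_Suc_conv)
  note lin = Suc.prems(3) and bd = Suc.prems(4) and cont = Suc.prems(5) and der = Suc.prems(6)
  have linx: "multilinear (Suc m) (P x)" using eventually_nhds_x_imp_x[OF lin] .
  have w: "(w has_derivative w') (at x)" using Suc.prems(7)[of 0] by simp
  have wc: "(w \<longlongrightarrow> w x) (nhds x)"
    using has_derivative_continuous[OF w] by (simp add: isCont_def tendsto_at_iff_tendsto_nhds)
  have C0: "C \<ge> 0" using op_bound_nonneg[OF bd] .
  define Q where "Q = (\<lambda>y vs. P y (w y # vs))"
  define Q' where "Q' = (\<lambda>vs h. P' (w x # vs) h + P x (w' h # vs))"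
  have "((\<lambda>y. Q y (map (\<lambda>w. w y) us)) has_derivative
    (\<lambda>h. Q' (map (\<lambda>w. w x) us) h + (\<Sum>q<m. Q x ((map (\<lambda>w. w x) us)[q := (us' ! q) h])))) (at x)"
  proof (rule Suc.IH[OF len])
    show "\<forall>\<^sub>F y in nhds x. multilinear m (Q y)"
      using lin by eventually_elim (simp add: Q_def multilinear_Cons_tail)
    show "op_bound m (C * norm (w x)) (Q x)"
      unfolding Q_def by (rule op_bound_Cons[OF linx bd])
    show "((us ! q) has_derivative (us' ! q)) (at x)" if "q < m" for q
      using Suc.prems(7)[of "Suc q"] that by simp
    show "\<forall>\<^sub>F y in nhds x. op_bound m e (\<lambda>vs. Q y vs - Q x vs)" if "e > 0" for e
    proof -
      \<comment> \<open>Half of \<open>e\<close> is spent on \<open>P y - P x\<close> at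
        \<open>w y\<close>, half on \<open>P x\<close> at \<open>w y - w x\<close>. The cap 1 in
        \<open>e2\<close> keeps the norm of \<open>w y\<close> below
        \<open>norm (w x) + 1\<close>.\<close>
      define e1 where "e1 = e / (2 * (norm (w x) + 1))"
      define e2 where "e2 = min 1 (e / (2 * (C + 1)))"
      have e1: "e1 > 0" using that by (simp add: e1_def add_nonneg_pos)
      have e2: "e2 > 0" using that C0 by (simp add: e2_def)
      have "\<forall>\<^sub>F y in nhds x. norm (w y - w x) < e2" using tendstoD[OF wc e2] by (simp add: dist_norm)
      with lin cont[OF e1] show ?thesis
      proof eventually_elim
        case (elim y)
        have l: "multilinear (Suc m) (\<lambda>vs. P y vs - P x vs)" using elim(1) linx by (rule multilinear_diff)
        have "norm (w y) \<le> norm (w x) + 1"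
          using elim(3) norm_triangle_sub[of "w y" "w x"] by (simp add: e2_def)
        moreover have "norm (w x) + 1 > 0" by (simp add: add_nonneg_pos)
        then have "e1 * (norm (w x) + 1) = e / 2" by (simp add: e1_def field_simps)
        ultimately have "e1 * norm (w y) \<le> e / 2"
          using e1 by (metis less_imp_le mult_left_mono)
        then have 1: "op_bound m (e / 2) (\<lambda>vs. P y (w y # vs) - P x (w y # vs))"
          by (rule op_bound_mono[OF op_bound_Cons[OF l elim(2)]])
        have "C * norm (w y - w x) \<le> C * (e / (2 * (C + 1)))" 
          using elim(3) C0 by (intro mult_left_mono) (auto simp: e2_def)
        also have "\<dots> \<le> e / 2" using C0 that by (simp add: field_simps)
        finally have 2: "op_bound m (e / 2) (\<lambda>vs. P x ((w y - w x) # vs))"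
          by (rule op_bound_mono[OF op_bound_Cons[OF linx bd]])
        have "op_bound m (e/2 + e/2) (\<lambda>vs. (P y (w y # vs) - P x (w y # vs)) + P x ((w y - w x) # vs))"
          by (rule op_bound_add[OF 1 2])
        then show ?case unfolding op_bound_def Q_def
          using linear_diff[OF multilinear_Cons_head[OF linx]] by (auto simp: unit_lists_def)
      qed
    qed
    show "((\<lambda>y. Q y vs) has_derivative Q' vs) (at x)" if vs: "length vs = m" for vs
      unfolding Q_def Q'_def
    proof (rule has_derivative_slot[where B = "\<lambda>y u. P y (u # vs)"])
      define p where "p = prod_list (map norm vs)"
      have p0: "p \<ge> 0" unfolding p_def by (intro prod_list_nonneg) auto
      show "\<forall>\<^sub>F y in nhds x. linear (\<lambda>u. P y (u # vs))"
        using lin by eventually_elim (rule multilinear_Cons_head[OF _ vs])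
      show "bounded_linear (\<lambda>u. P x (u # vs))"
      proof (rule bounded_linear_intro[where K = "C * p"])
        show "norm (P x (u # vs)) \<le> norm u * (C * p)" for u
          using op_bound_imp[OF linx bd, of "u # vs"] vs by (simp add: p_def algebra_simps)
      qed (use linear_add[OF multilinear_Cons_head[OF linx vs]] linear_scale[OF multilinear_Cons_head[OF linx vs]]
          in auto)
      show "\<forall>\<^sub>F y in nhds x. \<forall>u. norm (P y (u # vs) - P x (u # vs)) \<le> e * norm u" if "e > 0" for e
      proof -
        have "e / (p + 1) > 0" using that p0 by simp
        from lin cont[OF this] show ?thesis
        proof eventually_elim
          case (elim y)
          have l: "multilinear (Suc m) (\<lambda>vs. P y vs - P x vs)" using elim(1) linx by (rule multilinear_diff)
          show ?case
          proof
            fix u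
            have "norm (P y (u # vs) - P x (u # vs)) \<le> e / (p + 1) * (norm u * p)"
              using op_bound_imp[OF l elim(2), of "u # vs"] vs by (simp add: p_def)
            also have "\<dots> = e * norm u * (p / (p + 1))" by simp
            also have "\<dots> \<le> e * norm u" using p0 that by (intro mult_right_le_one_le) auto
            finally show "norm (P y (u # vs) - P x (u # vs)) \<le> e * norm u" .
          qed
        qed
      qed
      show "((\<lambda>y. P y (w x # vs)) has_derivative P' (w x # vs)) (at x)" using der vs by simp
      show "(w has_derivative w') (at x)" by (rule w)
    qed
  qed
  then show ?case
    by (simp add: Q_def Q'_def sum.lessThan_Suc_shift add.assoc del: sum.lessThan_Suc)
qed

subsection \<open>Set partitions and composition of jets\<close>

text \<open>In \<open>parts (h # vs)\<close> the element \<open>h\<close> opens a new block or joins an old one: these are the two ways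
  in which differentiation in direction \<open>h\<close> acts on a term of the Faa di Bruno formula \<open>jcomp\<close>.\<close>

fun parts :: "'a list \<Rightarrow> 'a list list list" where
  "parts [] = [[]]"
| "parts (h # vs) =
     concat (map (\<lambda>\<pi>. ([h] # \<pi>) # map (\<lambda>q. \<pi>[q := h # \<pi> ! q]) [0..<length \<pi>]) (parts vs))"

lemma set_parts_Cons:
  "\<pi> \<in> set (parts (h # vs)) \<longleftrightarrow>
    (\<exists>\<rho>\<in>set (parts vs). \<pi> = [h] # \<rho> \<or> (\<exists>q<length \<rho>. \<pi> = \<rho>[q := h # \<rho> ! q]))"
proof -
  have "set (parts (h # vs)) =
      (\<Union>\<rho>\<in>set (parts vs). insert ([h] # \<rho>) ((\<lambda>q. \<rho>[q := h # \<rho> ! q]) ` {..<length \<rho>}))"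
    by (simp add: atLeast0LessThan)
  then show ?thesis by blast
qed

lemma parts_set: "\<pi> \<in> set (parts vs) \<Longrightarrow> \<Union> (set ` set \<pi>) = set vs"
proof (induction vs arbitrary: \<pi>)
  case (Cons h vs)
  then obtain \<rho> where \<rho>: "\<rho> \<in> set (parts vs)"
    and "\<pi> = [h] # \<rho> \<or> (\<exists>q<length \<rho>. \<pi> = \<rho>[q := h # \<rho> ! q])"
    unfolding set_parts_Cons by blast
  then consider "\<pi> = [h] # \<rho>" | q where "q < length \<rho>" "\<pi> = \<rho>[q := h # \<rho> ! q]" by blast
  then show ?case
  proof cases
    case 2
    have "set \<rho> = insert (\<rho> ! q) (set (take q \<rho>) \<union> set (drop (Suc q) \<rho>))"
      using id_take_nth_drop[OF 2(1)] by (metis Un_insert_right list.simps(15) set_append)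
    moreover have "set \<pi> = insert (h # \<rho> ! q) (set (take q \<rho>) \<union> set (drop (Suc q) \<rho>))"
      using 2 by (simp add: upd_conv_take_nth_drop)
    ultimately show ?thesis using Cons.IH[OF \<rho>] by auto
  qed (use Cons.IH[OF \<rho>] in auto)
qed simp

lemma parts_length: "\<pi> \<in> set (parts vs) \<Longrightarrow> length \<pi> \<le> length vs"
proof (induction vs arbitrary: \<pi>)
  case (Cons h vs)
  then obtain \<rho> where "\<rho> \<in> set (parts vs)"
    and "\<pi> = [h] # \<rho> \<or> (\<exists>q<length \<rho>. \<pi> = \<rho>[q := h # \<rho> ! q])"
    unfolding set_parts_Cons by blast
  with Cons.IH[of \<rho>] show ?case by (metis length_Cons length_list_update not_less_eq_eq le_SucI)
qed simp

lemma parts_block: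
  "\<pi> \<in> set (parts vs) \<Longrightarrow> b \<in> set \<pi> \<Longrightarrow> b \<noteq> [] \<and> length b \<le> length vs"
proof (induction vs arbitrary: \<pi> b)
  case (Cons h vs)
  from Cons.prems(1) obtain \<rho> where \<rho>: "\<rho> \<in> set (parts vs)"
    and "\<pi> = [h] # \<rho> \<or> (\<exists>q<length \<rho>. \<pi> = \<rho>[q := h # \<rho> ! q])"
    unfolding set_parts_Cons by blast
  then have "b = [h] \<or> b \<in> set \<rho> \<or> (\<exists>c\<in>set \<rho>. b = h # c)"
    using Cons.prems(2) set_update_subset_insert by fastforce
  then show ?case using Cons.IH[OF \<rho>] by force
qed simp

text \<open>\<open>parts\<close> never inspects the entries, so partitions are transported along any
  map; hence their number depends on the length alone.\<close>

lemma parts_map: "parts (map f vs) = map (map (map f)) (parts vs)"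
  by (induction vs) (auto simp: map_concat o_def map_update intro!: arg_cong[where f = concat] map_cong)

text \<open>The Bell numbers: \<open>parts\<close> splits positions, so equal entries are kept
  apart.\<close>

definition bell :: "nat \<Rightarrow> nat" where
  "bell j = length (parts (replicate j ()))"

lemma length_parts: "length (parts vs) = bell (length vs)"
proof -
  have "length (parts (map (\<lambda>_. ()) vs)) = length (parts vs)" by (simp add: parts_map)
  moreover have "map (\<lambda>_. ()) vs = replicate (length vs) ()" by (rule map_replicate_const)
  ultimately show ?thesis by (simp add: bell_def)
qed

text \<open>Opening a new block is listed first at every step, so the partition into singletons
  heads the list. It is the only one without a block of length at least 2, which singles out the
  leading term in \<open>jcomp_contraction\<close>.\<close>

lemma parts_singletons:
  "\<exists>ps. parts vs = map (\<lambda>v. [v]) vs # ps \<and> (\<forall>\<pi>\<in>set ps. \<exists>b\<in>set \<pi>. 2 \<le> length b)"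
proof (induction vs)
  case (Cons h vs)
  then obtain ps where ps: "parts vs = map (\<lambda>v. [v]) vs # ps" "\<forall>\<pi>\<in>set ps. \<exists>b\<in>set \<pi>. 2 \<le> length b"
    by blast
  let ?g = "\<lambda>\<pi>. map (\<lambda>q. \<pi>[q := h # \<pi> ! q]) [0..<length \<pi>]"
  have 1: "\<exists>b\<in>set \<pi>. 2 \<le> length b" if "\<pi> \<in> set (?g (map (\<lambda>v. [v]) vs))" for \<pi>
  proof -
    from that obtain q where q: "q < length vs" "\<pi> = (map (\<lambda>v. [v]) vs)[q := h # map (\<lambda>v. [v]) vs ! q]"
      unfolding set_map set_upt length_map by (elim imageE) simp
    then have q: "q < length vs" "\<pi> = (map (\<lambda>v. [v]) vs)[q := [h, vs ! q]]" by simp_all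
    then have "[h, vs ! q] \<in> set \<pi>" by (simp add: set_update_memI)
    then show ?thesis by (rule bexI[rotated]) simp
  qed
  have 2: "\<exists>b\<in>set \<pi>. 2 \<le> length b" if \<rho>: "\<rho> \<in> set ps" and \<pi>: "\<pi> \<in> set (([h] # \<rho>) # ?g \<rho>)" for \<pi> \<rho>
  proof -
    obtain b where b: "b \<in> set \<rho>" "2 \<le> length b" using ps(2) \<rho> by blast
    consider "\<pi> = [h] # \<rho>" | "\<pi> \<in> set (?g \<rho>)" using \<pi> unfolding list.set(2) insert_iff by (elim disjE)
    then consider "\<pi> = [h] # \<rho>" | q where "q < length \<rho>" "\<pi> = \<rho>[q := h # \<rho> ! q]"
    proof cases
      case 2
      then obtain q where "\<pi> = \<rho>[q := h # \<rho> ! q]" "q \<in> {0..<length \<rho>}" unfolding set_map set_upt by (rule imageE)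
      with that(2) show thesis by simp
    qed (use that(1) in simp)
    then show ?thesis
    proof cases
      case 2
      obtain i where i: "i < length \<rho>" "\<rho> ! i = b" using b by (meson in_set_conv_nth)
      then have "i < length \<pi>" "2 \<le> length (\<pi> ! i)" using 2 b by (simp_all add: nth_list_update)
      then have "\<pi> ! i \<in> set \<pi>" "2 \<le> length (\<pi> ! i)" by (simp_all only: nth_mem)
      then show ?thesis by (rule bexI[rotated])
    next
      case 1
      then have "b \<in> set \<pi>" using b(1) by simp
      then show ?thesis using b(2) by (rule bexI[rotated])
    qed
  qed
  have "parts (h # vs) = map (\<lambda>v. [v]) (h # vs) #
      (?g (map (\<lambda>v. [v]) vs) @ concat (map (\<lambda>\<pi>. ([h] # \<pi>) # ?g \<pi>) ps))"
    by (simp add: ps(1))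
  moreover have "\<exists>b\<in>set \<pi>. 2 \<le> length b"
    if "\<pi> \<in> set (?g (map (\<lambda>v. [v]) vs) @ concat (map (\<lambda>\<pi>. ([h] # \<pi>) # ?g \<pi>) ps))" for \<pi>
  proof -
    from that have "\<pi> \<in> set (?g (map (\<lambda>v. [v]) vs)) \<or> (\<exists>\<rho>\<in>set ps. \<pi> \<in> set (([h] # \<rho>) # ?g \<rho>))"
      unfolding set_append set_concat set_map by blast
    then show ?thesis using 1[of \<pi>] 2[of _ \<pi>] by (elim disjE bexE) assumption+
  qed
  ultimately show ?case by (intro exI conjI ballI)
qed simp

text \<open>\<open>S p\<close> stands for the p-th derivative of the outer map at the image point
  and \<open>F i\<close> for the i-th derivative of the inner map; every block fills one slot of the
  outer derivative.\<close>

definition jcomp :: "(nat \<Rightarrow> 'b list \<Rightarrow> 'c::real_vector) \<Rightarrow> (nat \<Rightarrow> 'a list \<Rightarrow> 'b) \<Rightarrow> 'a list \<Rightarrow> 'c" where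
  "jcomp S F vs = (\<Sum>\<pi>\<leftarrow>parts vs. S (length \<pi>) (map (\<lambda>b. F (length b) b) \<pi>))"

lemma jcomp_Nil [simp]: "jcomp S F [] = S 0 []"
  by (simp add: jcomp_def)

lemma sum_list_concat_map: "(\<Sum>x\<leftarrow>concat xss. f x) = (\<Sum>xs\<leftarrow>xss. \<Sum>x\<leftarrow>xs. f x)"
  by (induction xss) auto

text \<open>The recursion of \<open>parts\<close> in exactly the shape that
  \<open>has_derivative_multilinear\<close> produces: a new block differentiates the outer map, an
  enlarged block one inner factor.\<close>

lemma jcomp_Cons:
  "jcomp S F (h # vs) = (\<Sum>\<pi>\<leftarrow>parts vs. S (Suc (length \<pi>)) (F 1 [h] # map (\<lambda>b. F (length b) b) \<pi>) +
     (\<Sum>q<length \<pi>. S (length \<pi>) ((map (\<lambda>b. F (length b) b) \<pi>)[q := F (Suc (length (\<pi> ! q))) (h # \<pi> ! q)])))"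
  by (simp add: jcomp_def sum_list_concat_map o_def map_update interv_sum_list_conv_sum_set_nat
      atLeast0LessThan)

section \<open>Gauges and multilinear estimates in them\<close>

locale gauges =
  fixes TT :: "'w \<Rightarrow> ('e::real_normed_vector \<Rightarrow> 'f::real_normed_vector) set" and w0 :: 'w
  assumes bounded_linear_gauge: "T \<in> TT w \<Longrightarrow> bounded_linear T"
begin

text \<open>The gauge is the supremum of \<open>norm (T x)\<close> over \<open>TT w\<close>; it may
  be infinite, so only its upper bounds are named. Generating it by bounded linear maps makes such
  bounds survive limits and the mean value inequality.\<close>

definition bnd :: "'w \<Rightarrow> real \<Rightarrow> 'e \<Rightarrow> bool" where
  "bnd w c x \<longleftrightarrow> 0 \<le> c \<and> (\<forall>T\<in>TT w. norm (T x) \<le> c)"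

lemma bnd_nonneg: "bnd w c x \<Longrightarrow> 0 \<le> c"
  by (simp add: bnd_def)

lemma bnd_mono: "bnd w c x \<Longrightarrow> c \<le> d \<Longrightarrow> bnd w d x"
  by (force simp: bnd_def)

lemma bnd_zero: "0 \<le> c \<Longrightarrow> bnd w c 0"
  by (auto simp: bnd_def linear_0[OF bounded_linear.linear[OF bounded_linear_gauge]])

lemma bnd_add: "bnd w c x \<Longrightarrow> bnd w d y \<Longrightarrow> bnd w (c + d) (x + y)"
  unfolding bnd_def
  by (auto simp: linear_add[OF bounded_linear.linear[OF bounded_linear_gauge]] intro: norm_triangle_mono)

lemma bnd_scale: "bnd w c x \<Longrightarrow> bnd w (\<bar>s\<bar> * c) (s *\<^sub>R x)"
  unfolding bnd_def
  by (auto simp: linear_scale[OF bounded_linear.linear[OF bounded_linear_gauge]] mult_left_mono)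

lemma bnd_minus: "bnd w c x \<Longrightarrow> bnd w c (- x)"
  using bnd_scale[of w c x "-1"] by simp

lemma bnd_diff: "bnd w c x \<Longrightarrow> bnd w d y \<Longrightarrow> bnd w (c + d) (x - y)"
  using bnd_add[OF _ bnd_minus] by fastforce

lemma bnd_sum:
  "(\<And>i. i \<in> I \<Longrightarrow> bnd w (c i) (f i)) \<Longrightarrow> bnd w (sum c I) (sum f I)"
  by (induction I rule: infinite_finite_induct) (auto intro: bnd_add bnd_zero)

lemma bnd_sum_list:
  "(\<And>p. p \<in> set ps \<Longrightarrow> bnd w c (f p)) \<Longrightarrow> bnd w (real (length ps) * c) (\<Sum>p\<leftarrow>ps. f p)"
proof (induction ps)
  case (Cons p ps)
  then have "bnd w (c + real (length ps) * c) (f p + (\<Sum>p\<leftarrow>ps. f p))" by (intro bnd_add) auto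
  then show ?case by (simp add: algebra_simps)
qed (simp add: bnd_zero)

lemma bnd_limit:
  assumes "\<And>k. bnd w c (x k)" "x \<longlonglongrightarrow> y"
  shows "bnd w c y"
  unfolding bnd_def
proof (intro conjI ballI)
  show "0 \<le> c" using assms(1) bnd_nonneg by blast
  fix T assume T: "T \<in> TT w"
  have "(\<lambda>k. T (x k)) \<longlonglongrightarrow> T y"
    using bounded_linear.tendsto[OF bounded_linear_gauge[OF T] assms(2)] .
  then show "norm (T y) \<le> c"
    using assms(1) T by (intro LIMSEQ_le_const2[OF tendsto_norm]) (auto simp: bnd_def)
qed

text \<open>The gauge \<open>w0\<close> plays the role of the norm. If all arguments are small in norm and one of them is small
  in the gauge \<open>w\<close>, then so is the value; the composition of jets preserves this property.\<close>

definition unitl :: "'w \<Rightarrow> 'e list \<Rightarrow> bool" where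
  "unitl w vs \<longleftrightarrow> (\<forall>v\<in>set vs. bnd w0 1 v) \<and> (w = w0 \<or> (\<exists>v\<in>set vs. bnd w 1 v))"

definition admw :: "'w \<Rightarrow> real \<Rightarrow> nat \<Rightarrow> ('e list \<Rightarrow> 'e) \<Rightarrow> bool" where
  "admw w c j A \<longleftrightarrow> (\<forall>vs. length vs = j \<longrightarrow> unitl w vs \<longrightarrow> bnd w c (A vs))"

lemma admwD: "admw w c j A \<Longrightarrow> length vs = j \<Longrightarrow> unitl w vs \<Longrightarrow> bnd w c (A vs)"
  by (simp add: admw_def)

lemma admw_mono: "admw w c j A \<Longrightarrow> c \<le> d \<Longrightarrow> admw w d j A"
  by (auto simp: admw_def intro: bnd_mono)

lemma admw_add: "admw w c j A \<Longrightarrow> admw w d j B \<Longrightarrow> admw w (c + d) j (\<lambda>vs. A vs + B vs)"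
  by (auto simp: admw_def intro: bnd_add)

lemma admw_diff: "admw w c j A \<Longrightarrow> admw w d j B \<Longrightarrow> admw w (c + d) j (\<lambda>vs. A vs - B vs)"
  by (auto simp: admw_def intro: bnd_diff)

text \<open>Each slot is normalised by its own factor. The slot that is small in \<open>w\<close>
  has to be so with the same factor as in \<open>w0\<close>, so that one division makes it a unit
  vector of both gauges.\<close>

lemma admw_scaled:
  assumes A: "multilinear k A" and c: "admw w c k A" and len: "length ys = k" "length fs = k"
    and fs: "\<And>q. q < k \<Longrightarrow> 0 < fs ! q \<and> bnd w0 (fs ! q) (ys ! q)"
    and w: "w = w0 \<or> (\<exists>q<k. bnd w (fs ! q) (ys ! q))"
  shows "bnd w (c * prod_list fs) (A ys)"
proof -
  define zs where "zs = map2 (\<lambda>f y. (1 / f) *\<^sub>R y) fs ys"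
  have zlen: "length zs = k" using len by (simp add: zs_def)
  have znth: "zs ! q = (1 / fs ! q) *\<^sub>R (ys ! q)" if "q < k" for q using that len by (simp add: zs_def)
  have b: "bnd w' 1 (zs ! q)" if "q < k" "bnd w' (fs ! q) (ys ! q)" for w' q
    using bnd_scale[OF that(2), of "1 / fs ! q"] fs[OF that(1)] znth[OF that(1)] by simp
  have "bnd w0 1 v" if "v \<in> set zs" for v
    using that b fs zlen by (auto simp: in_set_conv_nth)
  moreover have "w = w0 \<or> (\<exists>v\<in>set zs. bnd w 1 v)" using w b zlen by (metis nth_mem)
  ultimately have "unitl w zs" by (simp add: unitl_def)
  then have 1: "bnd w c (A zs)" using admwD[OF c zlen] by blast
  have "ys = map2 scaleR fs zs"
  proof (rule nth_equalityI)
    fix i assume "i < length ys"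
    then show "ys ! i = map2 scaleR fs zs ! i" using len zlen znth fs[of i] by simp
  qed (use len zlen in simp)
  then have "A ys = prod_list fs *\<^sub>R A zs" using multilinear_scale[OF A zlen len(2)] by simp
  moreover have "prod_list fs \<ge> 0" 
    using fs len by (intro prod_list_nonneg) (auto simp: in_set_conv_nth less_imp_le)
  ultimately show ?thesis using bnd_scale[OF 1, of "prod_list fs"] by (simp add: mult.commute)
qed

text \<open>In the hybrid lists of the telescoping sum a slot holds an entry of \<open>us\<close>,
  one of \<open>vs\<close> or their difference. Asking one slot to be small in \<open>w\<close> for
  all three makes every hybrid list admissible. The exact power k - 1 of \<open>\<rho>\<close> is
  rounded up to k.\<close>

lemma admw_telescope:
  assumes A: "multilinear k A" and c: "admw w c k A" "0 \<le> c" and len: "length us = k" "length vs = k"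
    and \<rho>: "1 \<le> \<rho>" and d: "0 < d"
    and b: "\<And>q. q < k \<Longrightarrow> bnd w0 \<rho> (us ! q) \<and> bnd w0 \<rho> (vs ! q) \<and> bnd w0 d (us ! q - vs ! q)"
    and w: "w = w0 \<or> (\<exists>q<k. bnd w \<rho> (us ! q) \<and> bnd w \<rho> (vs ! q) \<and> bnd w d (us ! q - vs ! q))"
  shows "bnd w (real k * (c * d * \<rho> ^ k)) (A us - A vs)"
proof -
  have "bnd w (c * d * \<rho> ^ k) (A ((take q us @ drop q vs)[q := us ! q - vs ! q]))" if q: "q < k" for q
  proof -
    define zs where "zs = (take q us @ drop q vs)[q := us ! q - vs ! q]"
    define fs where "fs = (replicate k \<rho>)[q := d]"
    have zlen: "length zs = k" and flen: "length fs = k" using q len by (auto simp: zs_def fs_def)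
    have znth: "zs ! i = (if i = q then us ! q - vs ! q else if i < q then us ! i else vs ! i)" if "i < k" for i
      using that q len by (auto simp: zs_def nth_append nth_list_update)
    have fnth: "fs ! i = (if i = q then d else \<rho>)" if "i < k" for i
      using that q by (auto simp: fs_def nth_list_update)
    have "bnd w (c * prod_list fs) (A zs)"
    proof (rule admw_scaled[OF A c(1) zlen flen])
      show "0 < fs ! i \<and> bnd w0 (fs ! i) (zs ! i)" if "i < k" for i
        using b[OF that] d \<rho> that by (auto simp: znth fnth)
      show "w = w0 \<or> (\<exists>i<k. bnd w (fs ! i) (zs ! i))" using w by (auto simp: znth fnth)
    qed
    moreover have "prod_list fs \<le> d * \<rho> ^ k"
    proof -
      have "fs = replicate q \<rho> @ d # replicate (k - Suc q) \<rho>"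
        using q by (simp add: fs_def upd_conv_take_nth_drop min_def)
      then have "prod_list fs = d * \<rho> ^ (q + (k - Suc q))" by (simp add: power_add)
      also have "\<dots> \<le> d * \<rho> ^ k" using d \<rho> q by (intro mult_left_mono power_increasing) auto
      finally show ?thesis .
    qed
    ultimately show ?thesis unfolding zs_def[symmetric]
      using c(2) by (elim bnd_mono) (simp add: mult.assoc mult_left_mono)
  qed
  then have "bnd w (\<Sum>q<k. c * d * \<rho> ^ k) (\<Sum>q<k. A ((take q us @ drop q vs)[q := us ! q - vs ! q]))"
    by (intro bnd_sum) auto
  then show ?thesis by (simp add: multilinear_telescope[OF A len])
qed

text \<open>The blocks cover \<open>vs\<close>, so the vector small in \<open>w\<close> lies in one
  of them, and the value on that block is a \<open>w\<close>-small argument of the outer map. This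
  is why composition keeps decay.\<close>

lemma unitl_parts:
  assumes "unitl w vs" "\<pi> \<in> set (parts vs)"
  shows "b \<in> set \<pi> \<Longrightarrow> unitl w0 b" and "w = w0 \<or> (\<exists>b\<in>set \<pi>. unitl w b)"
  using assms(1) parts_set[OF assms(2)] unfolding unitl_def by blast+

text \<open>Outer and inner maps are exchanged in turn: \<open>S' - S\<close> at the new arguments
  costs \<open>e * \<rho> ^ j\<close>, moving the arguments under \<open>S\<close> costs at most j
  terms \<open>c * d * \<rho> ^ j\<close>. The inner bounds are needed in \<open>w0\<close> as well,
  since only one block is known to be small in \<open>w\<close>.\<close>

lemma jcomp_diff:
  assumes S: "\<And>p. p \<le> j \<Longrightarrow> multilinear p (S p) \<and> multilinear p (S' p) \<and>
        admw w e p (\<lambda>vs. S' p vs - S p vs) \<and> admw w c p (S p)"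
    and F: "\<And>w' i. 1 \<le> i \<Longrightarrow> i \<le> j \<Longrightarrow> w' = w \<or> w' = w0 \<Longrightarrow> admw w' \<rho> i (F i) \<and> admw w' \<rho> i (F' i) \<and>
        admw w' d i (\<lambda>vs. F' i vs - F i vs)"
    and \<rho>: "1 \<le> \<rho>" and d: "0 < d" and c: "0 \<le> c" and e: "0 \<le> e"
  shows "admw w (real (bell j) * (e * \<rho> ^ j + real j * (c * d * \<rho> ^ j))) j (\<lambda>vs. jcomp S' F' vs - jcomp S F vs)"
  unfolding admw_def
proof (intro allI impI)
  fix vs assume len: "length vs = j" and u: "unitl w vs"
  define us' where "us' \<pi> = map (\<lambda>b. F' (length b) b) \<pi>" for \<pi>
  define us where "us \<pi> = map (\<lambda>b. F (length b) b) \<pi>" for \<pi>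
  have "bnd w (e * \<rho> ^ j + real j * (c * d * \<rho> ^ j)) (S' (length \<pi>) (us' \<pi>) - S (length \<pi>) (us \<pi>))"
    if \<pi>: "\<pi> \<in> set (parts vs)" for \<pi>
  proof -
    define p where "p = length \<pi>"
    have p: "p \<le> j" using parts_length[OF \<pi>] len by (simp add: p_def)
    have lens: "length (us' \<pi>) = p" "length (us \<pi>) = p" by (auto simp: us_def us'_def p_def)
    have blk: "bnd w' \<rho> (F (length b) b) \<and> bnd w' \<rho> (F' (length b) b) \<and> bnd w' d (F' (length b) b - F (length b) b)"
      if "b \<in> set \<pi>" "unitl w' b" "w' = w \<or> w' = w0" for w' b
    proof -
      have "1 \<le> length b" "length b \<le> j" using parts_block[OF \<pi> that(1)] len
        by (auto simp: Suc_le_eq)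
      from F[OF this that(3)] that(2) show ?thesis by (simp add: admw_def)
    qed
    have B0: "bnd w0 \<rho> (us' \<pi> ! q) \<and> bnd w0 \<rho> (us \<pi> ! q) \<and> bnd w0 d (us' \<pi> ! q - us \<pi> ! q)" if "q < p" for q
      using blk[of "\<pi> ! q" w0] unitl_parts(1)[OF u \<pi>, of "\<pi> ! q"] that by (simp add: us_def us'_def p_def)
    have Bw: "w = w0 \<or> (\<exists>q<p. bnd w \<rho> (us' \<pi> ! q) \<and> bnd w \<rho> (us \<pi> ! q) \<and> bnd w d (us' \<pi> ! q - us \<pi> ! q))"
    proof (cases "w = w0")
      case False
      then obtain b where "b \<in> set \<pi>" "unitl w b" using unitl_parts(2)[OF u \<pi>] by blast
      then obtain q where "q < p" "\<pi> ! q = b" by (auto simp: in_set_conv_nth p_def)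
      then show ?thesis using blk[OF \<open>b \<in> set \<pi>\<close> \<open>unitl w b\<close>] by (auto simp: us_def us'_def p_def)
    qed simp
    have pow: "\<rho> ^ p \<le> \<rho> ^ j" using p \<rho> by (intro power_increasing) auto
    have "bnd w (e * prod_list (replicate p \<rho>)) (S' p (us' \<pi>) - S p (us' \<pi>))"
      by (rule admw_scaled[where A = "\<lambda>vs. S' p vs - S p vs"])
         (use S[OF p] B0 Bw \<rho> lens in \<open>auto intro: multilinear_diff\<close>)
    then have 1: "bnd w (e * \<rho> ^ j) (S' p (us' \<pi>) - S p (us' \<pi>))"
      by (rule bnd_mono) (use e pow in \<open>simp add: mult_left_mono\<close>)
    have "bnd w (real p * (c * d * \<rho> ^ p)) (S p (us' \<pi>) - S p (us \<pi>))"
      by (rule admw_telescope[where A = "S p"]) (use S[OF p] B0 Bw \<rho> lens d c in auto)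
    then have "bnd w (real j * (c * d * \<rho> ^ j)) (S p (us' \<pi>) - S p (us \<pi>))"
      by (rule bnd_mono) (use p c d \<rho> pow in \<open>intro mult_mono; simp\<close>)
    from bnd_add[OF 1 this] show ?thesis by (simp add: p_def)
  qed
  then have "bnd w (real (length (parts vs)) * (e * \<rho> ^ j + real j * (c * d * \<rho> ^ j)))
    (\<Sum>\<pi>\<leftarrow>parts vs. S' (length \<pi>) (us' \<pi>) - S (length \<pi>) (us \<pi>))" by (rule bnd_sum_list)
  then show "bnd w (real (bell j) * (e * \<rho> ^ j + real j * (c * d * \<rho> ^ j))) (jcomp S' F' vs - jcomp S F vs)"
    by (simp add: jcomp_def us_def us'_def sum_list_subtractf length_parts len)
qed

text \<open>This is the difference estimate against the zero outer map, where \<open>c\<close> takes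
  the role of \<open>e\<close>.\<close>

lemma jcomp_bound:
  assumes S: "\<And>p. p \<le> j \<Longrightarrow> multilinear p (S p) \<and> admw w c p (S p)"
    and F: "\<And>w' i. 1 \<le> i \<Longrightarrow> i \<le> j \<Longrightarrow> w' = w \<or> w' = w0 \<Longrightarrow> admw w' \<rho> i (F i)"
    and \<rho>: "1 \<le> \<rho>" and c: "0 \<le> c"
  shows "admw w (real (bell j) * (c * \<rho> ^ j)) j (jcomp S F)"
proof -
  have "admw w (real (bell j) * (c * \<rho> ^ j + real j * (0 * 1 * \<rho> ^ j))) j
      (\<lambda>vs. jcomp S F vs - jcomp (\<lambda>_ _. 0) F vs)"
  proof (rule jcomp_diff)
    show "multilinear p ((\<lambda>_ _. 0 :: 'e) p) \<and> multilinear p (S p) \<and> admw w c p (\<lambda>vs. S p vs - 0) \<and>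
      admw w 0 p (\<lambda>_. 0)" if "p \<le> j" for p
      using S[OF that] by (auto simp: multilinear_def admw_def bnd_zero linear_iff)
    show "admw w' \<rho> i (F i) \<and> admw w' \<rho> i (F i) \<and> admw w' 1 i (\<lambda>vs. F i vs - F i vs)"
      if "1 \<le> i" "i \<le> j" "w' = w \<or> w' = w0" for w' i
      using F[OF that] by (auto simp: admw_def bnd_zero)
  qed (use assms in auto)
  then show ?thesis by (simp add: jcomp_def[abs_def])
qed

text \<open>Only the partition into singletons involves nothing but first derivatives; it gives
  \<open>\<theta> ^ j\<close>. Every other one has a block of length at least 2 and hence a factor
  \<open>\<eta>\<close>, all remaining factors being at most 1.\<close>

lemma jcomp_contraction:
  assumes S: "\<And>p. p \<le> j \<Longrightarrow> multilinear p (S p) \<and> admw w c p (S p)"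
    and F1: "\<And>w'. w' = w \<or> w' = w0 \<Longrightarrow> admw w' \<theta> 1 (F 1)"
    and F: "\<And>w' i. 2 \<le> i \<Longrightarrow> i \<le> j \<Longrightarrow> w' = w \<or> w' = w0 \<Longrightarrow> admw w' \<eta> i (F i)"
    and \<theta>: "0 < \<theta>" "\<theta> \<le> 1" and \<eta>: "0 < \<eta>" "\<eta> \<le> 1" and c: "0 \<le> c"
  shows "admw w (c * (\<theta> ^ j + real (bell j) * \<eta>)) j (jcomp S F)"
  unfolding admw_def
proof (intro allI impI)
  fix vs assume len: "length vs = j" and u: "unitl w vs"
  define us where "us \<pi> = map (\<lambda>b. F (length b) b) \<pi>" for \<pi>
  define fs where "fs = map (\<lambda>b :: 'e list. if 2 \<le> length b then \<eta> else \<theta>)"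
  have trm: "bnd w (c * prod_list (fs \<pi>)) (S (length \<pi>) (us \<pi>))" if \<pi>: "\<pi> \<in> set (parts vs)" for \<pi>
  proof (rule admw_scaled)
    have p: "length \<pi> \<le> j" using parts_length[OF \<pi>] len by simp
    show "multilinear (length \<pi>) (S (length \<pi>))" "admw w c (length \<pi>) (S (length \<pi>))" using S[OF p] by auto
    have blk: "bnd w' (if 2 \<le> length b then \<eta> else \<theta>) (F (length b) b)"
      if "b \<in> set \<pi>" "unitl w' b" "w' = w \<or> w' = w0" for w' b
    proof -
      have "1 \<le> length b" "length b \<le> j" using parts_block[OF \<pi> that(1)] len by (auto simp: Suc_le_eq)
      then consider "length b = 1" | "2 \<le> length b" "length b \<le> j" by linarith
      then show ?thesis using F1[OF that(3)] F[OF _ _ that(3), of "length b"] that(2)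
        by cases (auto simp: admw_def)
    qed
    show "0 < fs \<pi> ! q \<and> bnd w0 (fs \<pi> ! q) (us \<pi> ! q)" if "q < length \<pi>" for q
      using blk[of "\<pi> ! q" w0] unitl_parts(1)[OF u \<pi>, of "\<pi> ! q"] that \<theta> \<eta> by (simp add: us_def fs_def)
    show "w = w0 \<or> (\<exists>q<length \<pi>. bnd w (fs \<pi> ! q) (us \<pi> ! q))"
    proof (cases "w = w0")
      case False
      then obtain b where "b \<in> set \<pi>" "unitl w b" using unitl_parts(2)[OF u \<pi>] by blast
      then obtain q where "q < length \<pi>" "\<pi> ! q = b" by (auto simp: in_set_conv_nth)
      then show ?thesis using blk[OF \<open>b \<in> set \<pi>\<close> \<open>unitl w b\<close>] by (auto simp: us_def fs_def)
    qed simp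
  qed (auto simp: us_def fs_def)
  obtain ps where ps: "parts vs = map (\<lambda>v. [v]) vs # ps" "\<forall>\<pi>\<in>set ps. \<exists>b\<in>set \<pi>. 2 \<le> length b"
    using parts_singletons by blast
  let ?s = "map (\<lambda>v. [v]) vs"
  have "fs ?s = replicate j \<theta>" by (simp add: fs_def o_def map_replicate_const len)
  then have 1: "bnd w (c * \<theta> ^ j) (S (length ?s) (us ?s))" using trm[of ?s] ps(1) by simp
  have "bnd w (c * \<eta>) (S (length \<pi>) (us \<pi>))" if \<pi>: "\<pi> \<in> set ps" for \<pi>
  proof -
    obtain b where b: "b \<in> set \<pi>" "2 \<le> length b" using ps(2) \<pi> by blast
    then obtain p1 p2 where sp: "\<pi> = p1 @ b # p2" by (meson split_list)
    have fs01: "0 \<le> x \<and> x \<le> 1" if "x \<in> set (fs q)" for q x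
      using that \<theta> \<eta> by (auto simp: fs_def split: if_splits)
    have "prod_list (fs q) \<le> 1" "0 \<le> prod_list (fs q)" for q
      using prod_list_le_power[of "fs q" 1] fs01[of _ q] by (auto intro!: prod_list_nonneg)
    then have "prod_list (fs p1) * prod_list (fs p2) \<le> 1" by (simp add: mult_le_one)
    then have "prod_list (fs \<pi>) \<le> \<eta>" using b \<eta>
      by (simp add: sp fs_def mult_left_le mult.left_commute)
    then have "c * prod_list (fs \<pi>) \<le> c * \<eta>" using c by (rule mult_left_mono)
    then show ?thesis using bnd_mono[OF trm] \<pi> ps(1) by simp
  qed
  then have 2: "bnd w (real (length ps) * (c * \<eta>)) (\<Sum>\<pi>\<leftarrow>ps. S (length \<pi>) (us \<pi>))" by (rule bnd_sum_list)
  have "real (length ps) \<le> real (bell j)" using length_parts[of vs] ps(1) len by simp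
  then have "real (length ps) * (c * \<eta>) \<le> real (bell j) * (c * \<eta>)" using c \<eta> by (intro mult_right_mono) auto
  then have "bnd w (c * \<theta> ^ j + real (bell j) * (c * \<eta>)) (jcomp S F vs)"
    using bnd_mono[OF bnd_add[OF 1 2]] by (simp add: jcomp_def us_def ps(1))
  then show "bnd w (c * (\<theta> ^ j + real (bell j) * \<eta>)) (jcomp S F vs)" by (simp add: algebra_simps)
qed

end

subsection \<open>Families of derivatives\<close>

text \<open>All orders are bounded on \<open>V\<close> and continuous in operator norm, but
  differentiability is asked only with the arguments \<open>vs\<close> fixed. This form passes
  through compositions and limits; on a convex open set the mean value inequality recovers
  differentiability in operator norm.\<close>

definition smooth_family ::
  "nat \<Rightarrow> 'a::real_normed_vector set \<Rightarrow> (nat \<Rightarrow> 'a \<Rightarrow> 'a list \<Rightarrow> 'b::real_normed_vector) \<Rightarrow> bool" where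
  "smooth_family r V D \<longleftrightarrow>
     (\<forall>j\<le>r. \<exists>C. \<forall>x\<in>V. op_bound j C (D j x)) \<and>
     (\<forall>j\<le>r. \<forall>x\<in>V. \<forall>e>0. \<exists>d>0. \<forall>y\<in>V. norm (y - x) < d \<longrightarrow> op_bound j e (\<lambda>vs. D j y vs - D j x vs)) \<and>
     (\<forall>j<r. \<forall>x\<in>V. \<forall>vs. length vs = j \<longrightarrow>
        ((\<lambda>y. D j y vs) has_derivative (\<lambda>h. D (Suc j) x (h # vs))) (at x))"

lemma smooth_family_ex_bound:
  assumes "smooth_family r V D" "j \<le> r"
  shows "\<exists>C. \<forall>x\<in>V. op_bound j C (D j x)"
  using conjunct1[OF assms(1)[unfolded smooth_family_def]] assms(2) by simp

lemma smooth_family_bound: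
  assumes "smooth_family r V D" "j \<le> r"
  obtains C where "\<And>x. x \<in> V \<Longrightarrow> op_bound j C (D j x)" "C \<ge> 1"
proof -
  obtain C where C: "\<forall>x\<in>V. op_bound j C (D j x)" using smooth_family_ex_bound[OF assms] by (elim exE)
  show ?thesis by (rule that[of "max C 1"]) (use C in \<open>auto intro: op_bound_mono\<close>)
qed

lemma smooth_family_bounds:
  assumes "smooth_family r V D"
  obtains C where "\<And>x j. x \<in> V \<Longrightarrow> j \<le> r \<Longrightarrow> op_bound j C (D j x)" "C \<ge> 1"
proof -
  obtain c where c: "\<And>j x. j \<le> r \<Longrightarrow> x \<in> V \<Longrightarrow> op_bound j (c j) (D j x)"
    using smooth_family_ex_bound[OF assms] by metis
  have "op_bound j (Max (insert 1 (c ` {..r}))) (D j x)" if "j \<le> r" "x \<in> V" for j x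
    using c[OF that] by (rule op_bound_mono) (use that in \<open>intro Max_ge; simp\<close>)
  then show ?thesis by (intro that) auto
qed

lemma smooth_family_cont:
  assumes "smooth_family r V D" "j \<le> r" "x \<in> V" "e > 0"
  shows "\<exists>d>0. \<forall>y\<in>V. norm (y - x) < d \<longrightarrow> op_bound j e (\<lambda>vs. D j y vs - D j x vs)"
  using conjunct1[OF conjunct2[OF assms(1)[unfolded smooth_family_def]]] assms(2-4) by simp

lemma smooth_family_eventually:
  assumes "smooth_family r V D" "j \<le> r" "open V" "x \<in> V" "e > 0"
  shows "\<forall>\<^sub>F y in nhds x. op_bound j e (\<lambda>vs. D j y vs - D j x vs)"
proof -
  obtain d where d: "d > 0" "\<forall>y\<in>V. norm (y - x) < d \<longrightarrow> op_bound j e (\<lambda>vs. D j y vs - D j x vs)"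
    using smooth_family_cont[OF assms(1,2,4,5)] by blast
  have "\<forall>\<^sub>F y in nhds x. y \<in> V \<and> norm (y - x) < d"
    using d(1) assms(3,4) eventually_nhds_metric[of "\<lambda>y. norm (y - x) < d" x]
    by (intro eventually_conj eventually_nhds_in_open) (auto simp: dist_norm)
  then show ?thesis by eventually_elim (use d in auto)
qed

lemma smooth_family_deriv:
  assumes "smooth_family r V D" "j < r" "x \<in> V" "length vs = j"
  shows "((\<lambda>y. D j y vs) has_derivative (\<lambda>h. D (Suc j) x (h # vs))) (at x)"
  using conjunct2[OF conjunct2[OF assms(1)[unfolded smooth_family_def]]] assms(2-4) by simp

lemma smooth_familyI:
  assumes "\<And>j. j \<le> r \<Longrightarrow> \<exists>C. \<forall>x\<in>V. op_bound j C (D j x)"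
    and "\<And>j x e. j \<le> r \<Longrightarrow> x \<in> V \<Longrightarrow> e > 0 \<Longrightarrow>
      \<exists>d>0. \<forall>y\<in>V. norm (y - x) < d \<longrightarrow> op_bound j e (\<lambda>vs. D j y vs - D j x vs)"
    and "\<And>j x vs. j < r \<Longrightarrow> x \<in> V \<Longrightarrow> length vs = j \<Longrightarrow>
      ((\<lambda>y. D j y vs) has_derivative (\<lambda>h. D (Suc j) x (h # vs))) (at x)"
  shows "smooth_family r V D"
  unfolding smooth_family_def using assms by simp

lemma smooth_family_less:
  assumes "smooth_family r V D" "s \<le> r"
  shows "smooth_family s V D"
proof (rule smooth_familyI)
  show "\<exists>C. \<forall>x\<in>V. op_bound j C (D j x)" if "j \<le> s" for j
    using smooth_family_ex_bound[OF assms(1), of j] that assms(2) by simp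
  show "\<exists>d>0. \<forall>y\<in>V. norm (y - x) < d \<longrightarrow> op_bound j e (\<lambda>vs. D j y vs - D j x vs)"
    if "j \<le> s" "x \<in> V" "e > 0" for j x e
    using smooth_family_cont[OF assms(1), of j x e] that assms(2) by simp
  show "((\<lambda>y. D j y vs) has_derivative (\<lambda>h. D (Suc j) x (h # vs))) (at x)"
    if "j < s" "x \<in> V" "length vs = j" for j x vs
    using smooth_family_deriv[OF assms(1), of j x vs] that assms(2) by simp
qed

lemma smooth_family_subset:
  assumes "smooth_family r V D" "W \<subseteq> V"
  shows "smooth_family r W D"
proof (rule smooth_familyI)
  show "\<exists>C. \<forall>x\<in>W. op_bound j C (D j x)" if "j \<le> r" for j
    using smooth_family_ex_bound[OF assms(1) that] assms(2) by blast
  show "\<exists>d>0. \<forall>y\<in>W. norm (y - x) < d \<longrightarrow> op_bound j e (\<lambda>vs. D j y vs - D j x vs)"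
    if "j \<le> r" "x \<in> W" "e > 0" for j x e
    using smooth_family_cont[OF assms(1) that(1) _ that(3), of x] that(2) assms(2) by blast
  show "((\<lambda>y. D j y vs) has_derivative (\<lambda>h. D (Suc j) x (h # vs))) (at x)"
    if "j < r" "x \<in> W" "length vs = j" for j x vs
    using smooth_family_deriv[OF assms(1), of j x vs] that assms(2) by blast
qed

text \<open>Multilinearity propagates from each derivative to the next by uniqueness of derivatives, so it
  need not be part of \<^const>\<open>smooth_family\<close>.\<close>

lemma multilinear_derivs:
  assumes V: "open V"
    and der: "\<And>j x vs. j < r \<Longrightarrow> x \<in> V \<Longrightarrow> length vs = j \<Longrightarrow>
      ((\<lambda>y. D j y vs) has_derivative (\<lambda>h. D (Suc j) x (h # vs))) (at x)"
  shows "j \<le> r \<Longrightarrow> x \<in> V \<Longrightarrow> multilinear j (D j x)"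
proof (induction j arbitrary: x)
  case 0
  then show ?case by (simp add: multilinear_def)
next
  case (Suc j)
  note IH = Suc.IH[OF Suc_leD[OF Suc.prems(1)]]
  show ?case
    unfolding multilinear_def
  proof (intro allI impI)
    fix vs :: "'a list" and p assume len: "length vs = Suc j" and p: "p < Suc j"
    then obtain h us where vs: "vs = h # us" "length us = j" by (metis length_Suc_conv)
    show "linear (\<lambda>w. D (Suc j) x (vs[p := w]))"
    proof (cases p)
      case 0
      then show ?thesis
        using has_derivative_linear[OF der[of j x us]] Suc.prems vs by simp
    next
      case (Suc q)
      with p have q: "q < j" by simp
      define f where "f = (\<lambda>u y. D j y (us[q := u]))"
      define f' where "f' = (\<lambda>u h. D (Suc j) x (h # us[q := u]))"
      have f': "(f u has_derivative f' u) (at x)" for u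
        unfolding f_def f'_def using der Suc.prems vs by simp
      have lin: "linear (\<lambda>u. f u y)" if "y \<in> V" for y
        using multilinearD[OF IH[OF that] vs(2) q] by (simp add: f_def)
      have "f' (u + v) h = f' u h + f' v h" for u v
      proof -
        have "((\<lambda>y. f u y + f v y) has_derivative (\<lambda>h. f' u h + f' v h)) (at x)"
          by (intro has_derivative_add f')
        then have "(f (u + v) has_derivative (\<lambda>h. f' u h + f' v h)) (at x)"
          by (rule has_derivative_transform_within_open[OF _ V Suc.prems(2)]) (simp add: linear_add[OF lin])
        then show ?thesis using has_derivative_unique[OF f'] by metis
      qed
      moreover have "f' (c *\<^sub>R u) h = c *\<^sub>R f' u h" for u c
      proof -
        have "((\<lambda>y. c *\<^sub>R f u y) has_derivative (\<lambda>h. c *\<^sub>R f' u h)) (at x)"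
          by (intro has_derivative_scaleR_right f')
        then have "(f (c *\<^sub>R u) has_derivative (\<lambda>h. c *\<^sub>R f' u h)) (at x)"
          by (rule has_derivative_transform_within_open[OF _ V Suc.prems(2)]) (simp add: linear_scale[OF lin])
        then show ?thesis using has_derivative_unique[OF f'] by metis
      qed
      ultimately show ?thesis using Suc vs by (simp add: f'_def linear_iff)
    qed
  qed
qed

lemma smooth_family_multilinear:
  assumes "smooth_family r V D" "open V" "j \<le> r" "x \<in> V"
  shows "multilinear j (D j x)"
  by (rule multilinear_derivs[OF assms(2) _ assms(3,4)]) (rule smooth_family_deriv[OF assms(1)])

text \<open>The one-variable inequality along the segment. The vector \<open>c\<close> serves two
  uses: 0 gives a Lipschitz bound, \<open>f' x (y - x)\<close> a bound on the first-order
  remainder.\<close>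

lemma mean_value_bound:
  fixes f :: "'a::real_normed_vector \<Rightarrow> 'b::real_normed_vector"
  assumes V: "convex V" "x \<in> V" "y \<in> V" and der: "\<And>z. z \<in> V \<Longrightarrow> (f has_derivative f' z) (at z)"
    and B: "\<And>z. z \<in> V \<Longrightarrow> norm (f' z (y - x) - c) \<le> B"
  shows "norm (f y - f x - c) \<le> B"
proof -
  define g where "g t = f (x + t *\<^sub>R (y - x)) - t *\<^sub>R c" for t
  have seg: "x + t *\<^sub>R (y - x) \<in> V" if "t \<in> {0..1}" for t
    using convexD_alt[OF V, of t] that by (simp add: algebra_simps)
  have "norm (g 1 - g 0) \<le> B * norm (1 - 0 :: real)"
  proof (rule differentiable_bound)
    fix t :: real assume t: "t \<in> {0..1}"
    let ?z = "x + t *\<^sub>R (y - x)"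
    have "((\<lambda>t. x + t *\<^sub>R (y - x)) has_derivative (\<lambda>s. s *\<^sub>R (y - x))) (at t within {0..1})"
      by (auto intro!: derivative_eq_intros)
    from has_derivative_compose[OF this der[OF seg[OF t]]]
    have "((\<lambda>t. f (x + t *\<^sub>R (y - x))) has_derivative (\<lambda>s. f' ?z (s *\<^sub>R (y - x)))) (at t within {0..1})" .
    then show "(g has_derivative (\<lambda>s. f' ?z (s *\<^sub>R (y - x)) - s *\<^sub>R c)) (at t within {0..1})"
      unfolding g_def by (intro has_derivative_diff has_derivative_scaleR_left has_derivative_ident)
    show "onorm (\<lambda>s. f' ?z (s *\<^sub>R (y - x)) - s *\<^sub>R c) \<le> B"
    proof (rule onorm_le)
      fix s :: real
      have "f' ?z (s *\<^sub>R (y - x)) - s *\<^sub>R c = s *\<^sub>R (f' ?z (y - x) - c)"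
        using linear_scale[OF has_derivative_linear[OF der[OF seg[OF t]]], of s "y - x"]
        by (simp add: scaleR_diff_right)
      then show "norm (f' ?z (s *\<^sub>R (y - x)) - s *\<^sub>R c) \<le> B * norm s"
        using mult_left_mono[OF B[OF seg[OF t]], of "\<bar>s\<bar>"] by (simp add: mult.commute)
    qed
  qed auto
  then show ?thesis by (simp add: g_def algebra_simps)
qed

text \<open>On a convex set a bound on order j + 1 makes order j Lipschitz, so continuity up to
  order \<open>r\<close> is paid for by one further bounded order.\<close>

lemma smooth_familyI_bounded:
  assumes V: "open V" "convex V"
    and bd: "\<And>j. j \<le> Suc r \<Longrightarrow> \<exists>C. \<forall>x\<in>V. op_bound j C (D j x)"
    and der: "\<And>j x vs. j \<le> r \<Longrightarrow> x \<in> V \<Longrightarrow> length vs = j \<Longrightarrow>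
      ((\<lambda>y. D j y vs) has_derivative (\<lambda>h. D (Suc j) x (h # vs))) (at x)"
  shows "smooth_family r V D"
proof (rule smooth_familyI)
  have ml: "multilinear j (D j x)" if "j \<le> Suc r" "x \<in> V" for j x
    by (rule multilinear_derivs[OF V(1) _ that]) (use der in auto)
  fix j x and e :: real assume j: "j \<le> r" and x: "x \<in> V" and e: "e > 0"
  obtain C where "\<forall>x\<in>V. op_bound (Suc j) C (D (Suc j) x)" using bd[of "Suc j"] j by auto
  then have C: "\<And>x. x \<in> V \<Longrightarrow> op_bound (Suc j) C (D (Suc j) x)" by blast
  have C0: "C \<ge> 0" using op_bound_nonneg[OF C[OF x]] .
  have "op_bound j e (\<lambda>vs. D j y vs - D j x vs)" if y: "y \<in> V" "norm (y - x) < e / (C + 1)" for y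
    unfolding op_bound_def
  proof
    fix vs :: "'a list" assume vs: "vs \<in> unit_lists j"
    then have len: "length vs = j" by (simp add: unit_lists_def)
    have "norm (D j y vs - D j x vs - 0) \<le> C * norm (y - x)"
    proof (rule mean_value_bound[OF V(2) x y(1) der[OF j _ len]])
      show "norm (D (Suc j) z ((y - x) # vs) - 0) \<le> C * norm (y - x)" if "z \<in> V" for z
        using op_bound_Cons[OF ml[OF _ that] C[OF that], of "y - x"] vs j by (auto simp: op_bound_def)
    qed
    also have "\<dots> \<le> (C + 1) * norm (y - x)" by (simp add: algebra_simps)
    also have "\<dots> \<le> e" using y(2) C0 by (simp add: field_simps)
    finally show "norm (D j y vs - D j x vs) \<le> e" by simp
  qed
  then show "\<exists>d>0. \<forall>y\<in>V. norm (y - x) < d \<longrightarrow> op_bound j e (\<lambda>vs. D j y vs - D j x vs)"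
    using e C0 by (intro exI[of _ "e / (C + 1)"]) auto
qed (use bd der in auto)

text \<open>Continuity of order j + 1 at \<open>x\<close> bounds the remainder of order j, uniformly
  over unit lists, by the mean value inequality on the convex set
  \<open>V \<inter> ball x d\<close>.\<close>

lemma smooth_family_imp_frechet_derivs:
  assumes S: "smooth_family r V D" and V: "open V" "convex V" and F: "\<And>x. x \<in> V \<Longrightarrow> D 0 x [] = F x"
  shows "frechet_derivs r V F D"
  unfolding frechet_derivs_def
proof (intro conjI allI impI ballI)
  fix j x assume "j \<le> r" "x \<in> V"
  moreover obtain C where "\<And>x. x \<in> V \<Longrightarrow> op_bound j C (D j x)" "C \<ge> 1"
    using smooth_family_bound[OF S \<open>j \<le> r\<close>] by blast
  ultimately show "bounded_multilinear j (D j x)"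
    using smooth_family_multilinear[OF S V(1)] op_norm_le_iff[of C j "D j x"]
    by (auto simp: bounded_multilinear_def top.not_eq_extremum[symmetric] top_unique)
next
  fix j x and e :: real assume j: "j < r" and x: "x \<in> V" and e: "e > 0"
  obtain d where d: "d > 0" "\<forall>y\<in>V. norm (y - x) < d \<longrightarrow>
      op_bound (Suc j) e (\<lambda>vs. D (Suc j) y vs - D (Suc j) x vs)"
    using smooth_family_cont[OF S _ x e, of "Suc j"] j by auto
  have "op_norm j (\<lambda>vs. D j (x + h) vs - D j x vs - D (Suc j) x (h # vs)) \<le> ennreal (e * norm h)"
    if h: "norm h < d" "x + h \<in> V" for h
  proof -
    let ?W = "V \<inter> ball x d"
    have W: "convex ?W" "x \<in> ?W" "x + h \<in> ?W" using V x h d(1)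
      by (auto simp: dist_norm intro: convex_Int)
    have "op_bound j (e * norm h) (\<lambda>vs. D j (x + h) vs - D j x vs - D (Suc j) x (h # vs))"
      unfolding op_bound_def
    proof
      fix vs :: "'a list" assume vs: "vs \<in> unit_lists j"
      then have len: "length vs = j" by (simp add: unit_lists_def)
      show "norm (D j (x + h) vs - D j x vs - D (Suc j) x (h # vs)) \<le> e * norm h"
      proof (rule mean_value_bound[OF W])
        fix z assume z: "z \<in> ?W"
        then show "((\<lambda>y. D j y vs) has_derivative (\<lambda>h. D (Suc j) z (h # vs))) (at z)"
          using smooth_family_deriv[OF S j _ len] by simp
        have ml: "multilinear (Suc j) (\<lambda>vs. D (Suc j) z vs - D (Suc j) x vs)"
          using z x j smooth_family_multilinear[OF S V(1)] by (intro multilinear_diff) auto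
        have "op_bound (Suc j) e (\<lambda>vs. D (Suc j) z vs - D (Suc j) x vs)"
          using d z by (simp add: dist_norm norm_minus_commute)
        from op_bound_Cons[OF ml this, of h]
        show "norm (D (Suc j) z ((x + h - x) # vs) - D (Suc j) x (h # vs)) \<le> e * norm h"
          using vs by (simp add: op_bound_def)
      qed
    qed
    then show ?thesis using e by (subst op_norm_le_iff) auto
  qed
  then show "\<exists>d>0. \<forall>h. norm h < d \<longrightarrow> x + h \<in> V \<longrightarrow>
      op_norm j (\<lambda>vs. D j (x + h) vs - D j x vs - D (Suc j) x (h # vs)) \<le> ennreal (e * norm h)"
    using d(1) by blast
next
  fix x and e :: real assume "x \<in> V" "e > 0"
  from smooth_family_cont[OF S order_refl this]
  show "\<exists>d>0. \<forall>y\<in>V. norm (y - x) < d \<longrightarrow> op_norm r (\<lambda>vs. D r y vs - D r x vs) \<le> ennreal e"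
    using \<open>e > 0\<close> by (simp add: op_norm_le_iff)
qed (rule F)

text \<open>\<open>frechet_derivs\<close> states continuity for the top order only. Below it,
  continuity at \<open>x\<close> comes from the expansion at \<open>x\<close> with error constant 1
  and the bound on the next order.\<close>

lemma frechet_derivs_imp_smooth_family:
  assumes F: "frechet_derivs r V F D" and V: "open V"
    and bd: "\<And>j. j \<le> r \<Longrightarrow> \<exists>C. \<forall>x\<in>V. op_bound j C (D j x)"
  shows "smooth_family r V D"
proof -
  note F' = F[unfolded frechet_derivs_def]
  note F_ml = conjunct1[OF conjunct2[OF F']]
    and F_diff = conjunct1[OF conjunct2[OF conjunct2[OF F']]]
    and F_cont = conjunct2[OF conjunct2[OF conjunct2[OF F']]]
  have ml: "multilinear j (D j x)" if "j \<le> r" "x \<in> V" for j x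
    using F_ml that by (simp add: bounded_multilinear_def)
  have diff: "\<exists>d>0. \<forall>h. norm h < d \<longrightarrow>
      x + h \<in> V \<and> op_bound j (e * norm h) (\<lambda>vs. D j (x + h) vs - D j x vs - D (Suc j) x (h # vs))"
    if j: "j < r" and x: "x \<in> V" and e: "e > 0" for j x e
  proof -
    obtain d1 where d1: "d1 > 0" "\<And>h. norm h < d1 \<Longrightarrow> x + h \<in> V \<Longrightarrow>
        op_norm j (\<lambda>vs. D j (x + h) vs - D j x vs - D (Suc j) x (h # vs)) \<le> ennreal (e * norm h)"
      using F_diff[rule_format, OF j x e] by blast
    obtain d2 where d2: "d2 > 0" "ball x d2 \<subseteq> V" using V x by (meson openE)
    have "x + h \<in> V" if "norm h < d2" for h
      using d2(2) that by (auto simp: subset_iff dist_norm)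
    then show ?thesis using d1 d2(1) e
      by (intro exI[of _ "min d1 d2"]) (auto simp: op_norm_le_iff[symmetric])
  qed
  have cont: "\<exists>d>0. \<forall>y\<in>V. norm (y - x) < d \<longrightarrow> op_bound j e (\<lambda>vs. D j y vs - D j x vs)"
    if j: "j \<le> r" and x: "x \<in> V" and e: "e > 0" for j x e
  proof (cases "j = r")
    case True
    obtain d where "d > 0" "\<forall>y\<in>V. norm (y - x) < d \<longrightarrow> op_norm r (\<lambda>vs. D r y vs - D r x vs) \<le> ennreal e"
      using F_cont[rule_format, OF x e] by blast
    then show ?thesis using True e by (auto simp: op_norm_le_iff)
  next
    case False
    then have j': "j < r" using j by simp
    obtain C where "\<forall>x\<in>V. op_bound (Suc j) C (D (Suc j) x)" using bd[of "Suc j"] j' by auto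
    with x have C: "op_bound (Suc j) C (D (Suc j) x)" by blast
    have C0: "C \<ge> 0" using op_bound_nonneg[OF C] .
    obtain d where d: "d > 0" "\<forall>h. norm h < d \<longrightarrow>
      x + h \<in> V \<and> op_bound j (1 * norm h) (\<lambda>vs. D j (x + h) vs - D j x vs - D (Suc j) x (h # vs))"
      using diff[OF j' x zero_less_one] by blast
    have "op_bound j e (\<lambda>vs. D j y vs - D j x vs)" if y: "norm (y - x) < min d (e / (C + 1))" for y
    proof -
      have 1: "op_bound j (1 * norm (y - x)) (\<lambda>vs. D j y vs - D j x vs - D (Suc j) x ((y - x) # vs))"
        using d(2)[rule_format, of "y - x"] y by simp
      have "op_bound j (1 * norm (y - x) + C * norm (y - x))
         (\<lambda>vs. (D j y vs - D j x vs - D (Suc j) x ((y - x) # vs)) + D (Suc j) x ((y - x) # vs))"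
        by (rule op_bound_add[OF 1 op_bound_Cons[OF ml[OF _ x] C]]) (use j' in simp)
      then have "op_bound j (1 * norm (y - x) + C * norm (y - x)) (\<lambda>vs. D j y vs - D j x vs)" by simp
      then show ?thesis
        by (rule op_bound_mono) (use y C0 in \<open>simp add: field_simps\<close>)
    qed
    then show ?thesis using d(1) e C0 by (intro exI[of _ "min d (e / (C + 1))"]) auto
  qed
  have der: "((\<lambda>y. D j y vs) has_derivative (\<lambda>h. D (Suc j) x (h # vs))) (at x)"
    if j: "j < r" and x: "x \<in> V" and len: "length vs = j" for j x vs
  proof -
    obtain C where "\<forall>x\<in>V. op_bound (Suc j) C (D (Suc j) x)" using bd[of "Suc j"] j by auto
    with x have C: "op_bound (Suc j) C (D (Suc j) x)" by blast
    have mlx: "multilinear (Suc j) (D (Suc j) x)" using ml j x by simp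
    define p where "p = prod_list (map norm vs)"
    have p0: "p \<ge> 0" unfolding p_def by (intro prod_list_nonneg) auto
    have bl: "bounded_linear (\<lambda>h. D (Suc j) x (h # vs))"
    proof (rule bounded_linear_intro[where K = "C * p"])
      show "norm (D (Suc j) x (h # vs)) \<le> norm h * (C * p)" for h
        using op_bound_imp[OF mlx C, of "h # vs"] len by (simp add: p_def algebra_simps)
    qed (use linear_add[OF multilinear_Cons_head[OF mlx len]] linear_scale[OF multilinear_Cons_head[OF mlx len]]
        in auto)
    show ?thesis unfolding has_derivative_at_alt
    proof (intro conjI bl allI impI)
      fix e :: real assume e: "e > 0"
      then have "e / (p + 1) > 0" using p0 by simp
      then obtain d where d: "d > 0" "\<forall>h. norm h < d \<longrightarrow> x + h \<in> V \<and> op_bound j (e / (p + 1) * norm h)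
          (\<lambda>vs. D j (x + h) vs - D j x vs - D (Suc j) x (h # vs))"
        using diff[OF j x] by blast
      have "norm (D j y vs - D j x vs - D (Suc j) x ((y - x) # vs)) \<le> e * norm (y - x)"
        if y: "norm (y - x) < d" for y
      proof -
        have yV: "y \<in> V" and b: "op_bound j (e / (p + 1) * norm (y - x))
            (\<lambda>vs. D j y vs - D j x vs - D (Suc j) x ((y - x) # vs))"
          using d(2)[rule_format, of "y - x"] y by auto
        have m: "multilinear j (\<lambda>vs. D j y vs - D j x vs - D (Suc j) x ((y - x) # vs))"
          by (intro multilinear_diff ml multilinear_Cons_tail) (use yV x j in auto)
        have "norm (D j y vs - D j x vs - D (Suc j) x ((y - x) # vs)) \<le> e / (p + 1) * norm (y - x) * p"
          using op_bound_imp[OF m b len] by (simp add: p_def)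
        also have "\<dots> = e * norm (y - x) * (p / (p + 1))" by simp
        also have "\<dots> \<le> e * norm (y - x)" using p0 e by (intro mult_right_le_one_le) auto
        finally show ?thesis .
      qed
      then show "\<exists>d>0. \<forall>y. norm (y - x) < d \<longrightarrow>
          norm (D j y vs - D j x vs - D (Suc j) x ((y - x) # vs)) \<le> e * norm (y - x)"
        using d(1) by blast
    qed
  qed
  show ?thesis by (rule smooth_familyI) (fact bd cont der)+
qed

lemma smooth_family_diff:
  assumes A: "smooth_family r V D" and B: "smooth_family r V E"
  shows "smooth_family r V (\<lambda>j x vs. D j x vs - E j x vs)"
proof (rule smooth_familyI)
  fix j assume j: "j \<le> r"
  obtain C where C: "\<And>x. x \<in> V \<Longrightarrow> op_bound j C (D j x)" using smooth_family_bound[OF A j] by blast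
  obtain C' where C': "\<And>x. x \<in> V \<Longrightarrow> op_bound j C' (E j x)" using smooth_family_bound[OF B j] by blast
  show "\<exists>C. \<forall>x\<in>V. op_bound j C (\<lambda>vs. D j x vs - E j x vs)"
    using op_bound_diff[OF C C'] by blast
  fix x and e :: real assume x: "x \<in> V" and e: "e > 0"
  then have "e / 2 > 0" by simp
  obtain d where d: "d > 0" "\<forall>y\<in>V. norm (y - x) < d \<longrightarrow> op_bound j (e/2) (\<lambda>vs. D j y vs - D j x vs)"
    using smooth_family_cont[OF A j x \<open>e / 2 > 0\<close>] by blast
  obtain d' where d': "d' > 0" "\<forall>y\<in>V. norm (y - x) < d' \<longrightarrow> op_bound j (e/2) (\<lambda>vs. E j y vs - E j x vs)"
    using smooth_family_cont[OF B j x \<open>e / 2 > 0\<close>] by blast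
  have "op_bound j e (\<lambda>vs. (D j y vs - E j y vs) - (D j x vs - E j x vs))"
    if "y \<in> V" "norm (y - x) < min d d'" for y
    using op_bound_diff[of j "e/2" "\<lambda>vs. D j y vs - D j x vs" "e/2" "\<lambda>vs. E j y vs - E j x vs"] d d' that
    by (simp add: algebra_simps)
  then show "\<exists>d>0. \<forall>y\<in>V. norm (y - x) < d \<longrightarrow> op_bound j e (\<lambda>vs. (D j y vs - E j y vs) - (D j x vs - E j x vs))"
    using d(1) d'(1) by (intro exI[of _ "min d d'"]) auto
next
  fix j x and vs :: "'a list" assume "j < r" "x \<in> V" "length vs = j"
  then show "((\<lambda>y. D j y vs - E j y vs) has_derivative (\<lambda>h. D (Suc j) x (h # vs) - E (Suc j) x (h # vs))) (at x)"
    by (intro has_derivative_diff smooth_family_deriv[OF A] smooth_family_deriv[OF B])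
qed

lemma op_bound_linear:
  assumes T: "\<And>x. norm (T x) \<le> norm x * K" "0 \<le> K" and A: "op_bound j C A"
  shows "op_bound j (C * K) (\<lambda>vs. T (A vs))"
  using A T unfolding op_bound_def by (meson mult_right_mono order_trans)

lemma smooth_family_linear:
  fixes D :: "nat \<Rightarrow> 'a::real_normed_vector \<Rightarrow> 'a list \<Rightarrow> 'b::real_normed_vector"
    and T :: "'b \<Rightarrow> 'c::real_normed_vector"
  assumes T: "bounded_linear T" and A: "smooth_family r V D"
  shows "smooth_family r V (\<lambda>j x vs. T (D j x vs))"
proof (rule smooth_familyI)
  obtain K where K: "K > 0" "\<And>x. norm (T x) \<le> norm x * K" using bounded_linear.pos_bounded[OF T] by blast
  then have K': "0 \<le> K" by simp
  fix j assume j: "j \<le> r"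
  obtain C where C: "\<And>x. x \<in> V \<Longrightarrow> op_bound j C (D j x)" using smooth_family_bound[OF A j] by blast
  show "\<exists>C. \<forall>x\<in>V. op_bound j C (\<lambda>vs. T (D j x vs))"
    using op_bound_linear[of T K, OF K(2) K' C] by blast
  fix x and e :: real assume x: "x \<in> V" and e: "e > 0"
  then have "e / K > 0" using K by simp
  obtain d where d: "d > 0" "\<forall>y\<in>V. norm (y - x) < d \<longrightarrow> op_bound j (e/K) (\<lambda>vs. D j y vs - D j x vs)"
    using smooth_family_cont[OF A j x \<open>e / K > 0\<close>] by blast
  have "op_bound j e (\<lambda>vs. T (D j y vs) - T (D j x vs))" if "y \<in> V" "norm (y - x) < d" for y
    using op_bound_linear[of T K j "e / K" "\<lambda>vs. D j y vs - D j x vs"] K d that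
    by (simp add: linear_diff[OF bounded_linear.linear[OF T]])
  then show "\<exists>d>0. \<forall>y\<in>V. norm (y - x) < d \<longrightarrow> op_bound j e (\<lambda>vs. T (D j y vs) - T (D j x vs))"
    using d(1) by blast
next
  fix j x and vs :: "'a list" assume "j < r" "x \<in> V" "length vs = j"
  then show "((\<lambda>y. T (D j y vs)) has_derivative (\<lambda>h. T (D (Suc j) x (h # vs)))) (at x)"
    by (intro bounded_linear.has_derivative[OF T] smooth_family_deriv[OF A])
qed

definition id_family :: "nat \<Rightarrow> 'a \<Rightarrow> 'a list \<Rightarrow> 'a::real_normed_vector" where
  "id_family j x vs = (if j = 0 then x else if j = 1 then hd vs else 0)"

lemma smooth_family_id:
  assumes V: "open V" "convex V" and b: "bounded V"
  shows "smooth_family r V id_family"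
proof (rule smooth_familyI_bounded[OF V])
  obtain B where B: "\<And>x. x \<in> V \<Longrightarrow> norm x \<le> B" using b by (auto simp: bounded_iff)
  fix j assume "j \<le> Suc r"
  have "op_bound j (max B 1) (id_family j x)" if "x \<in> V" for x
    unfolding op_bound_def
  proof
    fix vs :: "'a list" assume vs: "vs \<in> unit_lists j"
    then have "j = 1 \<Longrightarrow> norm (hd vs) \<le> 1"
      by (cases vs) (auto simp: unit_lists_def)
    then show "norm (id_family j x vs) \<le> max B 1"
      using B[OF that] by (auto simp: id_family_def)
  qed
  then show "\<exists>C. \<forall>x\<in>V. op_bound j C (id_family j x)" by blast
next
  fix j x and vs :: "'a list" assume "length vs = j"
  show "((\<lambda>y. id_family j y vs) has_derivative (\<lambda>h. id_family (Suc j) x (h # vs))) (at x)"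
    by (cases "j = 0") (auto simp: id_family_def)
qed

subsection \<open>Composition and limits\<close>

text \<open>With the norm as the only gauge, \<open>admw\<close> becomes \<open>op_bound\<close>, so
  the estimates for \<open>jcomp\<close> yield plain operator bounds too.\<close>

interpretation norm_gauge: gauges "\<lambda>_::unit. {\<lambda>x::'a::real_normed_vector. x}" "()"
  by (rule gauges.intro) (auto intro: bounded_linear_ident)

lemma norm_gauge_admw: "norm_gauge.admw w c j A \<longleftrightarrow> op_bound j c A"
proof -
  have "op_bound j c A \<Longrightarrow> 0 \<le> c" by (rule op_bound_nonneg)
  moreover have "norm_gauge.unitl w vs \<longleftrightarrow> (\<forall>v\<in>set vs. norm v \<le> 1)" for vs :: "'a list"
    by (auto simp: norm_gauge.unitl_def norm_gauge.bnd_def)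
  ultimately show ?thesis
    by (auto simp: norm_gauge.admw_def op_bound_def unit_lists_def norm_gauge.bnd_def)
qed

lemma has_derivative_sum_list:
  "(\<And>p. p \<in> set ps \<Longrightarrow> (f p has_derivative f' p) F) \<Longrightarrow>
    ((\<lambda>y. \<Sum>p\<leftarrow>ps. f p y) has_derivative (\<lambda>h. \<Sum>p\<leftarrow>ps. f' p h)) F"
  by (induction ps) (auto intro!: has_derivative_add)

definition comp_family ::
  "(nat \<Rightarrow> 'b \<Rightarrow> 'b list \<Rightarrow> 'c::real_vector) \<Rightarrow> (nat \<Rightarrow> 'a \<Rightarrow> 'a list \<Rightarrow> 'b) \<Rightarrow> nat \<Rightarrow> 'a \<Rightarrow> 'a list \<Rightarrow> 'c" where
  "comp_family S F j x = jcomp (\<lambda>p. S p (F 0 x [])) (\<lambda>i. F i x)"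

lemma smooth_family_tendsto:
  assumes "smooth_family r V F" "open V" "x \<in> V"
  shows "((\<lambda>y. F 0 y []) \<longlongrightarrow> F 0 x []) (nhds x)"
proof (rule tendstoI)
  fix e :: real assume "e > 0"
  then have "e / 2 > 0" by simp
  from smooth_family_eventually[OF assms(1) le0 assms(2,3) this]
  show "\<forall>\<^sub>F y in nhds x. dist (F 0 y []) (F 0 x []) < e"
    by eventually_elim (use \<open>e > 0\<close> in \<open>auto simp: op_bound_def unit_lists_def dist_norm\<close>)
qed

text \<open>Boundedness and continuity are the two norm estimates for \<open>jcomp\<close>;
  differentiability is the product rule for each partition, and \<open>jcomp_Cons\<close> collects
  the result.\<close>

lemma smooth_family_comp:
  fixes S F :: "nat \<Rightarrow> 'a::real_normed_vector \<Rightarrow> 'a list \<Rightarrow> 'a"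
  assumes S: "smooth_family r W S" and F: "smooth_family r V F" and op: "open V" "open W"
    and maps: "\<And>x. x \<in> V \<Longrightarrow> F 0 x [] \<in> W"
  shows "smooth_family r V (comp_family S F)"
proof (rule smooth_familyI)
  obtain C where C: "\<And>x j. x \<in> W \<Longrightarrow> j \<le> r \<Longrightarrow> op_bound j C (S j x)" "C \<ge> 1"
    using smooth_family_bounds[OF S] by blast
  obtain \<rho> where \<rho>: "\<And>x j. x \<in> V \<Longrightarrow> j \<le> r \<Longrightarrow> op_bound j \<rho> (F j x)" "\<rho> \<ge> 1"
    using smooth_family_bounds[OF F] by blast
  have ml: "multilinear p (S p (F 0 x []))" if "p \<le> r" "x \<in> V" for p x
    using smooth_family_multilinear[OF S op(2) that(1) maps[OF that(2)]] .
  fix j assume j: "j \<le> r"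
  have "op_bound j (real (bell j) * (C * \<rho> ^ j)) (comp_family S F j x)" if x: "x \<in> V" for x
    unfolding comp_family_def
    by (rule norm_gauge.jcomp_bound[unfolded norm_gauge_admw])
       (use C \<rho> x j maps ml in auto)
  then show "\<exists>C. \<forall>x\<in>V. op_bound j C (comp_family S F j x)" by blast
  fix x and e :: real assume x: "x \<in> V" and e: "e > 0"
  \<comment> \<open>\<open>M - 1\<close> is the factor that \<open>jcomp_diff\<close> produces when
    all differences are bounded by \<open>e'\<close>; the added 1 makes the division safe.\<close>
  define M where "M = real (bell j) * (\<rho> ^ j * (1 + real j * C)) + 1"
  have M: "M \<ge> 1" unfolding M_def using C(2) \<rho>(2) by simp
  define e' where "e' = e / M"
  have e': "e' > 0" using e M by (simp add: e'_def)
  have lim: "((\<lambda>y. F 0 y []) \<longlongrightarrow> F 0 x []) (nhds x)"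
    by (rule smooth_family_tendsto[OF F op(1) x])
  have evS: "\<forall>\<^sub>F y in nhds x. op_bound p e' (\<lambda>vs. S p (F 0 y []) vs - S p (F 0 x []) vs)" if "p \<le> j" for p
    using eventually_compose_filterlim[OF smooth_family_eventually[OF S _ op(2) maps[OF x] e', of p] lim]
      that j by simp
  have evF: "\<forall>\<^sub>F y in nhds x. op_bound p e' (\<lambda>vs. F p y vs - F p x vs)" if "p \<le> j" for p
    using smooth_family_eventually[OF F _ op(1) x e', of p] that j by simp
  have "\<forall>\<^sub>F y in nhds x. \<forall>p\<in>{..j}. op_bound p e' (\<lambda>vs. S p (F 0 y []) vs - S p (F 0 x []) vs) \<and>
      op_bound p e' (\<lambda>vs. F p y vs - F p x vs)"
    using evS evF by (intro eventually_ball_finite ballI eventually_conj) auto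
  moreover have "\<forall>\<^sub>F y in nhds x. y \<in> V" using op(1) x by (rule eventually_nhds_in_open)
  ultimately have "\<forall>\<^sub>F y in nhds x. op_bound j e (\<lambda>vs. comp_family S F j y vs - comp_family S F j x vs)"
  proof eventually_elim
    case (elim y)
    have "op_bound j (real (bell j) * (e' * \<rho> ^ j + real j * (C * e' * \<rho> ^ j)))
        (\<lambda>vs. jcomp (\<lambda>p. S p (F 0 y [])) (\<lambda>i. F i y) vs - jcomp (\<lambda>p. S p (F 0 x [])) (\<lambda>i. F i x) vs)"
    proof (rule norm_gauge.jcomp_diff[unfolded norm_gauge_admw])
      show "multilinear p (S p (F 0 x [])) \<and> multilinear p (S p (F 0 y [])) \<and>
          op_bound p e' (\<lambda>vs. S p (F 0 y []) vs - S p (F 0 x []) vs) \<and> op_bound p C (S p (F 0 x []))"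
        if "p \<le> j" for p
        using that ml x elim C maps j by auto
      show "op_bound i \<rho> (F i x) \<and> op_bound i \<rho> (F i y) \<and> op_bound i e' (\<lambda>vs. F i y vs - F i x vs)"
        if "i \<le> j" for i
        using that x elim \<rho> j by auto
    qed (use e' \<rho> C in auto)
    moreover have "real (bell j) * (e' * \<rho> ^ j + real j * (C * e' * \<rho> ^ j)) = e' * (M - 1)"
      by (simp add: M_def algebra_simps)
    moreover have "e' * (M - 1) \<le> e" using M e by (simp add: e'_def field_simps)
    ultimately show ?case unfolding comp_family_def by (auto intro: op_bound_mono)
  qed
  then show "\<exists>d>0. \<forall>y\<in>V. norm (y - x) < d \<longrightarrow>
      op_bound j e (\<lambda>vs. comp_family S F j y vs - comp_family S F j x vs)"
    by (auto simp: eventually_nhds_metric dist_norm)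
next
  fix j x and vs :: "'a list" assume j: "j < r" and x: "x \<in> V" and len: "length vs = j"
  have F0: "((\<lambda>y. F 0 y []) has_derivative (\<lambda>h. F 1 x [h])) (at x)"
    using smooth_family_deriv[OF F, of 0 x "[]"] j x by simp
  have "((\<lambda>y. S (length \<pi>) (F 0 y []) (map (\<lambda>b. F (length b) y b) \<pi>)) has_derivative
     (\<lambda>h. S (Suc (length \<pi>)) (F 0 x []) (F 1 x [h] # map (\<lambda>b. F (length b) x b) \<pi>) +
     (\<Sum>q<length \<pi>. S (length \<pi>) (F 0 x [])
         ((map (\<lambda>b. F (length b) x b) \<pi>)[q := F (Suc (length (\<pi> ! q))) x (h # \<pi> ! q)])))) (at x)"
    if \<pi>: "\<pi> \<in> set (parts vs)" for \<pi>
  proof -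
    have p: "length \<pi> < r" using parts_length[OF \<pi>] len j by simp
    obtain C where C: "\<And>x. x \<in> W \<Longrightarrow> op_bound (length \<pi>) C (S (length \<pi>) x)"
      using smooth_family_bound[OF S, of "length \<pi>"] p by (metis less_imp_le)
    have lim: "((\<lambda>y. F 0 y []) \<longlongrightarrow> F 0 x []) (nhds x)"
      by (rule smooth_family_tendsto[OF F op(1) x])
    \<comment> \<open>Each block is one differentiable argument of the outer derivative; its own
      derivative prepends the direction to the block.\<close>
    define ws where "ws = map (\<lambda>b y. F (length b) y b) \<pi>"
    define ws' where "ws' = map (\<lambda>b h. F (Suc (length b)) x (h # b)) \<pi>"
    have "((\<lambda>y. S (length \<pi>) (F 0 y []) (map (\<lambda>w. w y) ws)) has_derivative
      (\<lambda>h. S (Suc (length \<pi>)) (F 0 x []) (F 1 x [h] # map (\<lambda>w. w x) ws) +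
       (\<Sum>q<length \<pi>. S (length \<pi>) (F 0 x []) ((map (\<lambda>w. w x) ws)[q := (ws' ! q) h])))) (at x)"
    proof (rule has_derivative_multilinear)
      have "\<forall>\<^sub>F y in nhds x. y \<in> V" using op(1) x by (rule eventually_nhds_in_open)
      then show "\<forall>\<^sub>F y in nhds x. multilinear (length \<pi>) (S (length \<pi>) (F 0 y []))"
        by eventually_elim (use smooth_family_multilinear[OF S op(2)] maps p in auto)
      show "op_bound (length \<pi>) C (S (length \<pi>) (F 0 x []))" using C maps x by blast
      show "\<forall>\<^sub>F y in nhds x. op_bound (length \<pi>) e
          (\<lambda>vs. S (length \<pi>) (F 0 y []) vs - S (length \<pi>) (F 0 x []) vs)" if "e > 0" for e
        using eventually_compose_filterlim[OF smooth_family_eventually[OF S _ op(2) maps[OF x] that] lim] p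
        by simp
      show "((\<lambda>y. S (length \<pi>) (F 0 y []) us) has_derivative
          (\<lambda>h. S (Suc (length \<pi>)) (F 0 x []) (F 1 x [h] # us))) (at x)" if "length us = length \<pi>" for us
        using has_derivative_compose[OF F0 smooth_family_deriv[OF S p maps[OF x] that]] by simp
      show "(ws ! q has_derivative ws' ! q) (at x)" if q: "q < length \<pi>" for q
      proof -
        have "length (\<pi> ! q) < r" using parts_block[OF \<pi>, of "\<pi> ! q"] q j len by force
        from smooth_family_deriv[OF F this x] show ?thesis using q by (simp add: ws_def ws'_def)
      qed
    qed (auto simp: ws_def ws'_def)
    moreover have "map (\<lambda>w. w y) ws = map (\<lambda>b. F (length b) y b) \<pi>" for y
      by (simp add: ws_def o_def)
    ultimately show ?thesis by (simp add: ws'_def cong: sum.cong_simp)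
  qed
  then show "((\<lambda>y. comp_family S F j y vs) has_derivative (\<lambda>h. comp_family S F (Suc j) x (h # vs))) (at x)"
    unfolding comp_family_def jcomp_Cons
    unfolding jcomp_def by (rule has_derivative_sum_list)
qed

text \<open>Geometric steps make every order a convergent series with a uniform tail. Continuity
  follows by splitting \<open>e\<close> into thirds, and the theorem on sequences with uniformly
  converging derivatives shows that the limit of order j + 1 is the derivative of the limit of order
  j.\<close>

lemma smooth_family_limit:
  fixes D :: "nat \<Rightarrow> nat \<Rightarrow> 'a::real_normed_vector \<Rightarrow> 'a list \<Rightarrow> 'b::banach"
  assumes V: "open V" "convex V" and D: "\<And>k. smooth_family r V (D k)"
    and diff: "\<And>k j x. j \<le> r \<Longrightarrow> x \<in> V \<Longrightarrow> op_bound j (C * \<kappa> ^ k) (\<lambda>vs. D (Suc k) j x vs - D k j x vs)"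
    and \<kappa>: "0 \<le> \<kappa>" "\<kappa> < 1"
  obtains L where "smooth_family r V L"
    and "\<And>j x vs. j \<le> r \<Longrightarrow> x \<in> V \<Longrightarrow> length vs = j \<Longrightarrow> (\<lambda>k. D k j x vs) \<longlonglongrightarrow> L j x vs"
proof -
  define L where "L j x vs = D 0 j x vs + (\<Sum>k. D (Suc k) j x vs - D k j x vs)" for j x vs
  define p where "p vs = prod_list (map norm vs)" for vs :: "'a list"
  have p0: "p vs \<ge> 0" for vs unfolding p_def by (intro prod_list_nonneg) auto
  have p1: "p vs \<le> 1" if "vs \<in> unit_lists j" for vs j
  proof -
    have "prod_list (map norm vs) \<le> 1 ^ length (map norm vs)"
      by (rule prod_list_le_power) (use that in \<open>auto simp: unit_lists_def\<close>)
    then show ?thesis by (simp add: p_def)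
  qed
  have ml: "multilinear j (D k j x)" if "j \<le> r" "x \<in> V" for k j x
    using smooth_family_multilinear[OF D V(1) that] .
  have step: "norm (D (Suc k) j x vs - D k j x vs) \<le> C * \<kappa> ^ k * p vs"
    if "j \<le> r" "x \<in> V" "length vs = j" for k j x vs
    unfolding p_def using op_bound_imp[OF multilinear_diff[OF ml ml] diff] that by blast
  have C0: "C \<ge> 0" if "x \<in> V" for x
    using op_bound_nonneg[OF diff[OF le0 that, of 0]] by simp
  have lim: "(\<lambda>k. D k j x vs) \<longlonglongrightarrow> L j x vs" if "j \<le> r" "x \<in> V" "length vs = j" for j x vs
  proof -
    have "summable (\<lambda>k. C * p vs * \<kappa> ^ k)" using \<kappa> by (intro summable_mult summable_geometric) simp
    then have "summable (\<lambda>k. D (Suc k) j x vs - D k j x vs)"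
      by (rule summable_comparison_test'[where N = 0]) (use step[OF that] in \<open>simp add: mult_ac\<close>)
    then have "(\<lambda>k. D 0 j x vs + (\<Sum>i<k. D (Suc i) j x vs - D i j x vs)) \<longlonglongrightarrow> L j x vs"
      unfolding L_def by (intro tendsto_add tendsto_const summable_LIMSEQ)
    moreover have "D 0 j x vs + (\<Sum>i<k. D (Suc i) j x vs - D i j x vs) = D k j x vs" for k
      using sum_lessThan_telescope[of "\<lambda>k. D k j x vs" k] by simp
    ultimately show ?thesis by simp
  qed
  have tail: "norm (L j x vs - D k j x vs) \<le> C * \<kappa> ^ k / (1 - \<kappa>) * p vs"
    if *: "j \<le> r" "x \<in> V" "length vs = j" for j x vs k
  proof (rule LIMSEQ_le_const2)
    show "(\<lambda>n. norm (D (n + k) j x vs - D k j x vs)) \<longlonglongrightarrow> norm (L j x vs - D k j x vs)"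
      using LIMSEQ_ignore_initial_segment[OF lim[OF *], of k] by (intro tendsto_intros)
    have "norm (D (n + k) j x vs - D k j x vs) \<le> C * p vs * \<kappa> ^ k * ((1 - \<kappa> ^ n) / (1 - \<kappa>))" for n
    proof (induction n)
      case (Suc n)
      have "norm (D (Suc n + k) j x vs - D k j x vs) \<le>
          norm (D (Suc (n + k)) j x vs - D (n + k) j x vs) + norm (D (n + k) j x vs - D k j x vs)"
        using norm_triangle_ineq[of "D (Suc (n + k)) j x vs - D (n + k) j x vs" "D (n + k) j x vs - D k j x vs"]
        by simp
      also have "\<dots> \<le> C * \<kappa> ^ (n + k) * p vs + C * p vs * \<kappa> ^ k * ((1 - \<kappa> ^ n) / (1 - \<kappa>))"
        using step[OF *] Suc by (intro add_mono)
      also have "\<dots> = C * p vs * \<kappa> ^ k * (\<kappa> ^ n + (1 - \<kappa> ^ n) / (1 - \<kappa>))"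
        by (simp add: power_add algebra_simps)
      also have "\<kappa> ^ n + (1 - \<kappa> ^ n) / (1 - \<kappa>) = (1 - \<kappa> ^ Suc n) / (1 - \<kappa>)"
        using \<kappa> by (simp add: field_simps)
      finally show ?case .
    qed simp
    moreover have "C * p vs * \<kappa> ^ k * ((1 - \<kappa> ^ n) / (1 - \<kappa>)) \<le> C * \<kappa> ^ k / (1 - \<kappa>) * p vs" for n
    proof -
      have "(1 - \<kappa> ^ n) / (1 - \<kappa>) \<le> 1 / (1 - \<kappa>)" using \<kappa> by (intro divide_right_mono) auto
      then have "C * p vs * \<kappa> ^ k * ((1 - \<kappa> ^ n) / (1 - \<kappa>)) \<le> C * p vs * \<kappa> ^ k * (1 / (1 - \<kappa>))"
        using C0[OF *(2)] p0 \<kappa> by (intro mult_left_mono) auto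
      then show ?thesis by (simp add: mult_ac)
    qed
    ultimately show "\<exists>N. \<forall>n\<ge>N. norm (D (n + k) j x vs - D k j x vs) \<le> C * \<kappa> ^ k / (1 - \<kappa>) * p vs"
      using order_trans by blast
  qed
  have small: "\<exists>K. \<forall>k\<ge>K. C * \<kappa> ^ k / (1 - \<kappa>) * c \<le> e" if "e > 0" for e c
  proof -
    have "(\<lambda>k. C * \<kappa> ^ k / (1 - \<kappa>) * c) \<longlonglongrightarrow> C * 0 / (1 - \<kappa>) * c"
      using \<kappa> by (intro tendsto_intros LIMSEQ_power_zero) auto
    then have "\<forall>\<^sub>F k in sequentially. C * \<kappa> ^ k / (1 - \<kappa>) * c < e"
      using that by (intro order_tendstoD(2)) simp_all
    then show ?thesis by (auto simp: eventually_sequentially intro: less_imp_le)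
  qed
  have tail_bound: "op_bound j (C * \<kappa> ^ k / (1 - \<kappa>)) (\<lambda>vs. L j x vs - D k j x vs)"
    if "j \<le> r" "x \<in> V" for j x k
    unfolding op_bound_def
  proof
    fix vs :: "'a list" assume vs: "vs \<in> unit_lists j"
    then have "norm (L j x vs - D k j x vs) \<le> C * \<kappa> ^ k / (1 - \<kappa>) * p vs"
      using tail[OF that] by (simp add: unit_lists_def)
    also have "\<dots> \<le> C * \<kappa> ^ k / (1 - \<kappa>) * 1"
      using p1[OF vs] C0[OF that(2)] \<kappa> by (intro mult_left_mono) auto
    finally show "norm (L j x vs - D k j x vs) \<le> C * \<kappa> ^ k / (1 - \<kappa>)" by simp
  qed
  have "smooth_family r V L"
  proof (rule smooth_familyI)
    fix j assume j: "j \<le> r"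
    obtain B where B: "\<And>x. x \<in> V \<Longrightarrow> op_bound j B (D 0 j x)"
      using smooth_family_bound[OF D j] by blast
    show "\<exists>C. \<forall>x\<in>V. op_bound j C (L j x)"
    proof (intro exI ballI)
      fix x assume x: "x \<in> V"
      from op_bound_add[OF tail_bound[OF j x, of 0] B[OF x]]
      show "op_bound j (C * \<kappa> ^ 0 / (1 - \<kappa>) + B) (L j x)" by simp
    qed
    fix x and e :: real assume x: "x \<in> V" and e: "e > 0"
    then have "e / 3 > 0" by simp
    from small[OF this, of 1] obtain k where k: "C * \<kappa> ^ k / (1 - \<kappa>) \<le> e / 3" by auto
    obtain d where d: "d > 0" "\<forall>y\<in>V. norm (y - x) < d \<longrightarrow> op_bound j (e/3) (\<lambda>vs. D k j y vs - D k j x vs)"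
      using smooth_family_cont[OF D j x \<open>e / 3 > 0\<close>] by blast
    have "op_bound j e (\<lambda>vs. L j y vs - L j x vs)" if y: "y \<in> V" "norm (y - x) < d" for y
    proof -
      have 1: "op_bound j (e / 3) (\<lambda>vs. L j y vs - D k j y vs)" "op_bound j (e / 3) (\<lambda>vs. L j x vs - D k j x vs)"
        using op_bound_mono[OF tail_bound[OF j] k] x y by auto
      have 2: "op_bound j (e / 3) (\<lambda>vs. D k j y vs - D k j x vs)" using d y by blast
      from op_bound_add[OF op_bound_diff[OF 1] 2] show ?thesis by (simp add: algebra_simps)
    qed
    then show "\<exists>d>0. \<forall>y\<in>V. norm (y - x) < d \<longrightarrow> op_bound j e (\<lambda>vs. L j y vs - L j x vs)"
      using d(1) by blast
  next
    fix j x and vs :: "'a list" assume j: "j < r" and x: "x \<in> V" and len: "length vs = j"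
    have "\<exists>g. \<forall>y\<in>V. (\<lambda>k. D k j y vs) \<longlonglongrightarrow> g y \<and> (g has_derivative (\<lambda>h. L (Suc j) y (h # vs))) (at y within V)"
    proof (rule has_derivative_sequence[OF V(2) _ _ x])
      show "((\<lambda>y. D k j y vs) has_derivative (\<lambda>h. D k (Suc j) y (h # vs))) (at y within V)" if "y \<in> V" for k y
        using smooth_family_deriv[OF D j that len] by (rule has_derivative_at_withinI)
      show "(\<lambda>k. D k j x vs) \<longlonglongrightarrow> L j x vs" using lim j x len by simp
      fix e :: real assume "e > 0"
      from small[OF this, of "p vs"] obtain K where K: "\<And>k. k \<ge> K \<Longrightarrow> C * \<kappa> ^ k / (1 - \<kappa>) * p vs \<le> e" by blast
      have "norm (D k (Suc j) y (h # vs) - L (Suc j) y (h # vs)) \<le> e * norm h" if "k \<ge> K" "y \<in> V" for k y h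
      proof -
        have "norm (D k (Suc j) y (h # vs) - L (Suc j) y (h # vs)) \<le> C * \<kappa> ^ k / (1 - \<kappa>) * p (h # vs)"
          using tail[of "Suc j" y "h # vs" k] j that len by (simp add: norm_minus_commute)
        also have "\<dots> = (C * \<kappa> ^ k / (1 - \<kappa>) * p vs) * norm h" by (simp add: p_def)
        also have "\<dots> \<le> e * norm h" using K[OF that(1)] by (intro mult_right_mono) auto
        finally show ?thesis .
      qed
      then show "\<forall>\<^sub>F k in sequentially. \<forall>y\<in>V. \<forall>h. norm (D k (Suc j) y (h # vs) - L (Suc j) y (h # vs)) \<le> e * norm h"
        by (auto simp: eventually_sequentially)
    qed
    then obtain g where g: "\<And>y. y \<in> V \<Longrightarrow> (\<lambda>k. D k j y vs) \<longlonglongrightarrow> g y"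
        "(g has_derivative (\<lambda>h. L (Suc j) x (h # vs))) (at x within V)" using x by blast
    have "g y = L j y vs" if "y \<in> V" for y
      using LIMSEQ_unique[OF g(1)[OF that] lim] j that len by simp
    then show "((\<lambda>y. L j y vs) has_derivative (\<lambda>h. L (Suc j) x (h # vs))) (at x)"
      using g(2) has_derivative_transform_within_open[OF _ V(1) x] at_within_open[OF x V(1)] by metis
  qed
  then show ?thesis using lim by (rule that)
qed

subsection \<open>Symmetry of derivatives and Taylor polynomials\<close>

text \<open>Schwarz's theorem. The second difference of \<open>f\<close> over the parallelogram with
  sides \<open>s *\<^sub>R h\<close> and \<open>s *\<^sub>R k\<close> is symmetric in
  \<open>h\<close> and \<open>k\<close> and, after division by \<open>s * s\<close>, within
  \<open>e * c\<close> of both mixed derivatives.\<close>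

lemma smooth_family_swap:
  fixes D :: "nat \<Rightarrow> 'a::real_normed_vector \<Rightarrow> 'a list \<Rightarrow> 'b::real_normed_vector"
  assumes S: "smooth_family r V D" and V: "open V" "x \<in> V" and j: "Suc (Suc j) \<le> r" and len: "length vs = j"
  shows "D (Suc (Suc j)) x (h # k # vs) = D (Suc (Suc j)) x (k # h # vs)"
proof -
  define f where "f = (\<lambda>y. D j y vs)"
  define f1 where "f1 = (\<lambda>y a. D (Suc j) y (a # vs))"
  define f2 where "f2 = (\<lambda>y a b. D (Suc (Suc j)) y (a # b # vs))"
  have f: "(f has_derivative f1 y) (at y)" if "y \<in> V" for y
    unfolding f_def f1_def using smooth_family_deriv[OF S _ that len] j by simp
  have f1: "((\<lambda>y. f1 y b) has_derivative (\<lambda>a. f2 y a b)) (at y)" if "y \<in> V" for y b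
    unfolding f1_def f2_def using smooth_family_deriv[OF S _ that, of "Suc j" "b # vs"] j len by simp
  have ml: "multilinear (Suc (Suc j)) (D (Suc (Suc j)) y)" if "y \<in> V" for y
    using smooth_family_multilinear[OF S V(1) j that] .
  have f2_scale: "f2 y (s *\<^sub>R a) b = s *\<^sub>R f2 y a b" if "y \<in> V" for y s a b
    unfolding f2_def using linear_scale[OF multilinear_Cons_head[OF ml[OF that], of "b # vs"]] len by simp
  define c where "c = norm h * norm k * prod_list (map norm vs)"
  have c0: "c \<ge> 0" unfolding c_def by (intro mult_nonneg_nonneg prod_list_nonneg) auto
  have bound: "norm (f2 x h k - f2 x k h) \<le> 2 * (e * c)" if e: "e > 0" for e
  proof -
    obtain d0 where d0: "d0 > 0" "\<forall>y\<in>V. norm (y - x) < d0 \<longrightarrow>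
        op_bound (Suc (Suc j)) e (\<lambda>vs. D (Suc (Suc j)) y vs - D (Suc (Suc j)) x vs)"
      using smooth_family_cont[OF S j V(2) e] by blast
    obtain d1 where d1: "d1 > 0" "ball x d1 \<subseteq> V" using V by (meson openE)
    define d where "d = min d0 d1"
    have d: "d > 0" "ball x d \<subseteq> V" using d0 d1 by (auto simp: d_def)
    have near: "norm (f2 y a b - f2 x a b) \<le> e * c" if y: "y \<in> ball x d" and ab: "(a, b) = (h, k) \<or> (a, b) = (k, h)" for y a b
    proof -
      have "norm (f2 y a b - f2 x a b) \<le> e * prod_list (map norm (a # b # vs))"
        unfolding f2_def
      proof (rule op_bound_imp)
        show "multilinear (Suc (Suc j)) (\<lambda>vs. D (Suc (Suc j)) y vs - D (Suc (Suc j)) x vs)"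
          using ml V y d by (intro multilinear_diff) auto
        show "op_bound (Suc (Suc j)) e (\<lambda>vs. D (Suc (Suc j)) y vs - D (Suc (Suc j)) x vs)"
          using d0(2) y d by (auto simp: d_def dist_norm norm_minus_commute)
      qed (use len in simp)
      then show ?thesis using ab by (auto simp: c_def mult_ac)
    qed
    \<comment> \<open>Small enough for the whole parallelogram to stay in \<open>ball x d\<close>;
      the 1 covers the case that both sides vanish.\<close>
    define s where "s = d / (2 * (norm h + norm k + 1))"
    have hk: "norm h + norm k + 1 > 0" by (simp add: add_nonneg_pos)
    have s: "s > 0" using d hk by (simp add: s_def)
    have "s * (norm h + norm k) < d"
    proof -
      have "s * (norm h + norm k) \<le> s * (norm h + norm k + 1)" using s by simp
      also have "\<dots> = d / 2" using hk by (simp add: s_def field_simps)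
      finally show ?thesis using d by simp
    qed
    then have sn: "s * norm h + s * norm k < d" by (simp add: algebra_simps)
    have second: "norm (f (x + s *\<^sub>R b + s *\<^sub>R a) - f (x + s *\<^sub>R b) - (f (x + s *\<^sub>R a) - f x) - (s * s) *\<^sub>R f2 x a b)
        \<le> s * (s * (e * c))" if ab: "(a, b) = (h, k) \<or> (a, b) = (k, h)" for a b
    proof -
      \<comment> \<open>The points \<open>y\<close> such that \<open>y\<close> and
        \<open>y + s *\<^sub>R a\<close> both lie in the ball. On this convex set the mean value
        inequality treats the first difference in direction \<open>b\<close>, and a second use
        inside the ball the remaining increment in direction \<open>a\<close>.\<close>
      define W where "W = ball x d \<inter> ball (x - s *\<^sub>R a) d"
      have W: "convex W" by (simp add: W_def convex_Int)
      have nab: "s * norm a + s * norm b < d" using ab sn by auto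
      moreover have "0 \<le> s * norm a" "0 \<le> s * norm b" using s by auto
      ultimately have na: "s * norm a < d" "s * norm b < d" by linarith+
      have xW: "x \<in> W" using d na s by (simp add: W_def dist_norm)
      have "norm (s *\<^sub>R a + s *\<^sub>R b) < d" using nab norm_triangle_ineq[of "s *\<^sub>R a" "s *\<^sub>R b"] s by simp
      then have bW: "x + s *\<^sub>R b \<in> W" using na s
        by (simp add: W_def dist_norm norm_minus_commute algebra_simps)
      have in_ball: "y \<in> ball x d" "y + s *\<^sub>R a \<in> ball x d" if "y \<in> W" for y
        using that by (auto simp: W_def dist_norm algebra_simps)
      have "norm ((\<lambda>y. f (y + s *\<^sub>R a) - f y) (x + s *\<^sub>R b) - (\<lambda>y. f (y + s *\<^sub>R a) - f y) x - (s * s) *\<^sub>R f2 x a b)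
          \<le> s * (s * (e * c))"
      proof (rule mean_value_bound[OF W xW bW])
        fix y assume y: "y \<in> W"
        have yV: "y \<in> V" "y + s *\<^sub>R a \<in> V" using in_ball[OF y] d by auto
        have "((\<lambda>y. f (y + s *\<^sub>R a)) has_derivative f1 (y + s *\<^sub>R a)) (at y)"
          using has_derivative_compose[OF has_derivative_add_const[OF has_derivative_ident] f[OF yV(2)], of UNIV]
          by simp
        then show "((\<lambda>y. f (y + s *\<^sub>R a) - f y) has_derivative (\<lambda>b. f1 (y + s *\<^sub>R a) b - f1 y b)) (at y)"
          using f[OF yV(1)] by (rule has_derivative_diff)
        have "norm (f1 (y + s *\<^sub>R a) b - f1 y b - s *\<^sub>R f2 x a b) \<le> s * (e * c)"
        proof (rule mean_value_bound[of "ball x d"])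
          fix z assume z: "z \<in> ball x d"
          then show "((\<lambda>y. f1 y b) has_derivative (\<lambda>a. f2 z a b)) (at z)" using f1 d by blast
          have "f2 z (y + s *\<^sub>R a - y) b - s *\<^sub>R f2 x a b = s *\<^sub>R (f2 z a b - f2 x a b)"
            using f2_scale[of z s a b] z d by (auto simp: scaleR_diff_right)
          then show "norm (f2 z (y + s *\<^sub>R a - y) b - s *\<^sub>R f2 x a b) \<le> s * (e * c)"
            using near[OF z ab] s by simp
        qed (use in_ball[OF y] in auto)
        moreover have "f1 (y + s *\<^sub>R a) (s *\<^sub>R b) = s *\<^sub>R f1 (y + s *\<^sub>R a) b" "f1 y (s *\<^sub>R b) = s *\<^sub>R f1 y b"
          using linear_scale[OF has_derivative_linear[OF f]] yV by auto
        then have "f1 (y + s *\<^sub>R a) (s *\<^sub>R b) - f1 y (s *\<^sub>R b) - (s * s) *\<^sub>R f2 x a b =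
            s *\<^sub>R (f1 (y + s *\<^sub>R a) b - f1 y b - s *\<^sub>R f2 x a b)"
          by (simp add: scaleR_diff_right)
        ultimately show "norm (f1 (y + s *\<^sub>R a) (x + s *\<^sub>R b - x) - f1 y (x + s *\<^sub>R b - x) - (s * s) *\<^sub>R f2 x a b)
            \<le> s * (s * (e * c))"
          using s by simp
      qed
      then show ?thesis by simp
    qed
    define \<Delta> where "\<Delta> = f (x + s *\<^sub>R h + s *\<^sub>R k) - f (x + s *\<^sub>R h) - f (x + s *\<^sub>R k) + f x"
    have 1: "norm (\<Delta> - (s * s) *\<^sub>R f2 x h k) \<le> s * (s * (e * c))"
      using second[of h k] by (simp add: \<Delta>_def algebra_simps)
    have 2: "norm (\<Delta> - (s * s) *\<^sub>R f2 x k h) \<le> s * (s * (e * c))"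
      using second[of k h] by (simp add: \<Delta>_def algebra_simps)
    have "(s * s) * norm (f2 x h k - f2 x k h) = norm ((\<Delta> - (s * s) *\<^sub>R f2 x k h) - (\<Delta> - (s * s) *\<^sub>R f2 x h k))"
      using s by (simp flip: scaleR_diff_right)
    also have "\<dots> \<le> (s * s) * (2 * (e * c))"
      using norm_triangle_ineq4[of "\<Delta> - (s * s) *\<^sub>R f2 x k h" "\<Delta> - (s * s) *\<^sub>R f2 x h k"] 1 2 by simp
    finally show ?thesis using s by simp
  qed
  have le: "norm (f2 x h k - f2 x k h) \<le> e" if "e > 0" for e
  proof -
    have "e / (2 * (c + 1)) > 0" using that c0 by simp
    then have "norm (f2 x h k - f2 x k h) \<le> 2 * (e / (2 * (c + 1)) * c)" by (rule bound)
    also have "\<dots> = e * (c / (c + 1))" using c0 by (simp add: divide_simps)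
    also have "\<dots> \<le> e" using that c0 by (intro mult_right_le_one_le) auto
    finally show ?thesis .
  qed
  have "norm (f2 x h k - f2 x k h) \<le> 0" by (rule field_le_epsilon) (use le in simp)
  then show ?thesis by (simp add: f2_def)
qed

text \<open>Permutations of the tail are inherited from the order below by uniqueness of
  derivatives, and \<open>smooth_family_swap\<close> exchanges the first two entries; together these
  generate all permutations.\<close>

lemma smooth_family_symmetric:
  fixes D :: "nat \<Rightarrow> 'a::real_normed_vector \<Rightarrow> 'a list \<Rightarrow> 'b::real_normed_vector"
  assumes S: "smooth_family r V D" and V: "open V"
  shows "j \<le> r \<Longrightarrow> x \<in> V \<Longrightarrow> length us = j \<Longrightarrow> mset us = mset vs \<Longrightarrow> D j x us = D j x vs"
proof (induction j arbitrary: x us vs)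
  case 0
  then show ?case by simp
next
  case (Suc j)
  have tail: "D (Suc j) x (h # ps) = D (Suc j) x (h # qs)"
    if "mset ps = mset qs" "length ps = j" for h ps qs
  proof -
    have len: "length qs = j" using that mset_eq_length by metis
    have "((\<lambda>y. D j y ps) has_derivative (\<lambda>h. D (Suc j) x (h # ps))) (at x)"
      using smooth_family_deriv[OF S _ Suc.prems(2) that(2)] Suc.prems(1) by simp
    then have "((\<lambda>y. D j y qs) has_derivative (\<lambda>h. D (Suc j) x (h # ps))) (at x)"
      by (rule has_derivative_transform_within_open[OF _ V Suc.prems(2)])
         (use Suc.IH[OF _ _ that(2,1)] Suc.prems(1) in auto)
    moreover have "((\<lambda>y. D j y qs) has_derivative (\<lambda>h. D (Suc j) x (h # qs))) (at x)"
      using smooth_family_deriv[OF S _ Suc.prems(2) len] Suc.prems(1) by simp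
    ultimately show ?thesis using has_derivative_unique by metis
  qed
  have "length vs = Suc j" using Suc.prems mset_eq_length by metis
  then obtain a us' b vs' where us: "us = a # us'" "vs = b # vs'" "length us' = j" "length vs' = j"
    using Suc.prems(3) by (metis length_Suc_conv)
  show ?case
  proof (cases "a = b")
    case True
    then show ?thesis using tail[of us' vs'] us Suc.prems(4) by simp
  next
    case False
    then have "a \<in> set vs'" using Suc.prems(4) us by (metis insert_iff list.simps(15) list.set_intros(1) set_mset_mset)
    define ws where "ws = remove1 a vs'"
    have 1: "mset vs' = mset (a # ws)" using \<open>a \<in> set vs'\<close> by (simp add: ws_def)
    then have lws: "Suc (length ws) = j" using us(4) mset_eq_length by fastforce
    have 2: "mset us' = mset (b # ws)" using Suc.prems(4) us 1 by (simp add: add_mset_commute)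
    have "D (Suc j) x us = D (Suc j) x (a # b # ws)" using tail[OF 2] us by simp
    also have "\<dots> = D (Suc j) x (b # a # ws)"
      using smooth_family_swap[OF S V Suc.prems(2) _ refl, of ws a b] lws Suc.prems(1) by simp
    also have "\<dots> = D (Suc j) x vs" using tail[OF 1] us by simp
    finally show ?thesis .
  qed
qed

text \<open>The derivatives of the polynomial with the symmetric coefficients \<open>L m / m!\<close>.\<close>

definition taylor_family ::
  "nat \<Rightarrow> (nat \<Rightarrow> 'a list \<Rightarrow> 'b::real_vector) \<Rightarrow> nat \<Rightarrow> 'a \<Rightarrow> 'a list \<Rightarrow> 'b" where
  "taylor_family d L j x vs = (\<Sum>m\<in>{j..d}. (1 / fact (m - j)) *\<^sub>R L m (vs @ replicate (m - j) x))"

lemma taylor_family_zero: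
  assumes "\<And>m. m \<le> d \<Longrightarrow> multilinear m (L m)" "length vs = j" "j \<le> d"
  shows "taylor_family d L j 0 vs = L j vs"
proof -
  have "L m (vs @ replicate (m - j) 0) = 0" if "m \<in> {Suc j..d}" for m
    by (rule multilinear_zero_slot[OF assms(1)]) (use that assms(2) in auto)
  then show ?thesis using assms(3) by (simp add: taylor_family_def sum.atLeast_Suc_atMost)
qed

text \<open>The fixed slots have derivative 0, and by symmetry each of the \<open>n\<close> slots
  filled with \<open>y\<close> contributes the same term with the direction moved to the
  front.\<close>

lemma has_derivative_symmetric_power:
  fixes A :: "'a::real_normed_vector list \<Rightarrow> 'b::real_normed_vector"
  assumes A: "multilinear (j + n) A" "op_bound (j + n) C A"
    and sym: "\<And>us vs. length us = j + n \<Longrightarrow> mset us = mset vs \<Longrightarrow> A us = A vs"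
    and len: "length vs = j"
  shows "((\<lambda>y. A (vs @ replicate n y)) has_derivative
    (\<lambda>h. real n *\<^sub>R A (h # vs @ replicate (n - 1) x))) (at x)"
proof -
  define ws where "ws = map (\<lambda>v (_ :: 'a). v) vs @ replicate n (\<lambda>y. y)"
  define ws' where "ws' = replicate j (\<lambda>_. 0 :: 'a) @ replicate n (\<lambda>h. h)"
  have map_ws: "map (\<lambda>w. w y) ws = vs @ replicate n y" for y by (simp add: ws_def o_def)
  have "((\<lambda>y. A (map (\<lambda>w. w y) ws)) has_derivative
    (\<lambda>h. 0 + (\<Sum>q<j + n. A ((map (\<lambda>w. w x) ws)[q := (ws' ! q) h])))) (at x)"
  proof (rule has_derivative_multilinear[OF _ _ _ A(2)])
    show "\<forall>\<^sub>F y in nhds x. op_bound (j + n) e (\<lambda>vs. A vs - A vs)" if "e > 0" for e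
      using that by (simp add: op_bound_def)
    show "(ws ! q has_derivative ws' ! q) (at x)" if "q < j + n" for q
      using that len by (auto simp: ws_def ws'_def nth_append)
  qed (use A len in \<open>auto simp: ws_def ws'_def\<close>)
  moreover have "(\<Sum>q<j + n. A ((vs @ replicate n x)[q := (ws' ! q) h])) = real n *\<^sub>R A (h # vs @ replicate (n - 1) x)" for h
  proof -
    have lo: "A ((vs @ replicate n x)[q := (ws' ! q) h]) = 0" if "q < j" for q
      by (rule multilinear_zero_slot[OF A(1)])
         (use that len in \<open>auto simp: ws'_def nth_append intro!: set_update_memI\<close>)
    have hi: "A ((vs @ replicate n x)[q := (ws' ! q) h]) = A (h # vs @ replicate (n - 1) x)"
      if q: "j \<le> q" "q < j + n" for q
    proof (rule sym)
      have "n = Suc (n - 1)" using q by simp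
      then have "mset (vs @ replicate n x) = add_mset x (mset vs + replicate_mset (n - 1) x)"
        by (metis mset_append mset_replicate replicate_mset_Suc union_mset_add_mset_right)
      moreover have "(vs @ replicate n x) ! q = x" "(ws' ! q) h = h" using q len by (auto simp: nth_append ws'_def)
      ultimately show "mset ((vs @ replicate n x)[q := (ws' ! q) h]) = mset (h # vs @ replicate (n - 1) x)"
        using q len by (simp add: mset_update)
    qed (use len in simp)
    have "{..<j + n} = {..<j} \<union> {j..<j + n}" by auto
    then have "(\<Sum>q<j + n. A ((vs @ replicate n x)[q := (ws' ! q) h])) =
        (\<Sum>q\<in>{j..<j + n}. A (h # vs @ replicate (n - 1) x))"
      using lo hi by (simp add: sum.union_disjoint ivl_disj_int)
    then show ?thesis by (simp add: sum_constant_scaleR)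
  qed
  ultimately show ?thesis by (simp add: map_ws)
qed

text \<open>Differentiation produces the factor m - j, which turns \<open>fact (m - j)\<close> into
  \<open>fact (m - Suc j)\<close>; the summand with m = j is constant in \<open>y\<close> and drops
  out.\<close>

lemma has_derivative_taylor_family:
  fixes L :: "nat \<Rightarrow> 'a::real_normed_vector list \<Rightarrow> 'b::real_normed_vector"
  assumes ml: "\<And>m. m \<le> d \<Longrightarrow> multilinear m (L m)" and bd: "\<And>m. m \<le> d \<Longrightarrow> \<exists>C. op_bound m C (L m)"
    and sym: "\<And>m us vs. m \<le> d \<Longrightarrow> length us = m \<Longrightarrow> mset us = mset vs \<Longrightarrow> L m us = L m vs"
    and len: "length vs = j"
  shows "((\<lambda>y. taylor_family d L j y vs) has_derivative (\<lambda>h. taylor_family d L (Suc j) x (h # vs))) (at x)"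
proof -
  have "((\<lambda>y. taylor_family d L j y vs) has_derivative
      (\<lambda>h. \<Sum>m\<in>{j..d}. (1 / fact (m - j)) *\<^sub>R real (m - j) *\<^sub>R L m (h # vs @ replicate (m - j - 1) x))) (at x)"
    unfolding taylor_family_def
  proof (intro has_derivative_sum has_derivative_scaleR_right)
    fix m assume m: "m \<in> {j..d}"
    obtain C where C: "op_bound m C (L m)" using bd[of m] m by auto
    show "((\<lambda>y. L m (vs @ replicate (m - j) y)) has_derivative
        (\<lambda>h. real (m - j) *\<^sub>R L m (h # vs @ replicate (m - j - 1) x))) (at x)"
      by (rule has_derivative_symmetric_power[where j = j and C = C]) (use m ml C sym len in auto)
  qed
  moreover have "(\<Sum>m\<in>{j..d}. (1 / fact (m - j)) *\<^sub>R real (m - j) *\<^sub>R L m (h # vs @ replicate (m - j - 1) x)) =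
      taylor_family d L (Suc j) x (h # vs)" for h
    unfolding taylor_family_def
  proof (rule sum.mono_neutral_cong_right)
    show "(1 / fact (m - j)) *\<^sub>R real (m - j) *\<^sub>R L m (h # vs @ replicate (m - j - 1) x) =
        (1 / fact (m - Suc j)) *\<^sub>R L m ((h # vs) @ replicate (m - Suc j) x)" if m: "m \<in> {Suc j..d}" for m
    proof -
      have "m - j = Suc (m - Suc j)" using m by auto
      then show ?thesis by (simp add: fact_reduce del: of_nat_Suc)
    qed
  qed (auto simp: not_less_eq_eq)
  ultimately show ?thesis by simp
qed

lemma op_bound_taylor_family:
  assumes ml: "\<And>m. m \<le> d \<Longrightarrow> multilinear m (L m)" and bd: "\<And>m. m \<le> d \<Longrightarrow> \<exists>C. op_bound m C (L m)"
    and V: "bounded V"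
  shows "\<exists>C. \<forall>x\<in>V. op_bound j C (taylor_family d L j x)"
proof -
  obtain B where B: "\<And>x. x \<in> V \<Longrightarrow> norm x \<le> B" using V by (auto simp: bounded_iff)
  obtain C where C: "\<And>m. m \<le> d \<Longrightarrow> op_bound m (C m) (L m)" using bd by metis
  have "norm (taylor_family d L j x vs) \<le> (\<Sum>m\<in>{j..d}. 1 / fact (m - j) * (C m * max 1 B ^ m))"
    if x: "x \<in> V" and vs: "vs \<in> unit_lists j" for x vs
    unfolding taylor_family_def
  proof (rule sum_norm_le)
    fix m assume m: "m \<in> {j..d}"
    have len: "length (vs @ replicate (m - j) x) = m" using m vs by (simp add: unit_lists_def)
    have "prod_list (map norm (vs @ replicate (m - j) x)) \<le> max 1 B ^ length (map norm (vs @ replicate (m - j) x))"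
      by (rule prod_list_le_power) (use vs B[OF x] in \<open>force simp: unit_lists_def\<close>)
    then have "prod_list (map norm (vs @ replicate (m - j) x)) \<le> max 1 B ^ m" by (simp only: length_map len)
    moreover have "norm (L m (vs @ replicate (m - j) x)) \<le> C m * prod_list (map norm (vs @ replicate (m - j) x))"
      using op_bound_imp[OF ml C len] m by simp
    moreover have "C m \<ge> 0" using op_bound_nonneg[OF C] m by simp
    ultimately have "norm (L m (vs @ replicate (m - j) x)) \<le> C m * max 1 B ^ m"
      by (meson mult_left_mono order_trans)
    then show "norm ((1 / fact (m - j)) *\<^sub>R L m (vs @ replicate (m - j) x)) \<le> 1 / fact (m - j) * (C m * max 1 B ^ m)"
      by (simp add: divide_right_mono)
  qed
  then show ?thesis unfolding op_bound_def by blast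
qed

lemma smooth_family_taylor:
  fixes L :: "nat \<Rightarrow> 'a::real_normed_vector list \<Rightarrow> 'b::real_normed_vector"
  assumes ml: "\<And>m. m \<le> d \<Longrightarrow> multilinear m (L m)" and bd: "\<And>m. m \<le> d \<Longrightarrow> \<exists>C. op_bound m C (L m)"
    and sym: "\<And>m us vs. m \<le> d \<Longrightarrow> length us = m \<Longrightarrow> mset us = mset vs \<Longrightarrow> L m us = L m vs"
    and V: "open V" "convex V" "bounded V"
  shows "smooth_family r V (taylor_family d L)"
  by (rule smooth_familyI_bounded[OF V(1,2)])
     (use op_bound_taylor_family[OF ml bd V(3)] has_derivative_taylor_family[OF ml bd sym] in blast)+

subsection \<open>Conjugacy near a fixed point\<close>

text \<open>Each order is the derivative of the one below, so order 0 determines all. Identities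
  between maps thus transfer to their jets.\<close>

lemma smooth_family_unique:
  assumes D: "smooth_family r V D" and E: "smooth_family r V E" and V: "open V"
    and eq: "\<And>x. x \<in> V \<Longrightarrow> D 0 x [] = E 0 x []"
  shows "j \<le> r \<Longrightarrow> x \<in> V \<Longrightarrow> length vs = j \<Longrightarrow> D j x vs = E j x vs"
proof (induction j arbitrary: x vs)
  case (Suc j)
  then obtain h us where us: "vs = h # us" "length us = j" by (metis length_Suc_conv)
  have "((\<lambda>y. D j y us) has_derivative (\<lambda>h. D (Suc j) x (h # us))) (at x)"
    using smooth_family_deriv[OF D _ Suc.prems(2) us(2)] Suc.prems(1) by simp
  then have "((\<lambda>y. E j y us) has_derivative (\<lambda>h. D (Suc j) x (h # us))) (at x)"
    by (rule has_derivative_transform_within_open[OF _ V Suc.prems(2)]) (use Suc us in auto)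
  moreover have "((\<lambda>y. E j y us) has_derivative (\<lambda>h. E (Suc j) x (h # us))) (at x)"
    using smooth_family_deriv[OF E _ Suc.prems(2) us(2)] Suc.prems(1) by simp
  ultimately show ?case using has_derivative_unique us(1) by metis
qed (use eq in auto)

section \<open>Gauge spaces and the contraction argument\<close>

locale gauge_space = gauges TT w0
  for TT :: "'w \<Rightarrow> ('e::banach \<Rightarrow> 'f::real_normed_vector) set" and w0 :: 'w +
  fixes K :: real
  assumes K: "K > 0"
    and bnd_norm: "bnd w0 (K * norm x) x"
    and norm_le_bnd: "bnd w0 c x \<Longrightarrow> norm x \<le> K * c"
begin

text \<open>The strict inequality makes this an open ball although only upper bounds of the gauge
  are at hand.\<close>

definition gball :: "real \<Rightarrow> 'e set" where
  "gball \<rho> = {x. \<exists>c<\<rho>. bnd w0 c x}"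

lemma open_gball: "open (gball \<rho>)"
  unfolding open_dist
proof
  fix x assume "x \<in> gball \<rho>"
  then obtain c where c: "c < \<rho>" "bnd w0 c x" by (auto simp: gball_def)
  have "y \<in> gball \<rho>" if "dist y x < (\<rho> - c) / K" for y
  proof -
    have "bnd w0 (c + K * norm (y - x)) (x + (y - x))" by (rule bnd_add[OF c(2) bnd_norm])
    moreover have "c + K * norm (y - x) < \<rho>" using that K by (simp add: dist_norm field_simps)
    ultimately show ?thesis unfolding gball_def by auto
  qed
  then show "\<exists>e>0. \<forall>y. dist y x < e \<longrightarrow> y \<in> gball \<rho>"
    using c K by (intro exI[of _ "(\<rho> - c) / K"]) auto
qed

lemma convex_gball: "convex (gball \<rho>)"
proof (rule convexI)
  fix x y and u v :: real assume x: "x \<in> gball \<rho>" and y: "y \<in> gball \<rho>" and uv: "0 \<le> u" "0 \<le> v" "u + v = 1"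
  obtain c d where c: "c < \<rho>" "bnd w0 c x" and d: "d < \<rho>" "bnd w0 d y"
    using x y by (auto simp: gball_def)
  have "bnd w0 (u * c + v * d) (u *\<^sub>R x + v *\<^sub>R y)"
    using bnd_add[OF bnd_scale[OF c(2), of u] bnd_scale[OF d(2), of v]] uv by simp
  moreover have "u * c + v * d < \<rho>" using convex_bound_lt[OF c(1) d(1) uv] .
  ultimately show "u *\<^sub>R x + v *\<^sub>R y \<in> gball \<rho>" unfolding gball_def by blast
qed

lemma bounded_gball: "bounded (gball \<rho>)"
  unfolding bounded_iff
proof (intro exI ballI)
  fix x assume "x \<in> gball \<rho>"
  then obtain c where c: "c < \<rho>" "bnd w0 c x" by (auto simp: gball_def)
  then show "norm x \<le> K * \<rho>" using norm_le_bnd[OF c(2)] K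
    by (meson less_imp_le mult_left_mono order_trans)
qed

lemma zero_gball: "0 < \<rho> \<Longrightarrow> 0 \<in> gball \<rho>"
  unfolding gball_def using bnd_zero by blast

lemma gballD: "x \<in> gball \<rho> \<Longrightarrow> bnd w0 \<rho> x"
  unfolding gball_def by (auto intro: bnd_mono)

lemma gballI: "bnd w0 c x \<Longrightarrow> c < \<rho> \<Longrightarrow> x \<in> gball \<rho>"
  unfolding gball_def by blast

text \<open>Each \<open>T\<close> that generates the gauge is bounded and linear, so the mean value
  inequality applies to \<open>T\<close> after \<open>f\<close>.\<close>

lemma bnd_mean_value:
  assumes V: "convex V" "x \<in> V" "y \<in> V" and der: "\<And>z. z \<in> V \<Longrightarrow> (f has_derivative f' z) (at z)"
    and B: "\<And>z. z \<in> V \<Longrightarrow> bnd w c (f' z (y - x))"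
  shows "bnd w c (f y - f x)"
  unfolding bnd_def
proof (intro conjI ballI)
  show "0 \<le> c" using B[OF V(2)] bnd_nonneg by blast
  fix T assume T: "T \<in> TT w"
  note bl = bounded_linear_gauge[OF T]
  have "norm (T (f y) - T (f x) - 0) \<le> c"
  proof (rule mean_value_bound[OF V])
    show "((\<lambda>y. T (f y)) has_derivative (\<lambda>h. T (f' z h))) (at z)" if "z \<in> V" for z
      using bounded_linear.has_derivative[OF bl der[OF that]] .
    show "norm (T (f' z (y - x)) - 0) \<le> c" if "z \<in> V" for z
      using B[OF that] T by (simp add: bnd_def)
  qed
  then show "norm (T (f y - f x)) \<le> c" by (simp add: linear_diff[OF bounded_linear.linear[OF bl]])
qed

text \<open>The direction \<open>y - x\<close> enters as an additional argument controlled in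
  \<open>w0\<close> only; smallness in \<open>w\<close> comes from \<open>vs\<close>. For
  \<open>j = 0\<close> the claim is therefore empty unless \<open>w = w0\<close>.\<close>

lemma admw_lipschitz:
  assumes V: "convex V" "x \<in> V" "y \<in> V"
    and der: "\<And>z vs. z \<in> V \<Longrightarrow> length vs = j \<Longrightarrow>
      ((\<lambda>y. D j y vs) has_derivative (\<lambda>h. D (Suc j) z (h # vs))) (at z)"
    and ml: "\<And>z. z \<in> V \<Longrightarrow> multilinear (Suc j) (D (Suc j) z)"
    and adm: "\<And>z. z \<in> V \<Longrightarrow> admw w c (Suc j) (D (Suc j) z)"
    and d: "bnd w0 d (y - x)" "0 < d"
  shows "admw w (c * d) j (\<lambda>vs. D j y vs - D j x vs)"
  unfolding admw_def
proof (intro allI impI)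
  fix vs assume len: "length vs = j" and u: "unitl w vs"
  show "bnd w (c * d) (D j y vs - D j x vs)"
  proof (rule bnd_mean_value[OF V der[OF _ len]])
    fix z assume z: "z \<in> V"
    let ?fs = "d # replicate j 1"
    have vs1: "bnd w0 1 (vs ! q)" if "q < j" for q
      using u that len by (auto simp: unitl_def)
    have "bnd w (c * prod_list ?fs) (D (Suc j) z ((y - x) # vs))"
    proof (rule admw_scaled[OF ml[OF z] adm[OF z]])
      show "0 < ?fs ! q \<and> bnd w0 (?fs ! q) (((y - x) # vs) ! q)" if "q < Suc j" for q
        using that d vs1 by (cases q) auto
      show "w = w0 \<or> (\<exists>q<Suc j. bnd w (?fs ! q) (((y - x) # vs) ! q))"
      proof (cases "w = w0")
        case False
        then obtain v where "v \<in> set vs" "bnd w 1 v" using u by (auto simp: unitl_def)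
        then obtain q where "q < j" "bnd w 1 (vs ! q)" using len by (auto simp: in_set_conv_nth)
        then show ?thesis by (intro disjI2 exI[of _ "Suc q"]) simp
      qed simp
    qed (use len in auto)
    then show "bnd w (c * d) (D (Suc j) z ((y - x) # vs))" by simp
  qed
qed

text \<open>Downward induction from order \<open>s\<close>: a derivative that vanishes at 0 is
  controlled by the next one in direction \<open>x\<close>, and as \<open>x\<close> has gauge at
  most 1 the constant does not grow.\<close>

lemma admw_vanishing:
  assumes V: "convex V" "0 \<in> V" "V \<subseteq> gball 1"
    and der: "\<And>j x vs. j < r \<Longrightarrow> x \<in> V \<Longrightarrow> length vs = j \<Longrightarrow>
      ((\<lambda>y. D j y vs) has_derivative (\<lambda>h. D (Suc j) x (h # vs))) (at x)"
    and zero: "\<And>j vs. j < s \<Longrightarrow> length vs = j \<Longrightarrow> D j 0 vs = 0"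
    and s: "s \<le> r" and adm: "\<And>j x. s \<le> j \<Longrightarrow> j \<le> r \<Longrightarrow> x \<in> V \<Longrightarrow> admw w c j (D j x)"
  shows "j \<le> r \<Longrightarrow> x \<in> V \<Longrightarrow> admw w c j (D j x)"
proof -
  have low: "\<forall>x\<in>V. admw w c j (D j x)" if "j \<le> s" for j
    using that
  proof (induction rule: inc_induct)
    case base
    show ?case using adm s by simp
  next
    case (step j)
    show ?case unfolding admw_def
    proof (intro ballI allI impI)
      fix x vs assume x: "x \<in> V" and len: "length vs = j" and u: "unitl w vs"
      have jr: "j < r" using step s by simp
      have "bnd w c (D j x vs - D j 0 vs)"
      proof (rule bnd_mean_value[OF V(1,2) x])
        fix z assume z: "z \<in> V"
        show "((\<lambda>y. D j y vs) has_derivative (\<lambda>h. D (Suc j) z (h # vs))) (at z)"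
          by (rule der[OF jr z len])
        have "bnd w0 1 x" using x V(3) gballD by blast
        with u have "unitl w (x # vs)" by (auto simp: unitl_def)
        then show "bnd w c (D (Suc j) z ((x - 0) # vs))"
          using step.IH z len by (auto simp: admw_def)
      qed
      then show "bnd w c (D j x vs)" using zero[OF step(2) len] by simp
    qed
  qed
  then show "j \<le> r \<Longrightarrow> x \<in> V \<Longrightarrow> admw w c j (D j x)" using adm by (cases "j \<le> s") auto
qed

text \<open>A unit vector of the norm has gauge at most \<open>K\<close>, which gives one
  \<open>K\<close> for each slot; the last one returns from the gauge to the norm.\<close>

lemma admw_imp_op_bound:
  assumes A: "multilinear j A" "admw w0 c j A"
  shows "op_bound j (K * c * K ^ j) A"
  unfolding op_bound_def
proof
  fix vs :: "'e list" assume vs: "vs \<in> unit_lists j"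
  then have len: "length vs = j" by (simp add: unit_lists_def)
  have "bnd w0 K (vs ! q)" if "q < j" for q
    using bnd_mono[OF bnd_norm, of "vs ! q" K] vs that K len by (auto simp: unit_lists_def)
  then have "bnd w0 (c * prod_list (replicate j K)) (A vs)"
    using K len by (intro admw_scaled[OF A]) auto
  from norm_le_bnd[OF this] show "norm (A vs) \<le> K * c * K ^ j" by (simp add: mult.assoc)
qed

lemma admw_linear:
  assumes "\<And>w c x. bnd w c x \<Longrightarrow> bnd w (\<theta> * c) (T x)" "admw w c j A"
  shows "admw w (\<theta> * c) j (\<lambda>vs. T (A vs))"
  using assms by (simp add: admw_def)

text \<open>The constant \<open>\<eta>\<close> is fixed before \<open>F\<close> and
  \<open>N\<close>, and all estimates are uniform in the gauge \<open>w\<close>. \<open>N\<close>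
  lives on the ball of radius 3 because the iterates stay within gauge 2; it is one order smoother
  because comparing it at two base points costs a derivative.\<close>

theorem conjugacy:
  assumes \<theta>: "0 < \<theta>" "\<theta> < 1" and \<theta>': "0 < \<theta>'" "\<theta>' * \<theta> ^ s < 1" and s: "2 \<le> s" "s \<le> r"
  obtains \<eta> where "0 < \<eta>" "\<eta> \<le> 1"
    and "\<And>F N A B.
      smooth_family r (gball 1) F \<Longrightarrow> F 0 0 [] = 0 \<Longrightarrow>
      (\<And>w x. x \<in> gball 1 \<Longrightarrow> admw w \<theta> 1 (F 1 x)) \<Longrightarrow>
      (\<And>w j x. x \<in> gball 1 \<Longrightarrow> 2 \<le> j \<Longrightarrow> j \<le> r \<Longrightarrow> admw w \<eta> j (F j x)) \<Longrightarrow>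
      smooth_family (Suc r) (gball 3) N \<Longrightarrow>
      (\<And>w j x. x \<in> gball 3 \<Longrightarrow> 1 \<le> j \<Longrightarrow> j \<le> Suc r \<Longrightarrow> admw w \<eta> j (N j x)) \<Longrightarrow>
      linear A \<Longrightarrow> bounded_linear B \<Longrightarrow> (\<And>x. A (B x) = x) \<Longrightarrow> (\<And>x. B (A x) = x) \<Longrightarrow>
      (\<And>w c x. bnd w c x \<Longrightarrow> bnd w (\<theta>' * c) (B x)) \<Longrightarrow>
      (\<And>j vs. j < s \<Longrightarrow> length vs = j \<Longrightarrow> F j 0 vs = N j 0 vs + A (id_family j 0 vs)) \<Longrightarrow>
      \<exists>R. smooth_family r (gball 1) R \<and> R 0 0 [] = 0 \<and> (\<forall>h. R 1 0 [h] = h) \<and>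
        (\<forall>w j. \<forall>x\<in>gball 1. j \<le> r \<longrightarrow> admw w 2 j (R j x)) \<and>
        (\<forall>x\<in>gball 1. R 0 (F 0 x []) [] = A (R 0 x []) + N 0 (R 0 x []) [])"
proof -
  \<comment> \<open>The midpoint of \<open>\<theta>' * \<theta> ^ s\<close> and 1: half of the gap
    is left to the perturbations.\<close>
  define \<kappa> where "\<kappa> = (1 + \<theta>' * \<theta> ^ s) / 2"
  have \<kappa>: "0 < \<kappa>" "\<kappa> < 1" using \<theta> \<theta>' by (auto simp: \<kappa>_def add_pos_pos)
  \<comment> \<open>Collects, over all orders up to \<open>r\<close>, the constants of
    \<open>jcomp_contraction\<close> and of \<open>jcomp_diff\<close>, the latter used with bound 2
    for the inner jets and \<open>3 * \<eta>\<close> for the outer ones.\<close>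
  define M where "M = (\<Sum>j\<le>r. real (bell j) + real (bell j) * (2 ^ j * (1 + 3 * real j)))"
  have M: "real (bell j) + real (bell j) * (2 ^ j * (1 + 3 * real j)) \<le> M" if "j \<le> r" for j
    unfolding M_def using that by (intro member_le_sum) auto
  have M0: "M \<ge> 0" unfolding M_def by (intro sum_nonneg) auto
  \<comment> \<open>The second entry brings the contraction factor below \<open>\<kappa>\<close>;
    the third keeps the sum of all steps below 1, so that iterates starting at the identity stay
    within gauge 2.\<close>
  define \<eta> where "\<eta> = min 1 (min ((1 - \<theta>' * \<theta> ^ s) / (2 * \<theta>' * (M + 1))) ((1 - \<kappa>) / (2 * \<theta>')))"
  have \<eta>: "\<eta> > 0" "\<eta> \<le> 1" using \<theta> \<theta>' M0 \<kappa> by (auto simp: \<eta>_def)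
  have \<eta>M: "\<theta>' * (\<theta> ^ s + M * \<eta>) \<le> \<kappa>"
  proof -
    have "\<eta> \<le> (1 - \<theta>' * \<theta> ^ s) / (2 * \<theta>' * (M + 1))" by (simp add: \<eta>_def)
    moreover have "2 * \<theta>' * (M + 1) > 0" using \<theta>'(1) M0 by simp
    ultimately have "\<eta> * (2 * \<theta>' * (M + 1)) \<le> 1 - \<theta>' * \<theta> ^ s" by (simp only: pos_le_divide_eq)
    then have "\<theta>' * (M + 1) * \<eta> \<le> (1 - \<theta>' * \<theta> ^ s) / 2" by (simp add: algebra_simps)
    moreover have "\<theta>' * M * \<eta> \<le> \<theta>' * (M + 1) * \<eta>" using \<theta>'(1) \<eta> by simp
    ultimately show ?thesis by (simp add: \<kappa>_def algebra_simps)
  qed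
  \<comment> \<open>The size of the first step: in orders from \<open>s\<close> on the identity has
    no derivative, while \<open>F\<close> and \<open>N\<close> contribute \<open>\<eta>\<close> each
    before the inverse multiplies by \<open>\<theta>'\<close>.\<close>
  define c0 where "c0 = 2 * \<theta>' * \<eta>"
  have c0: "c0 > 0" "c0 / (1 - \<kappa>) \<le> 1"
  proof -
    show "c0 > 0" using \<theta>' \<eta> by (simp add: c0_def)
    have "\<eta> \<le> (1 - \<kappa>) / (2 * \<theta>')" by (simp add: \<eta>_def)
    then show "c0 / (1 - \<kappa>) \<le> 1" using \<theta>' \<kappa> by (simp add: c0_def field_simps)
  qed
  have geo: "1 + c0 * (\<Sum>i<k. \<kappa> ^ i) \<le> 2" for k
  proof -
    have "(\<Sum>i<k. \<kappa> ^ i) \<le> 1 / (1 - \<kappa>)" using \<kappa> by (simp add: sum_gp_strict divide_right_mono)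
    then have "c0 * (\<Sum>i<k. \<kappa> ^ i) \<le> c0 * (1 / (1 - \<kappa>))" using c0(1) by (intro mult_left_mono) auto
    then show ?thesis using c0(2) by simp
  qed
  let ?V = "gball 1" and ?W = "gball 3"
  have V: "open ?V" "convex ?V" "bounded ?V" "0 \<in> ?V" and W: "open ?W" "convex ?W" "0 \<in> ?W"
    by (auto simp: open_gball convex_gball bounded_gball zero_gball)
  show ?thesis
  proof (rule that[OF \<eta>])
    fix F N :: "nat \<Rightarrow> 'e \<Rightarrow> 'e list \<Rightarrow> 'e" and A B :: "'e \<Rightarrow> 'e"
    assume F: "smooth_family r ?V F" and F00: "F 0 0 [] = 0"
      and F1': "\<And>w x. x \<in> ?V \<Longrightarrow> admw w \<theta> 1 (F 1 x)"
      and F2': "\<And>w j x. x \<in> ?V \<Longrightarrow> 2 \<le> j \<Longrightarrow> j \<le> r \<Longrightarrow> admw w \<eta> j (F j x)"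
      and N: "smooth_family (Suc r) ?W N"
      and Nadm': "\<And>w j x. x \<in> ?W \<Longrightarrow> 1 \<le> j \<Longrightarrow> j \<le> Suc r \<Longrightarrow> admw w \<eta> j (N j x)"
      and A: "linear A" and B: "bounded_linear B" and AB: "\<And>x. A (B x) = x" and BA: "\<And>x. B (A x) = x"
      and Bb': "\<And>w c x. bnd w c x \<Longrightarrow> bnd w (\<theta>' * c) (B x)"
      and jets': "\<And>j vs. j < s \<Longrightarrow> length vs = j \<Longrightarrow> F j 0 vs = N j 0 vs + A (id_family j 0 vs)"
    have F1: "\<forall>w. \<forall>x\<in>?V. admw w \<theta> 1 (F 1 x)"
      and F2: "\<forall>w j. \<forall>x\<in>?V. 2 \<le> j \<longrightarrow> j \<le> r \<longrightarrow> admw w \<eta> j (F j x)"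
      and Nadm: "\<forall>w j. \<forall>x\<in>?W. 1 \<le> j \<longrightarrow> j \<le> Suc r \<longrightarrow> admw w \<eta> j (N j x)"
      and Bb: "\<forall>w c x. bnd w c x \<longrightarrow> bnd w (\<theta>' * c) (B x)"
      and jets: "\<forall>j<s. \<forall>vs. length vs = j \<longrightarrow> F j 0 vs = N j 0 vs + A (id_family j 0 vs)"
      using F1' F2' Nadm' Bb' jets' by simp_all
    note Blin = bounded_linear.linear[OF B]
    have r: "0 < r" "1 \<le> r" using s by auto
    have Nr: "smooth_family r ?W N" using N by (rule smooth_family_less) simp
    have Fml: "multilinear j (F j x)" if "j \<le> r" "x \<in> ?V" for j x
      using smooth_family_multilinear[OF F V(1) that] .
    have Nml: "multilinear j (N j x)" if "j \<le> Suc r" "x \<in> ?W" for j x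
      using smooth_family_multilinear[OF N W(1) that] .
    \<comment> \<open>The unit ball is mapped into itself since the first derivative has bound
      \<open>\<theta> < 1\<close>. The radius \<open>c\<close> is enlarged to \<open>c'\<close>
      because \<open>admw_lipschitz\<close> asks for a positive distance bound.\<close>
    have FV: "F 0 x [] \<in> ?V" if xV: "x \<in> ?V" for x
    proof -
      obtain c where c: "c < 1" "bnd w0 c x" using xV by (auto simp: gball_def)
      define c' where "c' = (c + 1) / 2"
      have c': "0 < c'" "c' < 1" "c \<le> c'" using c bnd_nonneg[OF c(2)] by (auto simp: c'_def)
      have "admw w0 (\<theta> * c') 0 (\<lambda>vs. F 0 x vs - F 0 0 vs)"
        by (rule admw_lipschitz[OF V(2,4) xV])
           (use smooth_family_deriv[OF F r(1)] Fml r F1 bnd_mono[OF c(2) c'(3)] c'(1) in auto)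
      then have "bnd w0 (\<theta> * c') (F 0 x [])" using F00 by (auto simp: admw_def unitl_def)
      moreover have "\<theta> * c' < 1" using mult_strict_mono[of \<theta> 1 c' 1] \<theta> c' by simp
      ultimately show ?thesis by (rule gballI)
    qed
    have N00: "N 0 0 [] = 0" using jets F00 s linear_0[OF A] by (force simp: id_family_def)
    \<comment> \<open>In order 0 only \<open>w0\<close> says anything: an empty list contains no
      argument that is small in another gauge.\<close>
    have N0: "admw w (3 * \<eta>) 0 (N 0 y)" if "y \<in> ?W" for w y
    proof (cases "w = w0")
      case True
      have "admw w0 (\<eta> * 3) 0 (\<lambda>vs. N 0 y vs - N 0 0 vs)"
        by (rule admw_lipschitz[OF W(2,3) that])
           (use smooth_family_deriv[OF N] Nml Nadm gballD[OF that] in auto)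
      then show ?thesis using True N00 by (auto simp: admw_def mult.commute)
    qed (simp add: admw_def unitl_def)
    have Np: "admw w (3 * \<eta>) p (N p y)" if "y \<in> ?W" "p \<le> r" for w y p
    proof (cases "p = 0")
      case False
      then have "admw w \<eta> p (N p y)" using Nadm that by simp
      then show ?thesis by (rule admw_mono) (use \<eta> in simp)
    qed (use N0[OF that(1)] in simp)
    \<comment> \<open>The iteration runs on whole jets: order 0 is the map, and
      \<open>comp_family\<close> supplies the derivatives of both composites.\<close>
    define Rf where "Rf = rec_nat id_family
      (\<lambda>_ S j x vs. B (comp_family S F j x vs - comp_family N S j x vs))"
    have Rf0: "Rf 0 = id_family"
      and RfS: "Rf (Suc k) = (\<lambda>j x vs. B (comp_family (Rf k) F j x vs - comp_family N (Rf k) j x vs))" for k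
      by (simp_all add: Rf_def)
    define \<Delta> where "\<Delta> k j x vs = Rf (Suc k) j x vs - Rf k j x vs" for k j x vs
    have inW: "T [] \<in> ?W" if "admw w0 2 0 T" for T
      by (rule gballI[of 2]) (use that in \<open>auto simp: admw_def unitl_def\<close>)
    have next_smooth: "smooth_family r ?V (Rf (Suc k))"
      if "smooth_family r ?V (Rf k)" "\<And>x. x \<in> ?V \<Longrightarrow> Rf k 0 x [] \<in> ?W" for k
      unfolding RfS
      by (intro smooth_family_linear[OF B] smooth_family_diff smooth_family_comp[OF that(1) F V(1,1) FV]
          smooth_family_comp[OF Nr that(1) V(1) W(1) that(2)])
    have id_adm: "admw w 1 j (id_family j x)" if "x \<in> ?V" for w j x
      unfolding admw_def
    proof (intro allI impI)
      fix vs assume "length vs = j" "unitl w vs"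
      then show "bnd w 1 (id_family j x vs)"
        using gballD[OF that] by (cases vs) (auto simp: id_family_def unitl_def bnd_zero)
    qed
    \<comment> \<open>\<open>Rf (Suc k)\<close> is included because the bound on
      \<open>\<Delta> k\<close> is obtained by differentiating it. The vanishing below order
      \<open>s\<close> is what admits \<open>admw_vanishing\<close> at each step.\<close>
    have inv: "smooth_family r ?V (Rf k) \<and> smooth_family r ?V (Rf (Suc k)) \<and>
        (\<forall>w j x. j \<le> r \<longrightarrow> x \<in> ?V \<longrightarrow> admw w (1 + c0 * (\<Sum>i<k. \<kappa> ^ i)) j (Rf k j x)) \<and>
        (\<forall>w j x. j \<le> r \<longrightarrow> x \<in> ?V \<longrightarrow> admw w (c0 * \<kappa> ^ k) j (\<Delta> k j x)) \<and>
        (\<forall>j vs. j < s \<longrightarrow> length vs = j \<longrightarrow> \<Delta> k j 0 vs = 0)" for k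
    proof (induction k)
      case 0
      have sm: "smooth_family r ?V (Rf 0)" unfolding Rf0 by (rule smooth_family_id[OF V(1-3)])
      have ad: "admw w (1 + c0 * (\<Sum>i<0. \<kappa> ^ i)) j (Rf 0 j x)" if "x \<in> ?V" for w j x
        using id_adm[OF that] by (simp add: Rf0)
      have map: "Rf 0 0 x [] \<in> ?W" if "x \<in> ?V" for x
        by (rule inW[where T = "Rf 0 0 x"], rule admw_mono, rule ad[OF that]) simp
      have sm1: "smooth_family r ?V (Rf (Suc 0))" by (rule next_smooth[OF sm map])
      \<comment> \<open>Composition with the identity reproduces a jet: order 0 agrees, and
        uniqueness of derivatives gives the rest.\<close>
      have eqF: "comp_family id_family F j x vs = F j x vs" if "j \<le> r" "x \<in> ?V" "length vs = j" for j x vs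
        by (rule smooth_family_unique[OF smooth_family_comp[OF sm[unfolded Rf0] F V(1,1) FV] F V(1) _ that])
           (simp_all add: comp_family_def id_family_def)
      have eqN: "comp_family N id_family j x vs = N j x vs" if "j \<le> r" "x \<in> ?V" "length vs = j" for j x vs
      proof (rule smooth_family_unique[OF smooth_family_comp[OF Nr sm[unfolded Rf0] V(1) W(1)] _ V(1) _ that])
        show "id_family 0 x [] \<in> ?W" if "x \<in> ?V" for x using map[OF that] by (simp add: Rf0)
        show "smooth_family r ?V N" using Nr
          by (rule smooth_family_subset) (force simp: gball_def)
      qed (simp_all add: comp_family_def id_family_def)
      have \<Delta>0: "\<Delta> 0 j x vs = B (F j x vs - N j x vs) - id_family j x vs"
        if "j \<le> r" "x \<in> ?V" "length vs = j" for j x vs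
        using that by (simp add: \<Delta>_def RfS Rf0 eqF eqN)
      \<comment> \<open>At 0 the jets of \<open>F\<close> and \<open>N + A\<close> agree below order
        \<open>s\<close>, so \<open>B\<close> returns the jet of the identity.\<close>
      have zero: "\<Delta> 0 j 0 vs = 0" if "j < s" "length vs = j" for j vs
        using that jets BA s V(4) by (simp add: \<Delta>0)
      have sub: "?V \<subseteq> ?W" by (force simp: gball_def)
      have "admw w (c0 * \<kappa> ^ 0) j (\<Delta> 0 j x)" if "j \<le> r" "x \<in> ?V" for w j x
      proof (rule admw_vanishing[where D = "\<Delta> 0", OF V(2,4) order_refl _ zero s(2) _ that])
        show "((\<lambda>y. \<Delta> 0 j y vs) has_derivative (\<lambda>h. \<Delta> 0 (Suc j) x (h # vs))) (at x)"
          if "j < r" "x \<in> ?V" "length vs = j" for j x vs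
          unfolding \<Delta>_def by (intro has_derivative_diff smooth_family_deriv[OF sm] smooth_family_deriv[OF sm1] that)
        show "admw w (c0 * \<kappa> ^ 0) j (\<Delta> 0 j x)" if j: "s \<le> j" "j \<le> r" and x: "x \<in> ?V" for j x
        proof -
          have "admw w (\<theta>' * (\<eta> + \<eta>)) j (\<lambda>vs. B (F j x vs - N j x vs))"
            by (rule admw_linear[OF _ admw_diff]) (use Bb F2 Nadm j x s sub in auto)
          moreover have "id_family j x vs = 0" if "length vs = j" for vs using j s by (simp add: id_family_def)
          ultimately show ?thesis
            using j x by (auto simp: admw_def \<Delta>0 c0_def mult_ac)
        qed
      qed
      with sm sm1 ad zero show ?case by simp
    next
      case (Suc k)
      define c where "c = c0 * \<kappa> ^ k"
      have cpos: "c > 0" using c0 \<kappa> by (simp add: c_def)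
      have sm: "smooth_family r ?V (Rf k)" and sm1: "smooth_family r ?V (Rf (Suc k))"
        and ad: "\<And>w j x. j \<le> r \<Longrightarrow> x \<in> ?V \<Longrightarrow> admw w (1 + c0 * (\<Sum>i<k. \<kappa> ^ i)) j (Rf k j x)"
        and \<Delta>ad: "\<And>w j x. j \<le> r \<Longrightarrow> x \<in> ?V \<Longrightarrow> admw w c j (\<Delta> k j x)"
        and \<Delta>0: "\<And>j vs. j < s \<Longrightarrow> length vs = j \<Longrightarrow> \<Delta> k j 0 vs = 0"
        using Suc.IH by (auto simp: c_def)
      have ad1: "admw w (1 + c0 * (\<Sum>i<Suc k. \<kappa> ^ i)) j (Rf (Suc k) j x)" if "j \<le> r" "x \<in> ?V" for w j x
        using admw_add[OF ad[OF that] \<Delta>ad[OF that]] by (simp add: \<Delta>_def c_def algebra_simps)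
      have ad2: "admw w 2 j (Rf k j x)" "admw w 2 j (Rf (Suc k) j x)" if "j \<le> r" "x \<in> ?V" for w j x
        using admw_mono[OF ad[OF that] geo] admw_mono[OF ad1[OF that] geo] by auto
      have map: "Rf k 0 x [] \<in> ?W" "Rf (Suc k) 0 x [] \<in> ?W" if "x \<in> ?V" for x
        by (rule inW[where T = "Rf k 0 x"], rule ad2(1)[OF le0 that])
           (rule inW[where T = "Rf (Suc k) 0 x"], rule ad2(2)[OF le0 that])
      have sm2: "smooth_family r ?V (Rf (Suc (Suc k)))" by (rule next_smooth[OF sm1 map(2)])
      \<comment> \<open>The first composite is linear in the iterate, so its increment is
        \<open>\<Delta> k\<close> composed with \<open>F\<close>; the composite with
        \<open>N\<close> is not and remains a difference.\<close>
      have step: "\<Delta> (Suc k) j x vs = B (comp_family (\<Delta> k) F j x vs -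
          (comp_family N (Rf (Suc k)) j x vs - comp_family N (Rf k) j x vs))" for j x vs
      proof -
        have "comp_family (\<Delta> k) F j x vs = comp_family (Rf (Suc k)) F j x vs - comp_family (Rf k) F j x vs"
          by (simp add: comp_family_def jcomp_def \<Delta>_def sum_list_subtractf)
        then show ?thesis
          unfolding \<Delta>_def[of "Suc k"] RfS[of "Suc k"] by (subst RfS[of k]) (simp add: linear_diff[OF Blin])
      qed
      \<comment> \<open>A jet of order j of a composite at 0 depends only on jets of order at most j
        of the factors, and \<open>F\<close> fixes 0.\<close>
      have zero: "\<Delta> (Suc k) j 0 vs = 0" if j: "j < s" and len: "length vs = j" for j vs
      proof -
        have R_eq: "Rf (Suc k) i 0 us = Rf k i 0 us" if "i < s" "length us = i" for i us
          using \<Delta>0[OF that] by (simp add: \<Delta>_def)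
        have "\<Delta> k (length \<pi>) 0 us = 0" if "\<pi> \<in> set (parts vs)" "length us = length \<pi>" for \<pi> us
          using \<Delta>0[of "length \<pi>" us] parts_length[OF that(1)] that(2) j len by simp
        then have "comp_family (\<Delta> k) F j 0 vs = 0"
          by (simp add: comp_family_def jcomp_def F00 cong: map_cong)
        moreover have "comp_family N (Rf (Suc k)) j 0 vs = comp_family N (Rf k) j 0 vs"
        proof -
          have "Rf (Suc k) (length b) 0 b = Rf k (length b) 0 b" if "\<pi> \<in> set (parts vs)" "b \<in> set \<pi>" for \<pi> b
            using R_eq[of "length b" b] parts_block[OF that] j len by simp
          moreover have "Rf (Suc k) 0 0 [] = Rf k 0 0 []" using R_eq[of 0 "[]"] s by simp
          ultimately show ?thesis by (simp add: comp_family_def jcomp_def cong: map_cong)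
        qed
        ultimately show ?thesis by (simp add: step linear_0[OF Blin])
      qed
      have "admw w (c0 * \<kappa> ^ Suc k) j (\<Delta> (Suc k) j x)" if "j \<le> r" "x \<in> ?V" for w j x
      proof (rule admw_vanishing[where D = "\<Delta> (Suc k)", OF V(2,4) order_refl _ zero s(2) _ that])
        show "((\<lambda>y. \<Delta> (Suc k) j y vs) has_derivative (\<lambda>h. \<Delta> (Suc k) (Suc j) x (h # vs))) (at x)"
          if "j < r" "x \<in> ?V" "length vs = j" for j x vs
          unfolding \<Delta>_def by (intro has_derivative_diff smooth_family_deriv[OF sm1] smooth_family_deriv[OF sm2] that)
        show "admw w (c0 * \<kappa> ^ Suc k) j (\<Delta> (Suc k) j x)" if j: "s \<le> j" "j \<le> r" and x: "x \<in> ?V" for j x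
        proof -
          have Fx: "F 0 x [] \<in> ?V" by (rule FV[OF x])
          have \<Delta>ml: "multilinear p (\<Delta> k p y)" if "p \<le> r" "y \<in> ?V" for p y
            using multilinear_diff[OF smooth_family_multilinear[OF sm1 V(1) that]
                smooth_family_multilinear[OF sm V(1) that]] by (simp add: \<Delta>_def[abs_def])
          have 1: "admw w (c * (\<theta> ^ j + real (bell j) * \<eta>)) j (comp_family (\<Delta> k) F j x)"
            unfolding comp_family_def
            by (rule jcomp_contraction) (use \<Delta>ml \<Delta>ad F1 F2 Fx x j \<theta> \<eta> cpos in auto)
          \<comment> \<open>Comparing order p of \<open>N\<close> at two base points uses order p +
            1; this is where order \<open>Suc r\<close> of \<open>N\<close> enters.\<close>
          have lip: "admw w (\<eta> * c) p (\<lambda>vs. N p (Rf (Suc k) 0 x []) vs - N p (Rf k 0 x []) vs)" if "p \<le> r" for p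
          proof (rule admw_lipschitz[OF W(2)])
            have "admw w0 c 0 (\<Delta> k 0 x)" by (rule \<Delta>ad) (use x in auto)
            then show "bnd w0 c (Rf (Suc k) 0 x [] - Rf k 0 x [])" by (simp add: admw_def \<Delta>_def unitl_def)
          qed (use smooth_family_deriv[OF N] Nml Nadm map[OF x] cpos that in auto)
          have 2: "admw w (real (bell j) * (\<eta> * c * 2 ^ j + real j * (3 * \<eta> * c * 2 ^ j))) j
            (\<lambda>vs. comp_family N (Rf (Suc k)) j x vs - comp_family N (Rf k) j x vs)"
            unfolding comp_family_def
          proof (rule jcomp_diff)
            show "multilinear p (N p (Rf k 0 x [])) \<and> multilinear p (N p (Rf (Suc k) 0 x [])) \<and>
              admw w (\<eta> * c) p (\<lambda>vs. N p (Rf (Suc k) 0 x []) vs - N p (Rf k 0 x []) vs) \<and>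
              admw w (3 * \<eta>) p (N p (Rf k 0 x []))" if "p \<le> j" for p
              using Nml map[OF x] lip Np that j by auto
            show "admw w' 2 i (Rf k i x) \<and> admw w' 2 i (Rf (Suc k) i x) \<and>
              admw w' c i (\<lambda>vs. Rf (Suc k) i x vs - Rf k i x vs)" if "i \<le> j" for w' i
              using ad2[of i x w'] \<Delta>ad[of i x w'] that j x by (simp add: \<Delta>_def[abs_def])
          qed (use cpos \<eta> in auto)
          have "admw w (\<theta>' * (c * (\<theta> ^ j + real (bell j) * \<eta>) +
              real (bell j) * (\<eta> * c * 2 ^ j + real j * (3 * \<eta> * c * 2 ^ j)))) j (\<Delta> (Suc k) j x)"
            using admw_linear[of \<theta>' B, OF _ admw_diff[OF 1 2]] Bb by (simp add: step[abs_def])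
          then show ?thesis
          proof (rule admw_mono)
            have "\<theta>' * (c * (\<theta> ^ j + real (bell j) * \<eta>) +
              real (bell j) * (\<eta> * c * 2 ^ j + real j * (3 * \<eta> * c * 2 ^ j))) =
              c * (\<theta>' * (\<theta> ^ j + (real (bell j) + real (bell j) * (2 ^ j * (1 + 3 * real j))) * \<eta>))"
              by (simp add: algebra_simps)
            \<comment> \<open>Here the restriction to orders \<open>s \<le> j\<close> pays off:
              \<open>\<theta> ^ j \<le> \<theta> ^ s\<close>.\<close>
            also have "\<dots> \<le> c * (\<theta>' * (\<theta> ^ s + M * \<eta>))"
              using cpos \<theta>' \<eta> \<theta> M[OF j(2)] j
              by (intro mult_left_mono add_mono mult_right_mono power_decreasing) auto
            also have "\<dots> \<le> c * \<kappa>" using \<eta>M cpos by (intro mult_left_mono) auto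
            finally show "\<theta>' * (c * (\<theta> ^ j + real (bell j) * \<eta>) +
              real (bell j) * (\<eta> * c * 2 ^ j + real j * (3 * \<eta> * c * 2 ^ j))) \<le> c0 * \<kappa> ^ Suc k"
              by (simp add: c_def mult_ac)
          qed
        qed
      qed
      with sm1 sm2 ad1 zero show ?case by blast
    qed
    have sm: "smooth_family r ?V (Rf k)" for k using inv by blast
    have ad2: "admw w 2 j (Rf k j x)" if "j \<le> r" "x \<in> ?V" for w j x k
      using inv[of k] admw_mono[OF _ geo[of k]] that by blast
    \<comment> \<open>Gauge bounds become operator bounds with the same ratio
      \<open>\<kappa>\<close>, at the price of powers of \<open>K\<close>.\<close>
    define C where "C = (\<Sum>j\<le>r. K * c0 * K ^ j)"
    have opb: "op_bound j (C * \<kappa> ^ k) (\<lambda>vs. Rf (Suc k) j x vs - Rf k j x vs)" if "j \<le> r" "x \<in> ?V" for j k x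
    proof -
      have "multilinear j (\<Delta> k j x)"
        using multilinear_diff[OF smooth_family_multilinear[OF sm V(1) that]
                smooth_family_multilinear[OF sm V(1) that]] by (simp add: \<Delta>_def[abs_def])
      moreover have "admw w0 (c0 * \<kappa> ^ k) j (\<Delta> k j x)" using inv[of k] that by blast
      ultimately have "op_bound j (K * (c0 * \<kappa> ^ k) * K ^ j) (\<Delta> k j x)" by (rule admw_imp_op_bound)
      moreover have "K * (c0 * \<kappa> ^ k) * K ^ j = (K * c0 * K ^ j) * \<kappa> ^ k" by (simp add: mult_ac)
      moreover have "(K * c0 * K ^ j) * \<kappa> ^ k \<le> C * \<kappa> ^ k"
        unfolding C_def using that(1) K c0 \<kappa> by (intro mult_right_mono member_le_sum) auto
      ultimately show ?thesis by (auto simp: \<Delta>_def[abs_def] intro: op_bound_mono)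
    qed
    obtain R where R: "smooth_family r ?V R"
      and lim: "\<And>j x vs. j \<le> r \<Longrightarrow> x \<in> ?V \<Longrightarrow> length vs = j \<Longrightarrow> (\<lambda>k. Rf k j x vs) \<longlonglongrightarrow> R j x vs"
      using smooth_family_limit[where D = Rf, OF V(1,2) sm opb] \<kappa> by (metis less_imp_le)
    have at0: "Rf k j 0 vs = id_family j 0 vs" if "j < s" "length vs = j" for j vs k
    proof (induction k)
      case (Suc k)
      have "\<Delta> k j 0 vs = 0" using inv[of k] that by blast
      then show ?case using Suc by (simp add: \<Delta>_def)
    qed (simp add: Rf0)
    have R0: "R j 0 vs = id_family j 0 vs" if "j < s" "length vs = j" for j vs
    proof (rule LIMSEQ_unique)
      show "(\<lambda>k. Rf k j 0 vs) \<longlonglongrightarrow> R j 0 vs" by (rule lim) (use that s V(4) in auto)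
      show "(\<lambda>k. Rf k j 0 vs) \<longlonglongrightarrow> id_family j 0 vs" by (simp add: at0[OF that])
    qed
    have Rad: "admw w 2 j (R j x)" if "j \<le> r" "x \<in> ?V" for w j x
      unfolding admw_def using bnd_limit[OF _ lim[OF that]] ad2[OF that] by (auto simp: admw_def)
    \<comment> \<open>The recursion passes to the limit in order 0, and applying \<open>A\<close> to
      it gives the equation.\<close>
    have eq: "R 0 (F 0 x []) [] = A (R 0 x []) + N 0 (R 0 x []) []" if x: "x \<in> ?V" for x
    proof -
      have "R 0 x [] \<in> ?W" by (rule inW[where T = "R 0 x"], rule Rad[OF le0 x])
      then have "((\<lambda>y. N 0 y []) \<longlongrightarrow> N 0 (R 0 x []) []) (nhds (R 0 x []))"
        by (rule smooth_family_tendsto[OF Nr W(1)])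
      from filterlim_compose[OF this lim[of 0 x "[]"]] 
      have "(\<lambda>k. N 0 (Rf k 0 x []) []) \<longlonglongrightarrow> N 0 (R 0 x []) []" using x by simp
      then have "(\<lambda>k. B (Rf k 0 (F 0 x []) [] - N 0 (Rf k 0 x []) [])) \<longlonglongrightarrow> B (R 0 (F 0 x []) [] - N 0 (R 0 x []) [])"
        using lim[of 0 "F 0 x []" "[]"] FV[OF x] by (intro bounded_linear.tendsto[OF B] tendsto_diff) auto
      moreover have "(\<lambda>k. Rf (Suc k) 0 x []) \<longlonglongrightarrow> R 0 x []"
        using lim[of 0 x "[]"] x by (intro LIMSEQ_Suc) simp
      ultimately have "R 0 x [] = B (R 0 (F 0 x []) [] - N 0 (R 0 x []) [])"
        by (simp add: RfS comp_family_def LIMSEQ_unique)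
      then have "A (R 0 x []) = R 0 (F 0 x []) [] - N 0 (R 0 x []) []" using AB by metis
      then show ?thesis by simp
    qed
    show "\<exists>R. smooth_family r (gball 1) R \<and> R 0 0 [] = 0 \<and> (\<forall>h. R 1 0 [h] = h) \<and>
        (\<forall>w j. \<forall>x\<in>gball 1. j \<le> r \<longrightarrow> admw w 2 j (R j x)) \<and>
        (\<forall>x\<in>gball 1. R 0 (F 0 x []) [] = A (R 0 x []) + N 0 (R 0 x []) [])"
      using R R0[of 0 "[]"] R0[of 1 "[_]"] s Rad eq by (intro exI[of _ R]) (auto simp: id_family_def)
  qed
qed

end

subsection \<open>Powers of an operator in finite dimension\<close>

text \<open>Induction on the independent set. Coordinates along \<open>S\<close> being controlled, a
  limit of combinations of \<open>S\<close> stays in its span; hence \<open>b\<close> has positive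
  distance from that span, which bounds the coordinate along \<open>b\<close>.\<close>

lemma independent_coords_bound:
  fixes S :: "'v::real_normed_vector set"
  assumes "finite S" "independent S"
  shows "\<exists>c>0. \<forall>u. (\<Sum>b\<in>S. \<bar>u b\<bar>) \<le> c * norm (\<Sum>b\<in>S. u b *\<^sub>R b)"
  using assms
proof (induction S rule: finite_induct)
  case empty
  then show ?case by (intro exI[of _ 1]) simp
next
  case (insert b S)
  have ind: "independent S" "b \<notin> span S"
    using insert.prems insert.hyps(2) by (auto simp: independent_insert)
  obtain c where c: "c > 0" "\<And>u. (\<Sum>b\<in>S. \<bar>u b\<bar>) \<le> c * norm (\<Sum>b\<in>S. u b *\<^sub>R b)"
    using insert.IH[OF ind(1)] by blast
  have "\<exists>d>0. \<forall>u. d \<le> norm (b - (\<Sum>s\<in>S. u s *\<^sub>R s))"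
  proof (rule ccontr)
    assume neg: "\<not> ?thesis"
    have "\<exists>u. norm (b - (\<Sum>s\<in>S. u s *\<^sub>R s)) < 1 / real (Suc n)" for n
      using neg by (meson not_le of_nat_0_less_iff zero_less_Suc zero_less_divide_1_iff)
    then obtain u where u: "\<And>n. norm (b - (\<Sum>s\<in>S. u n s *\<^sub>R s)) < 1 / real (Suc n)" by metis
    define y where "y n = (\<Sum>s\<in>S. u n s *\<^sub>R s)" for n
    have "(\<lambda>n. norm (b - y n)) \<longlonglongrightarrow> 0"
      by (rule tendsto_sandwich[OF _ _ tendsto_const LIMSEQ_inverse_real_of_nat])
         (use u in \<open>auto simp: y_def inverse_eq_divide intro!: always_eventually less_imp_le\<close>)
    then have "(\<lambda>n. b - y n) \<longlonglongrightarrow> 0" by (simp only: tendsto_norm_zero_iff)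
    from tendsto_diff[OF tendsto_const[of b] this] have y: "y \<longlonglongrightarrow> b" by simp
    have "\<exists>l. (\<lambda>n. u n s) \<longlonglongrightarrow> l" if s: "s \<in> S" for s
    proof -
      have le: "\<bar>u m s - u n s\<bar> \<le> c * norm (y m - y n)" for m n
      proof -
        have "\<bar>u m s - u n s\<bar> \<le> (\<Sum>s\<in>S. \<bar>u m s - u n s\<bar>)"
          using s insert.hyps(1) by (intro member_le_sum) auto
        also have "\<dots> \<le> c * norm (\<Sum>s\<in>S. (u m s - u n s) *\<^sub>R s)" by (rule c(2))
        also have "(\<Sum>s\<in>S. (u m s - u n s) *\<^sub>R s) = y m - y n"
          by (simp add: y_def scaleR_diff_left sum_subtractf)
        finally show ?thesis .
      qed
      have "Cauchy (\<lambda>n. u n s)"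
      proof (rule CauchyI)
        fix e :: real assume "e > 0"
        then have "e / c > 0" using c by simp
        then obtain M where M: "\<And>m n. m \<ge> M \<Longrightarrow> n \<ge> M \<Longrightarrow> norm (y m - y n) < e / c"
          using CauchyD[OF LIMSEQ_imp_Cauchy[OF y]] by meson
        have "norm (u m s - u n s) < e" if "m \<ge> M" "n \<ge> M" for m n
          using le[of m n] M[OF that] c(1) by (simp add: pos_less_divide_eq mult.commute)
        then show "\<exists>M. \<forall>m\<ge>M. \<forall>n\<ge>M. norm (u m s - u n s) < e" by blast
      qed
      then show ?thesis by (simp add: Cauchy_convergent_iff convergent_def)
    qed
    then obtain l where l: "\<And>s. s \<in> S \<Longrightarrow> (\<lambda>n. u n s) \<longlonglongrightarrow> l s" by metis
    have "y \<longlonglongrightarrow> (\<Sum>s\<in>S. l s *\<^sub>R s)" unfolding y_def by (intro tendsto_intros l)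
    then have "b = (\<Sum>s\<in>S. l s *\<^sub>R s)" using y LIMSEQ_unique by blast
    moreover have "(\<Sum>s\<in>S. l s *\<^sub>R s) \<in> span S" by (intro span_sum span_scale span_base)
    ultimately have "b \<in> span S" by simp
    then show False using ind by blast
  qed
  then obtain d where d: "d > 0" "\<And>u. d \<le> norm (b - (\<Sum>s\<in>S. u s *\<^sub>R s))" by blast
  \<comment> \<open>\<open>1 / d\<close> bounds the coordinate along \<open>b\<close>, and the
    remaining part of a vector has norm at most \<open>1 + norm b / d\<close> times that of the
    whole.\<close>
  define C where "C = 1 / d + c * (1 + norm b / d)"
  have C: "C > 0" using c d by (simp add: C_def add_pos_nonneg)
  have "(\<Sum>s\<in>insert b S. \<bar>u s\<bar>) \<le> C * norm (\<Sum>s\<in>insert b S. u s *\<^sub>R s)" for u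
  proof -
    define y where "y = (\<Sum>s\<in>S. u s *\<^sub>R s)"
    define x where "x = u b *\<^sub>R b + y"
    have ub: "\<bar>u b\<bar> * d \<le> norm x"
    proof (cases "u b = 0")
      case False
      have "(\<Sum>s\<in>S. (- u s / u b) *\<^sub>R s) = - ((1 / u b) *\<^sub>R y)"
        by (simp add: y_def scaleR_sum_right flip: sum_negf)
      then have "d \<le> norm (b + (1 / u b) *\<^sub>R y)" using d(2)[of "\<lambda>s. - u s / u b"] by simp
      then have "\<bar>u b\<bar> * d \<le> norm (u b *\<^sub>R (b + (1 / u b) *\<^sub>R y))" by (simp add: mult_left_mono)
      also have "u b *\<^sub>R (b + (1 / u b) *\<^sub>R y) = x" using False by (simp add: x_def scaleR_add_right)
      finally show ?thesis .
    qed simp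
    then have ub': "\<bar>u b\<bar> \<le> norm x / d" using d by (simp add: field_simps)
    have "norm y \<le> norm x + \<bar>u b\<bar> * norm b"
      using norm_triangle_ineq4[of x "u b *\<^sub>R b"] by (simp add: x_def)
    also have "\<dots> \<le> norm x + norm x / d * norm b" using ub' by (intro add_left_mono mult_right_mono) auto
    finally have "c * norm y \<le> c * (norm x + norm x / d * norm b)" using c by (intro mult_left_mono) auto
    moreover have "(\<Sum>s\<in>S. \<bar>u s\<bar>) \<le> c * norm y" unfolding y_def by (rule c(2))
    ultimately have "\<bar>u b\<bar> + (\<Sum>s\<in>S. \<bar>u s\<bar>) \<le> C * norm x"
      using ub' by (simp add: C_def algebra_simps)
    then show ?thesis using insert.hyps by (simp add: x_def y_def)
  qed
  with C show ?case by blast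
qed

definition finite_basis :: "'v::real_vector set \<Rightarrow> bool" where
  "finite_basis S \<longleftrightarrow> finite S \<and> independent S \<and> span S = UNIV"

lemma sum_representation:
  fixes S :: "'v::real_vector set"
  shows "finite_basis S \<Longrightarrow> (\<Sum>b\<in>S. representation S x b *\<^sub>R b) = x"
  unfolding finite_basis_def by (intro real_vector.sum_representation_eq) auto

lemma finite_basis_coords_bound:
  fixes S :: "'v::real_normed_vector set"
  assumes "finite_basis S"
  shows "\<exists>c>0. \<forall>x. (\<Sum>b\<in>S. \<bar>representation S x b\<bar>) \<le> c * norm x"
  using independent_coords_bound[of S] assms sum_representation[OF assms] unfolding finite_basis_def by metis

lemma bounded_linear_representation:
  fixes S :: "'v::real_normed_vector set"
  assumes S: "finite_basis S" and b: "b \<in> S"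
  shows "bounded_linear (\<lambda>x. representation S x b)"
proof -
  obtain c where c: "c > 0" "\<And>x. (\<Sum>b\<in>S. \<bar>representation S x b\<bar>) \<le> c * norm x"
    using finite_basis_coords_bound[OF S] by blast
  have ind: "independent S" "x \<in> span S" for x using S by (auto simp: finite_basis_def)
  show ?thesis
  proof (rule bounded_linear_intro[where K = c])
    show "norm (representation S x b) \<le> norm x * c" for x
      using c(2)[of x] member_le_sum[of b S "\<lambda>b. \<bar>representation S x b\<bar>"] b S
      by (simp add: finite_basis_def mult.commute)
  qed (simp_all add: real_vector.representation_add[OF ind(1) ind(2) ind(2)] real_vector.representation_scale[OF ind(1) ind(2)])
qed

lemma bounded_linear_finite_dim:
  fixes T :: "'v::real_normed_vector \<Rightarrow> 'w::real_normed_vector" and S :: "'v set"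
  assumes S: "finite_basis S" and T: "linear T"
  shows "bounded_linear T"
proof -
  have eq: "T x = (\<Sum>b\<in>S. representation S x b *\<^sub>R T b)" for x
    by (subst sum_representation[OF S, of x, symmetric]) (simp add: linear_sum[OF T] linear_scale[OF T])
  have "bounded_linear (\<lambda>x. \<Sum>b\<in>S. representation S x b *\<^sub>R T b)"
    by (intro bounded_linear_sum bounded_linear_scaleR_left[THEN bounded_linear_compose]
        bounded_linear_representation[OF S])
  then show ?thesis by (simp only: eq[symmetric])
qed

lemma linear_inj_imp_surj_finite_dim:
  fixes T :: "'v::real_vector \<Rightarrow> 'v" and S :: "'v set"
  assumes S: "finite_basis S" and T: "linear T" "inj T"
  shows "surj T"
proof -
  interpret fd: finite_dimensional_vector_space "scaleR :: real \<Rightarrow> 'v \<Rightarrow> 'v" S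
    using S by unfold_locales (auto simp: finite_basis_def dependent_raw_def span_raw_def)
  show ?thesis using fd.linear_inj_imp_surj T by (simp add: linear_def)
qed

text \<open>Pairs \<open>(u, v)\<close> stand for \<open>u + \<i>v\<close> in the complexification.\<close>

definition cscale :: "complex \<Rightarrow> 'v \<times> 'v \<Rightarrow> 'v \<times> 'v::real_vector" where
  "cscale z p = (Re z *\<^sub>R fst p - Im z *\<^sub>R snd p, Im z *\<^sub>R fst p + Re z *\<^sub>R snd p)"

lemma cscale_add_right: "cscale z (p + q) = cscale z p + cscale z q"
  and cscale_add_left: "cscale (z + w) p = cscale z p + cscale w p"
  and cscale_cscale: "cscale z (cscale w p) = cscale (z * w) p"
  and cscale_one: "cscale 1 p = p"
  and cscale_zero_left: "cscale 0 p = 0"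
  and cscale_zero_right: "cscale z 0 = 0"
  and cscale_of_real: "cscale (of_real c) p = c *\<^sub>R p"
  by (auto simp: cscale_def algebra_simps prod_eq_iff)

lemma cscale_minus_left: "cscale (- z) p = - cscale z p"
  by (auto simp: cscale_def)

lemma cscale_eq_zero: "cscale z p = 0 \<Longrightarrow> z \<noteq> 0 \<Longrightarrow> p = 0"
  by (metis cscale_cscale cscale_one cscale_zero_right left_inverse)

lemma cscale_map: "linear T \<Longrightarrow> map_prod T T (cscale z p) = cscale z (map_prod T T p)"
  by (cases p) (auto simp: cscale_def linear_diff linear_add linear_scale)

lemma map_prod_add: "linear T \<Longrightarrow> map_prod T T (p + q) = map_prod T T p + map_prod T T q"
  by (cases p; cases q) (auto simp: linear_add)

lemma map_prod_zero: "linear T \<Longrightarrow> map_prod T T 0 = 0"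
  by (simp add: zero_prod_def linear_0)

lemma mem_complex_spectrum:
  "z \<in> complex_spectrum a \<longleftrightarrow> (\<exists>p. p \<noteq> 0 \<and> map_prod a a p = cscale z p)"
  by (force simp: complex_spectrum_def cscale_def zero_prod_def map_prod_def split: prod.splits)

text \<open>The value of p(T) by Horner's scheme, on the complexification so that complex
  coefficients make sense.\<close>

definition poly_act :: "('v \<Rightarrow> 'v) \<Rightarrow> complex poly \<Rightarrow> 'v \<times> 'v \<Rightarrow> 'v \<times> 'v::real_vector" where
  "poly_act T p x = fold_coeffs (\<lambda>c y. cscale c x + map_prod T T y) p 0"

lemma poly_act_0 [simp]: "poly_act T 0 x = 0"
  by (simp add: poly_act_def)

context
  fixes T :: "'v \<Rightarrow> 'v::real_vector"
  assumes T: "linear T"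
begin

lemma poly_act_pCons: "poly_act T (pCons c p) x = cscale c x + map_prod T T (poly_act T p x)"
  by (cases "c = 0 \<and> p = 0")
     (auto simp: poly_act_def cscale_zero_left map_prod_zero[OF T])

lemma poly_act_add: "poly_act T (p + q) x = poly_act T p x + poly_act T q x"
  by (induction p q rule: poly_induct2)
     (simp_all add: poly_act_pCons cscale_add_left map_prod_add[OF T] algebra_simps)

lemma poly_act_smult: "poly_act T (smult c p) x = cscale c (poly_act T p x)"
  by (induction p)
     (simp_all add: poly_act_pCons cscale_zero_right cscale_add_right cscale_cscale cscale_map[OF T])

lemma poly_act_add_right: "poly_act T p (x + y) = poly_act T p x + poly_act T p y"
  by (induction p) (simp_all add: poly_act_pCons cscale_add_right map_prod_add[OF T] algebra_simps)

lemma poly_act_cscale: "poly_act T p (cscale c x) = cscale c (poly_act T p x)"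
  by (induction p)
     (simp_all add: poly_act_pCons cscale_zero_right cscale_add_right cscale_cscale cscale_map[OF T] mult.commute)

lemma poly_act_map: "poly_act T p (map_prod T T x) = map_prod T T (poly_act T p x)"
  by (induction p) (simp_all add: poly_act_pCons map_prod_zero[OF T] map_prod_add[OF T] cscale_map[OF T])

text \<open>The form in which a root is split off: the cofactor acts first, then \<open>T\<close>
  minus the root.\<close>

lemma poly_act_linear_factor:
  "poly_act T ([:- \<mu>, 1:] * q) x = map_prod T T (poly_act T q x) - cscale \<mu> (poly_act T q x)"
proof -
  have "[:- \<mu>, 1:] * q = smult (- \<mu>) q + pCons 0 q" by simp
  then show ?thesis
    by (simp only: poly_act_add poly_act_smult poly_act_pCons cscale_zero_left cscale_minus_left) simp
qed

lemma poly_act_monom: "poly_act T (monom c i) x = cscale c ((map_prod T T ^^ i) x)"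
  by (induction i) (simp_all add: monom_0 monom_Suc poly_act_pCons cscale_zero_left map_prod_zero[OF T]
      cscale_map[OF T])

lemma poly_act_sum: "poly_act T (\<Sum>i\<in>I. f i) x = (\<Sum>i\<in>I. poly_act T (f i) x)"
  by (induction I rule: infinite_finite_induct) (simp_all add: poly_act_add)

end

lemma funpow_map_prod:
  fixes T :: "'a \<Rightarrow> 'a"
  shows "(map_prod T T ^^ k) (u, v) = ((T ^^ k) u, (T ^^ k) v)"
  by (induction k) auto

lemma linear_funpow:
  fixes T :: "'a::real_vector \<Rightarrow> 'a"
  shows "linear T \<Longrightarrow> linear (T ^^ k)"
proof (induction k)
  case 0
  show ?case by (simp add: linear_iff)
next
  case (Suc k)
  then show ?case using linear_compose[of "T ^^ k" T] by (simp add: o_def)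
qed

text \<open>In dimension n the n + 1 iterates of \<open>x\<close> are dependent. A repetition among
  them would be lost in the set of iterates and is treated apart as a relation of its own.\<close>

lemma annihilating_polynomial:
  fixes T :: "'v::real_vector \<Rightarrow> 'v" and S :: "'v set"
  assumes S: "finite_basis S" and T: "linear T"
  shows "\<exists>p. p \<noteq> 0 \<and> poly_act T p (x, 0) = 0"
proof -
  define n where "n = card S"
  define f where "f i = (T ^^ i) x" for i
  have key: "\<exists>p. p \<noteq> 0 \<and> poly_act T p (x, 0) = 0"
    if "(\<Sum>i\<le>n. c i *\<^sub>R f i) = 0" "i \<le> n" "c i \<noteq> 0" for c :: "nat \<Rightarrow> real" and i
  proof (intro exI conjI)
    let ?p = "\<Sum>i\<le>n. monom (complex_of_real (c i)) i"
    have "poly_act T ?p (x, 0) = (\<Sum>i\<le>n. c i *\<^sub>R (f i, 0))"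
      by (simp add: poly_act_sum[OF T] poly_act_monom[OF T] funpow_map_prod f_def cscale_of_real
          linear_0[OF linear_funpow[OF T]])
    also have "\<dots> = 0" using that(1) by (simp add: prod_eq_iff fst_sum snd_sum)
    finally show "poly_act T ?p (x, 0) = 0" .
    have "coeff ?p i = (\<Sum>j\<le>n. if j = i then complex_of_real (c j) else 0)"
      by (simp add: coeff_sum)
    then have "coeff ?p i \<noteq> 0" using that(2,3) by simp
    then show "?p \<noteq> 0" by auto
  qed
  show ?thesis
  proof (cases "inj_on f {..n}")
    case True
    have "\<not> independent (f ` {..n})"
    proof
      assume "independent (f ` {..n})"
      then have "card (f ` {..n}) \<le> card S"
        using real_vector.independent_span_bound[of S "f ` {..n}"] S by (auto simp: finite_basis_def)
      then show False using card_image[OF True] by (simp add: n_def)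
    qed
    then obtain u v where u: "v \<in> f ` {..n}" "u v \<noteq> 0" "(\<Sum>v\<in>f ` {..n}. u v *\<^sub>R v) = 0"
      using real_vector.dependent_finite[of "f ` {..n}"] by auto
    then obtain i where "i \<le> n" "u (f i) \<noteq> 0" by auto
    moreover have "(\<Sum>i\<le>n. u (f i) *\<^sub>R f i) = 0" using u(3) by (simp add: sum.reindex[OF True])
    ultimately show ?thesis using key[of "\<lambda>i. u (f i)" i] by blast
  next
    case False
    then obtain i j where ij: "i \<le> n" "j \<le> n" "i \<noteq> j" "f i = f j" by (auto simp: inj_on_def)
    have "(\<Sum>k\<le>n. ((if k = i then 1 else 0) - (if k = j then 1 else 0)) *\<^sub>R f k) = f i - f j"
      using ij by (simp add: scaleR_diff_left sum_subtractf if_distrib[of "\<lambda>c. c *\<^sub>R _"] cong: if_cong)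
    then show ?thesis using key[of "\<lambda>k. (if k = i then 1 else 0) - (if k = j then 1 else 0)" i] ij by simp
  qed
qed

text \<open>The product norm is not homogeneous for complex scalars. Bounding all multiples by
  scalars of modulus at most 1 gives a complex norm, for which \<open>cscale w\<close> costs the
  factor \<open>cmod w\<close>.\<close>

definition cbound :: "real \<Rightarrow> 'v \<times> 'v::real_normed_vector \<Rightarrow> bool" where
  "cbound c p \<longleftrightarrow> (\<forall>z. cmod z \<le> 1 \<longrightarrow> norm (cscale z p) \<le> c)"

lemma cbound_add: "cbound c p \<Longrightarrow> cbound d q \<Longrightarrow> cbound (c + d) (p + q)"
  unfolding cbound_def by (auto simp: cscale_add_right intro: norm_triangle_mono)

lemma cbound_mono: "cbound c p \<Longrightarrow> c \<le> d \<Longrightarrow> cbound d p"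
  unfolding cbound_def by force

lemma cbound_cscale:
  assumes "cbound c p"
  shows "cbound (cmod w * c) (cscale w p)"
  unfolding cbound_def
proof (intro allI impI)
  fix z assume z: "cmod z \<le> 1"
  define u where "u = (if w = 0 then 0 else z * w / of_real (cmod w))"
  have "z * w = of_real (cmod w) * u" by (simp add: u_def)
  then have "cscale z (cscale w p) = cmod w *\<^sub>R cscale u p"
    by (simp add: cscale_cscale cscale_of_real flip: cscale_of_real[of "cmod w" "cscale u p"])
  moreover have "cmod u \<le> 1" using z by (simp add: u_def norm_divide norm_mult)
  ultimately show "norm (cscale z (cscale w p)) \<le> cmod w * c"
    using assms by (simp add: cbound_def mult_left_mono)
qed

lemma cbound_exists: "\<exists>c. cbound c p"
proof -
  have "norm (cscale z p) \<le> 2 * (norm (fst p) + norm (snd p))" if "cmod z \<le> 1" for z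
  proof -
    have z: "\<bar>Re z\<bar> \<le> 1" "\<bar>Im z\<bar> \<le> 1" using abs_Re_le_cmod[of z] abs_Im_le_cmod[of z] that by auto
    have s: "norm (Re z *\<^sub>R q) \<le> norm q" "norm (Im z *\<^sub>R q) \<le> norm q" for q :: 'a
      using z by (simp_all add: mult_left_le_one_le)
    have "norm (cscale z p) \<le> norm (Re z *\<^sub>R fst p - Im z *\<^sub>R snd p) + norm (Im z *\<^sub>R fst p + Re z *\<^sub>R snd p)"
      unfolding cscale_def by (rule norm_Pair_le)
    also have "\<dots> \<le> (norm (Re z *\<^sub>R fst p) + norm (Im z *\<^sub>R snd p)) + (norm (Im z *\<^sub>R fst p) + norm (Re z *\<^sub>R snd p))"
      by (intro add_mono norm_triangle_ineq norm_triangle_ineq4)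
    also have "\<dots> \<le> 2 * (norm (fst p) + norm (snd p))"
      using add_mono[OF add_mono[OF s(1)[of "fst p"] s(2)[of "snd p"]] add_mono[OF s(2)[of "fst p"] s(1)[of "snd p"]]]
      by (simp only: mult_2)
    finally show ?thesis .
  qed
  then show ?thesis unfolding cbound_def by blast
qed

text \<open>Induction on the degree of an annihilating polynomial. A root is split off; if the
  cofactor \<open>q\<close> does not annihilate \<open>x\<close>, it turns \<open>x\<close> into an
  eigenvector, so \<open>cmod \<mu> < \<rho>\<close>, and \<open>y\<close>, which is
  \<open>T\<close> minus \<open>\<mu>\<close> at \<open>x\<close>, is annihilated by
  \<open>q\<close>. The orbit of \<open>x\<close> then obeys a recursion driven by that of
  \<open>y\<close>.\<close>

lemma orbit_bound:
  fixes T :: "'v::real_normed_vector \<Rightarrow> 'v"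
  assumes T: "linear T" and \<rho>: "0 < \<rho>"
    and ev: "\<And>z p. p \<noteq> 0 \<Longrightarrow> map_prod T T p = cscale z p \<Longrightarrow> cmod z < \<rho>"
    and p: "p \<noteq> 0" "poly_act T p x = 0"
  shows "\<exists>C. \<forall>k. cbound (C * \<rho> ^ k) ((map_prod T T ^^ k) x)"
  using p
proof (induction "degree p" arbitrary: p x rule: less_induct)
  case less
  let ?T = "map_prod T T"
  show ?case
  proof (cases "degree p = 0")
    case True
    then obtain c where c: "p = [:c:]" by (rule degree_eq_zeroE)
    then have "cscale c x = 0" "c \<noteq> 0" using less.prems by (simp_all add: poly_act_pCons[OF T] map_prod_zero[OF T])
    then have "x = 0" by (rule cscale_eq_zero)
    moreover have "(?T ^^ k) 0 = 0" for k by (induction k) (auto simp: map_prod_zero[OF T])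
    ultimately show ?thesis by (intro exI[of _ 0]) (simp add: cbound_def cscale_zero_right)
  next
    case False
    then have "\<not> constant (poly p)" by (simp add: constant_degree)
    then obtain \<mu> where "poly p \<mu> = 0" using fundamental_theorem_of_algebra by blast
    then obtain q where q: "p = [:- \<mu>, 1:] * q" by (auto simp: poly_eq_0_iff_dvd elim: dvdE)
    with less.prems(1) have q0: "q \<noteq> 0" by auto
    have deg: "degree q < degree p" using q0 by (simp add: q degree_mult_eq del: mult_pCons_left)
    show ?thesis
    proof (cases "poly_act T q x = 0")
      case True
      then show ?thesis by (rule less.hyps[OF deg q0])
    next
      case False
      have "?T (poly_act T q x) = cscale \<mu> (poly_act T q x)"
        using less.prems(2) by (simp add: q poly_act_linear_factor[OF T] del: mult_pCons_left)
      then have \<mu>: "cmod \<mu> < \<rho>" by (rule ev[OF False])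
      define y where "y = ?T x + cscale (- \<mu>) x"
      have "poly_act T q y = 0"
      proof -
        have "poly_act T q y = ?T (poly_act T q x) + cscale (- \<mu>) (poly_act T q x)"
          by (simp only: y_def poly_act_add_right[OF T] poly_act_map[OF T] poly_act_cscale[OF T])
        then show ?thesis
          using less.prems(2) by (simp add: q poly_act_linear_factor[OF T] cscale_minus_left del: mult_pCons_left)
      qed
      from less.hyps[OF deg q0 this] obtain C where C: "\<And>k. cbound (C * \<rho> ^ k) ((?T ^^ k) y)" by blast
      obtain C0 where C0: "cbound C0 x" using cbound_exists by blast
      \<comment> \<open>Large enough for the start of the orbit and for
        \<open>C + cmod \<mu> * C' \<le> \<rho> * C'\<close>, which closes the recursion.\<close>
      define C' where "C' = max C0 (C / (\<rho> - cmod \<mu>))"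
      have C': "C \<le> C' * (\<rho> - cmod \<mu>)" using \<mu> by (simp add: C'_def max_def field_simps)
      have Tx: "?T x = y + cscale \<mu> x" by (simp add: y_def cscale_minus_left)
      have pow_add: "(?T ^^ k) (a + b) = (?T ^^ k) a + (?T ^^ k) b" for k a b
        by (induction k) (auto simp: map_prod_add[OF T])
      have pow_cs: "(?T ^^ k) (cscale \<mu> a) = cscale \<mu> ((?T ^^ k) a)" for k a
        by (induction k) (auto simp: cscale_map[OF T])
      have "cbound (C' * \<rho> ^ k) ((?T ^^ k) x)" for k
      proof (induction k)
        case 0
        show ?case using cbound_mono[OF C0, of C'] by (simp add: C'_def)
      next
        case (Suc k)
        have "(?T ^^ Suc k) x = (?T ^^ k) y + cscale \<mu> ((?T ^^ k) x)"
          by (simp only: funpow_Suc_right o_apply Tx pow_add pow_cs)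
        moreover have "C * \<rho> ^ k + cmod \<mu> * (C' * \<rho> ^ k) \<le> C' * \<rho> ^ Suc k"
          using mult_right_mono[OF C', of "\<rho> ^ k"] \<rho> by (simp add: algebra_simps)
        ultimately show ?case using cbound_mono[OF cbound_add[OF C[of k] cbound_cscale[OF Suc]]] by simp
      qed
      then show ?thesis by blast
    qed
  qed
qed

text \<open>Growth is known orbit by orbit; a finite basis makes it uniform, since coordinates are
  bounded by the norm.\<close>

lemma power_growth:
  fixes T :: "'v::real_normed_vector \<Rightarrow> 'v" and S :: "'v set"
  assumes S: "finite_basis S" and T: "linear T" and \<rho>: "0 < \<rho>"
    and ev: "\<And>z p. p \<noteq> 0 \<Longrightarrow> map_prod T T p = cscale z p \<Longrightarrow> cmod z < \<rho>"
  shows "\<exists>C>0. \<forall>k x. norm ((T ^^ k) x) \<le> C * \<rho> ^ k * norm x"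
proof -
  have "\<exists>C. \<forall>k. norm ((T ^^ k) b) \<le> C * \<rho> ^ k" for b
  proof -
    obtain p where p: "p \<noteq> 0" "poly_act T p (b, 0) = 0" using annihilating_polynomial[OF S T] by blast
    have "\<exists>C. \<forall>k. cbound (C * \<rho> ^ k) ((map_prod T T ^^ k) (b, 0))"
      by (rule orbit_bound[OF T \<rho> _ p]) (rule ev)
    then obtain C where C: "\<And>k. cbound (C * \<rho> ^ k) ((map_prod T T ^^ k) (b, 0))" by blast
    have "norm ((T ^^ k) b) \<le> C * \<rho> ^ k" for k
      using C[of k] norm_fst_le[of "(T ^^ k) b" "(T ^^ k) 0"]
      by (auto simp: funpow_map_prod cbound_def cscale_one dest!: spec[of _ 1])
    then show ?thesis by blast
  qed
  then obtain C where C: "\<And>b k. norm ((T ^^ k) b) \<le> C b * \<rho> ^ k" by metis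
  have C0: "C b \<ge> 0" for b using order_trans[OF norm_ge_zero C[of 0 b]] by simp
  obtain c where c: "c > 0" "\<And>x. (\<Sum>b\<in>S. \<bar>representation S x b\<bar>) \<le> c * norm x"
    using finite_basis_coords_bound[OF S] by blast
  define M where "M = (\<Sum>b\<in>S. C b) + 1"
  have M: "M > 0" unfolding M_def using C0 by (simp add: add_nonneg_pos sum_nonneg)
  have CM: "C b \<le> M" if "b \<in> S" for b
    using member_le_sum[of b S C] that C0 S by (simp add: M_def finite_basis_def)
  have "norm ((T ^^ k) x) \<le> M * c * \<rho> ^ k * norm x" for k x
  proof -
    have lin: "linear (T ^^ k)" by (rule linear_funpow[OF T])
    have "(T ^^ k) x = (\<Sum>b\<in>S. representation S x b *\<^sub>R (T ^^ k) b)"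
      by (subst sum_representation[OF S, of x, symmetric]) (simp add: linear_sum[OF lin] linear_scale[OF lin])
    also have "norm \<dots> \<le> (\<Sum>b\<in>S. \<bar>representation S x b\<bar> * (M * \<rho> ^ k))"
    proof (rule sum_norm_le)
      fix b assume "b \<in> S"
      then have "norm ((T ^^ k) b) \<le> M * \<rho> ^ k"
        using C[of k b] CM[of b] \<rho> by (meson mult_right_mono order_trans zero_le_power less_imp_le)
      then show "norm (representation S x b *\<^sub>R (T ^^ k) b) \<le> \<bar>representation S x b\<bar> * (M * \<rho> ^ k)"
        by (simp add: mult_left_mono)
    qed
    also have "\<dots> = (\<Sum>b\<in>S. \<bar>representation S x b\<bar>) * (M * \<rho> ^ k)" by (simp add: sum_distrib_right)
    also have "\<dots> \<le> c * norm x * (M * \<rho> ^ k)" using c(2) M \<rho> by (intro mult_right_mono) auto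
    finally show ?thesis by (simp add: mult_ac)
  qed
  then show ?thesis using M c(1) by (intro exI[of _ "M * c"]) auto
qed

text \<open>0 is no eigenvalue, so \<open>a\<close> is invertible, and the eigenvalues of the
  inverse are reciprocals of those of \<open>a\<close>. The rates lie strictly beyond the spectral
  bounds so as to absorb the polynomial growth caused by Jordan blocks.\<close>

lemma spectral_bounds:
  fixes a :: "'v::real_normed_vector \<Rightarrow>\<^sub>L 'v" and S :: "'v set"
  assumes S: "finite_basis S" and \<alpha>: "0 < \<alpha>" "\<alpha> \<le> \<beta>"
    and ev: "\<And>z. z \<in> complex_spectrum a \<Longrightarrow> \<alpha> \<le> cmod z \<and> cmod z \<le> \<beta>"
  obtains ai where "bounded_linear ai" "\<And>x. a (ai x) = x" "\<And>x. ai (a x) = x"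
    and "\<And>\<rho>. \<rho> > \<beta> \<Longrightarrow> \<exists>C>0. \<forall>k x. norm ((blinfun_apply a ^^ k) x) \<le> C * \<rho> ^ k * norm x"
    and "\<And>\<rho>. \<rho> > 1 / \<alpha> \<Longrightarrow> \<exists>C>0. \<forall>k x. norm ((ai ^^ k) x) \<le> C * \<rho> ^ k * norm x"
proof -
  have lin: "linear (blinfun_apply a)" by (rule bounded_linear.linear[OF blinfun.bounded_linear_right])
  have "x = 0" if "a x = 0" for x
  proof (rule ccontr)
    assume "x \<noteq> 0"
    then have "0 \<in> complex_spectrum a" unfolding mem_complex_spectrum
      using that by (intro exI[of _ "(x, 0)"]) (simp add: cscale_zero_left zero_prod_def)
    then show False using ev[of 0] \<alpha> by simp
  qed
  then have inj: "inj (blinfun_apply a)" using linear_injective_0[OF lin] by blast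
  then have surj: "surj (blinfun_apply a)" by (rule linear_inj_imp_surj_finite_dim[OF S lin])
  define ai where "ai = inv (blinfun_apply a)"
  have a1: "a (ai x) = x" and a2: "ai (a x) = x" for x
    using surj inj by (simp_all add: ai_def surj_f_inv_f inv_f_f)
  have ailin: "linear ai"
  proof (rule linearI)
    show "ai (x + y) = ai x + ai y" for x y
      by (metis a1 a2 linear_add[OF lin])
    show "ai (c *\<^sub>R x) = c *\<^sub>R ai x" for c x
      by (metis a1 a2 linear_scale[OF lin])
  qed
  have ev_ai: "cmod z \<le> 1 / \<alpha>" if p: "p \<noteq> 0" "map_prod ai ai p = cscale z p" for z p
  proof -
    have "p = map_prod a a (map_prod ai ai p)" by (cases p) (simp add: a1)
    then have *: "p = cscale z (map_prod a a p)" using p(2) by (simp add: cscale_map[OF lin])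
    then have z: "z \<noteq> 0" using p(1) by (auto simp: cscale_zero_left)
    have "map_prod a a p = cscale (1 / z) p" using z
      by (subst (2) *) (simp add: cscale_cscale cscale_one)
    then have "1 / z \<in> complex_spectrum a" using p(1) unfolding mem_complex_spectrum by blast
    then have "\<alpha> \<le> 1 / cmod z" using ev[of "1 / z"] by (simp add: norm_divide)
    then show ?thesis using \<alpha> z by (simp add: field_simps)
  qed
  show ?thesis
  proof (rule that[of ai])
    show "bounded_linear ai" by (rule bounded_linear_finite_dim[OF S ailin])
    show "\<exists>C>0. \<forall>k x. norm ((blinfun_apply a ^^ k) x) \<le> C * \<rho> ^ k * norm x" if \<rho>: "\<rho> > \<beta>" for \<rho>
    proof (rule power_growth[OF S lin])
      show "0 < \<rho>" using \<rho> \<alpha> by simp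
      fix z p assume "p \<noteq> 0" "map_prod a a p = cscale z p"
      then have "z \<in> complex_spectrum a" unfolding mem_complex_spectrum by blast
      then show "cmod z < \<rho>" using ev \<rho> by fastforce
    qed
    show "\<exists>C>0. \<forall>k x. norm ((ai ^^ k) x) \<le> C * \<rho> ^ k * norm x" if \<rho>: "\<rho> > 1 / \<alpha>" for \<rho>
    proof (rule power_growth[OF S ailin])
      show "0 < \<rho>" using \<rho> \<alpha> by (meson less_trans zero_less_divide_1_iff)
      show "cmod z < \<rho>" if "p \<noteq> 0" "map_prod ai ai p = cscale z p" for z p
        using ev_ai[OF that] \<rho> by simp
    qed
  qed (rule a1 a2)+
qed

subsection \<open>Nodewise cutoff\<close>

text \<open>Induction on smoothness: start with clamping to the interval from -1 to 1; averaging
  over a window of half-width \<open>\<rho> / 2\<close> gains a derivative. Averages keep the bound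
  1, and over a symmetric window they keep the identity on half of the old interval.\<close>

lemma smooth_cutoff_real:
  "\<exists>D \<rho>. 0 < \<rho> \<and> \<rho> \<le> 1 \<and>
     (\<forall>j<n. \<forall>t. (D j has_real_derivative D (Suc j) t) (at t)) \<and>
     (\<forall>j\<le>n. continuous_on UNIV (D j) \<and> (\<exists>M. \<forall>t. \<bar>D j t\<bar> \<le> M)) \<and>
     (\<forall>t. \<bar>D 0 t\<bar> \<le> (1::real)) \<and> (\<forall>t. \<bar>t\<bar> \<le> \<rho> \<longrightarrow> D 0 t = t)"
proof (induction n)
  case 0
  show ?case
  proof (rule exI[of _ "\<lambda>_ t. max (- 1) (min 1 t)"], rule exI[of _ 1], intro conjI allI impI)
    show "continuous_on UNIV (\<lambda>t::real. max (- 1) (min 1 t))" by (intro continuous_intros)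
    show "\<exists>M. \<forall>t::real. \<bar>max (- 1) (min 1 t)\<bar> \<le> M" by (intro exI[of _ 1]) (auto simp: max_def min_def)
  qed (auto simp: max_def min_def)
next
  case (Suc n)
  then obtain D \<rho> where \<rho>: "0 < \<rho>" "\<rho> \<le> 1"
    and der: "\<And>j t. j < n \<Longrightarrow> (D j has_real_derivative D (Suc j) t) (at t)"
    and cont: "\<And>j. j \<le> n \<Longrightarrow> continuous_on UNIV (D j)"
    and bd: "\<And>j. j \<le> n \<Longrightarrow> \<exists>M. \<forall>t. \<bar>D j t\<bar> \<le> M"
    and one: "\<And>t. \<bar>D 0 t\<bar> \<le> (1::real)" and ident: "\<And>t. \<bar>t\<bar> \<le> \<rho> \<Longrightarrow> D 0 t = t" by metis
  have "isCont (D 0) x" for x using cont[of 0] by (simp add: continuous_on_eq_continuous_at)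
  then obtain G where G': "\<And>x. (G has_vector_derivative D 0 x) (at x)"
    using einterval_antiderivative[of "-\<infinity>" "\<infinity>" "D 0"] by auto
  then have G: "(G has_real_derivative D 0 x) (at x)" for x
    by (simp add: has_real_derivative_iff_has_vector_derivative)
  define w where "w = \<rho> / 2"
  have w: "w > 0" using \<rho> by (simp add: w_def)
  \<comment> \<open>\<open>E 0\<close> is the window average of \<open>D 0\<close>, written with its
    antiderivative \<open>G\<close>; the higher orders are difference quotients of the old
    ones.\<close>
  define E where "E j = (case j of 0 \<Rightarrow> \<lambda>t. (G (t + w) - G (t - w)) / (2 * w)
    | Suc j \<Rightarrow> \<lambda>t. (D j (t + w) - D j (t - w)) / (2 * w))" for j
  have E0: "E 0 = (\<lambda>t. (G (t + w) - G (t - w)) / (2 * w))"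
    and ES: "E (Suc j) = (\<lambda>t. (D j (t + w) - D j (t - w)) / (2 * w))" for j by (simp_all add: E_def)
  have avg: "((\<lambda>t. (f (t + w) - f (t - w)) / (2 * w)) has_real_derivative (g (t + w) - g (t - w)) / (2 * w)) (at t)"
    if f: "\<And>t. (f has_real_derivative g t) (at t)" for f g t
  proof -
    have "((\<lambda>t. f (t + c)) has_real_derivative g (t + c)) (at t)" for c
      using DERIV_shift[of f "g (t + c)" t c] f by (simp add: add.commute)
    from this[of w] this[of "- w"] show ?thesis by (intro DERIV_cdivide DERIV_diff) simp_all
  qed
  have Eder: "(E j has_real_derivative E (Suc j) t) (at t)" if "j < Suc n" for j t
  proof (cases j)
    case 0
    show ?thesis unfolding 0 E0 ES by (rule avg[OF G])
  next
    case (Suc i)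
    show ?thesis unfolding Suc ES by (rule avg[OF der]) (use that Suc in simp)
  qed
  have Eval: "\<exists>z. \<bar>z - t\<bar> \<le> w \<and> E 0 t = D 0 z" for t
  proof -
    have "\<exists>z. t - w < z \<and> z < t + w \<and> G (t + w) - G (t - w) = ((t + w) - (t - w)) * D 0 z"
      using w G by (intro MVT2) auto
    then obtain z where "t - w < z" "z < t + w" "G (t + w) - G (t - w) = 2 * w * D 0 z" by auto
    then show ?thesis using w by (intro exI[of _ z]) (simp add: E0)
  qed
  have E1: "\<bar>E 0 t\<bar> \<le> 1" for t using Eval[of t] one by auto
  have Eid: "E 0 t = t" if t: "\<bar>t\<bar> \<le> w" for t
  proof -
    \<comment> \<open>Its derivative \<open>D 0 s - s\<close> vanishes on the window around
      \<open>t\<close>, so \<open>G\<close> has the same increment there as half the square.\<close>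
    define H where "H s = G s - s\<^sup>2 / 2" for s
    have H: "(H has_real_derivative D 0 s - s) (at s)" for s
      unfolding H_def by (auto intro!: derivative_eq_intros G)
    have "\<exists>z. t - w < z \<and> z < t + w \<and> H (t + w) - H (t - w) = ((t + w) - (t - w)) * (D 0 z - z)"
      using w H by (intro MVT2) auto
    then obtain z where z: "t - w < z" "z < t + w" "H (t + w) - H (t - w) = ((t + w) - (t - w)) * (D 0 z - z)"
      by blast
    have "\<bar>z\<bar> \<le> \<rho>" using z(1,2) t unfolding w_def by linarith
    then have "H (t + w) = H (t - w)" using z(3) ident by simp
    then have "G (t + w) - G (t - w) = 2 * w * t" by (simp add: H_def power2_eq_square field_simps)
    then show ?thesis using w by (simp add: E0)
  qed
  have Econt: "continuous_on UNIV (E j)" if "j \<le> Suc n" for j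
  proof (cases j)
    case 0
    show ?thesis unfolding 0
      by (rule continuous_at_imp_continuous_on) (use Eder[of 0] DERIV_isCont in blast)
  next
    case (Suc i)
    have i: "continuous_on UNIV (D i)" using cont that Suc by simp
    show ?thesis unfolding Suc ES using w
      by (intro continuous_intros continuous_on_compose2[OF i]) auto
  qed
  have Ebd: "\<exists>M. \<forall>t. \<bar>E j t\<bar> \<le> M" if j: "j \<le> Suc n" for j
  proof (cases j)
    case 0
    then show ?thesis using E1 by blast
  next
    case (Suc i)
    obtain M where M: "\<And>t. \<bar>D i t\<bar> \<le> M" using bd[of i] j Suc by auto
    have "\<bar>E j t\<bar> \<le> (M + M) / (2 * w)" for t
    proof -
      have "\<bar>D i (t + w) - D i (t - w)\<bar> \<le> M + M" using M[of "t + w"] M[of "t - w"] by linarith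
      then show ?thesis unfolding Suc ES using w by (simp add: abs_divide field_simps)
    qed
    then show ?thesis by blast
  qed
  show ?case
    by (rule exI[of _ E], rule exI[of _ w], intro conjI allI impI)
       (use w \<rho> Eder Econt Ebd E1 Eid in \<open>auto simp: w_def\<close>)
qed

lemma apply_bounded_family:
  fixes f :: "int^'m::finite \<Rightarrow> 'v::real_normed_vector"
  assumes "\<And>i. norm (f i) \<le> C"
  shows "apply_bcontfun (Bcontfun f) = f"
  using assms by (intro Bcontfun_inverse bounded_family_in_bcontfun) (auto simp: bounded_iff)

section \<open>Smoothness of nodewise superposition operators\<close>

lemma smooth_family_add:
  assumes "smooth_family r V D" "smooth_family r V E"
  shows "smooth_family r V (\<lambda>j x vs. D j x vs + E j x vs)"
  using smooth_family_diff[OF assms(1) smooth_family_linear[OF bounded_linear_minus[OF bounded_linear_ident] assms(2)]]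
  by simp

lemma smooth_family_zero: "smooth_family r V (\<lambda>_ _ _. 0)"
  by (rule smooth_familyI) (auto simp: op_bound_def intro: exI[of _ 0] exI[of _ 1])

lemma smooth_family_sum:
  "(\<And>i. i \<in> I \<Longrightarrow> smooth_family r V (D i)) \<Longrightarrow> smooth_family r V (\<lambda>j x vs. \<Sum>i\<in>I. D i j x vs)"
  by (induction I rule: infinite_finite_induct) (auto intro: smooth_family_zero smooth_family_add)

text \<open>The superposition operator of the scalar function \<open>D 0\<close>, in direction
  \<open>b\<close> and read through the functional \<open>l\<close>, together with its derivatives:
  by the chain rule each argument contributes its value under \<open>l\<close> at the same
  node.\<close>

definition nemytskii ::
  "(nat \<Rightarrow> real \<Rightarrow> real) \<Rightarrow> ('v \<Rightarrow> real) \<Rightarrow> 'v \<Rightarrow> nat \<Rightarrow> ('m::finite, 'v::real_normed_vector) ell_infty \<Rightarrow>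
    ('m, 'v) ell_infty list \<Rightarrow> ('m, 'v) ell_infty" where
  "nemytskii D l b j x vs =
     Bcontfun (\<lambda>i. (D j (l (apply_bcontfun x i)) * prod_list (map (\<lambda>v. l (apply_bcontfun v i)) vs)) *\<^sub>R b)"

context
  fixes D :: "nat \<Rightarrow> real \<Rightarrow> real" and l :: "'v::real_normed_vector \<Rightarrow> real" and b :: 'v
    and L M :: real and n :: nat
  assumes l: "linear l" "\<And>y. \<bar>l y\<bar> \<le> L * norm y" and L: "0 \<le> L"
    and M: "\<And>j t. j \<le> n \<Longrightarrow> \<bar>D j t\<bar> \<le> M"
begin

lemma nemytskii_pointwise:
  fixes x :: "('m::finite, 'v) ell_infty"
  assumes "j \<le> n"
  shows "norm ((D j (l (apply_bcontfun x i)) * prod_list (map (\<lambda>v. l (apply_bcontfun v i)) vs)) *\<^sub>R b)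
    \<le> M * prod_list (map (\<lambda>v. L * norm (apply_bcontfun v i)) vs) * norm b"
proof -
  have "\<bar>prod_list (map (\<lambda>v. l (apply_bcontfun v i)) vs)\<bar> \<le> prod_list (map (\<lambda>v. L * norm (apply_bcontfun v i)) vs)"
  proof (induction vs)
    case (Cons v vs)
    then show ?case using l(2)[of "apply_bcontfun v i"] L by (auto simp: abs_mult intro!: mult_mono)
  qed simp
  then show ?thesis using M[OF assms, of "l (apply_bcontfun x i)"]
    by (auto simp: abs_mult intro!: mult_mono)
qed

lemma prod_list_norm_le:
  fixes vs :: "('m::finite, 'v) ell_infty list"
  shows "prod_list (map (\<lambda>v. L * norm (apply_bcontfun v i)) vs) \<le> prod_list (map (\<lambda>v. L * norm v) vs)"
proof (induction vs)
  case (Cons v vs)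
  have "0 \<le> prod_list (map (\<lambda>v. L * norm (apply_bcontfun v i)) vs)"
    using L by (intro prod_list_nonneg) auto
  then show ?case using Cons L by (auto intro!: mult_mono mult_left_mono norm_bounded)
qed simp

lemma apply_nemytskii:
  fixes x :: "('m::finite, 'v) ell_infty"
  assumes "j \<le> n"
  shows "apply_bcontfun (nemytskii D l b j x vs) i =
    (D j (l (apply_bcontfun x i)) * prod_list (map (\<lambda>v. l (apply_bcontfun v i)) vs)) *\<^sub>R b"
proof -
  have M0: "0 \<le> M" using M[OF assms, of 0] by simp
  have "norm ((D j (l (apply_bcontfun x i)) * prod_list (map (\<lambda>v. l (apply_bcontfun v i)) vs)) *\<^sub>R b)
      \<le> M * prod_list (map (\<lambda>v. L * norm v) vs) * norm b" for i
    using M0 by (intro order_trans[OF nemytskii_pointwise[OF assms]] mult_right_mono mult_left_mono prod_list_norm_le) auto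
  then show ?thesis unfolding nemytskii_def by (subst apply_bounded_family) auto
qed

lemma norm_nemytskii_le:
  fixes x :: "('m::finite, 'v) ell_infty"
  assumes "j \<le> n"
  shows "norm (apply_bcontfun (nemytskii D l b j x vs) i) \<le>
    M * prod_list (map (\<lambda>v. L * norm (apply_bcontfun v i)) vs) * norm b"
  unfolding apply_nemytskii[OF assms] by (rule nemytskii_pointwise[OF assms])

text \<open>In the supremum norm the remainder must be small uniformly over all nodes. The bound on
  order j + 2 of \<open>D\<close> makes it quadratic, whence two orders beyond
  \<open>r\<close>.\<close>

lemma smooth_family_nemytskii:
  assumes der: "\<And>j t. j < n \<Longrightarrow> (D j has_real_derivative D (Suc j) t) (at t)" and n: "n = Suc (Suc r)"
  shows "smooth_family r UNIV (nemytskii D l b :: _ \<Rightarrow> ('m::finite, 'v) ell_infty \<Rightarrow> _)"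
proof (rule smooth_familyI_bounded)
  have M0: "0 \<le> M" using M[OF le0, of 0] by simp
  fix j assume "j \<le> Suc r"
  then have j: "j \<le> n" using n by simp
  have "op_bound j (M * L ^ j * norm b) (nemytskii D l b j x)" for x :: "('m, 'v) ell_infty"
    unfolding op_bound_def
  proof
    fix vs :: "('m, 'v) ell_infty list" assume vs: "vs \<in> unit_lists j"
    show "norm (nemytskii D l b j x vs) \<le> M * L ^ j * norm b"
    proof (rule norm_bound)
      fix i
      have "prod_list (map (\<lambda>v. L * norm (apply_bcontfun v i)) vs) \<le> L ^ length (map (\<lambda>v. L * norm (apply_bcontfun v i)) vs)"
      proof (rule prod_list_le_power)
        fix y assume "y \<in> set (map (\<lambda>v. L * norm (apply_bcontfun v i)) vs)"
        then obtain v where "v \<in> set vs" "y = L * norm (apply_bcontfun v i)" by auto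
        moreover have "norm (apply_bcontfun v i) \<le> 1" if "v \<in> set vs" for v
          using norm_bounded[of v i] vs that by (auto simp: unit_lists_def)
        ultimately show "0 \<le> y \<and> y \<le> L" using L by (simp add: mult_left_le)
      qed
      then have "prod_list (map (\<lambda>v. L * norm (apply_bcontfun v i)) vs) \<le> L ^ j" using vs by (simp add: unit_lists_def)
      then have "M * prod_list (map (\<lambda>v. L * norm (apply_bcontfun v i)) vs) * norm b \<le> M * L ^ j * norm b"
        using M0 by (intro mult_left_mono mult_right_mono) auto
      then show "norm (apply_bcontfun (nemytskii D l b j x vs) i) \<le> M * L ^ j * norm b"
        using norm_nemytskii_le[OF j, of x vs i] by linarith
    qed
  qed
  then show "\<exists>C. \<forall>x\<in>UNIV. op_bound j C (nemytskii D l b j x :: ('m, 'v) ell_infty list \<Rightarrow> _)" by blast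
next
  have M0: "0 \<le> M" using M[OF le0, of 0] by simp
  fix j and x :: "('m, 'v) ell_infty" and vs :: "('m, 'v) ell_infty list"
  assume jr: "j \<le> r"
  then have j: "j \<le> n" "Suc j \<le> n" "j < n" "Suc j < n" using n by auto
  define P where "P = prod_list (map (\<lambda>v. L * norm v) vs)"
  have P0: "P \<ge> 0" unfolding P_def using L by (intro prod_list_nonneg) auto
  have P: "\<bar>prod_list (map (\<lambda>v. l (apply_bcontfun v i)) vs)\<bar> \<le> P" for i
  proof -
    have "\<bar>prod_list (map (\<lambda>v. l (apply_bcontfun v i)) vs)\<bar> \<le> prod_list (map (\<lambda>v. L * norm (apply_bcontfun v i)) vs)"
    proof (induction vs)
      case (Cons v vs)
      then show ?case using l(2)[of "apply_bcontfun v i"] L by (auto simp: abs_mult intro!: mult_mono)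
    qed simp
    then show ?thesis using prod_list_norm_le[of i vs] by (simp add: P_def)
  qed
  have taylor: "\<bar>D j (t + u) - D j t - D (Suc j) t * u\<bar> \<le> M * u\<^sup>2" for t u
  proof -
    have D1: "\<bar>D (Suc j) z - D (Suc j) t\<bar> \<le> M * \<bar>z - t\<bar>" for z
    proof -
      have "norm (D (Suc j) z - D (Suc j) t - 0) \<le> M * \<bar>z - t\<bar>"
      proof (rule mean_value_bound[where V = UNIV and f = "D (Suc j)" and x = t and y = z])
        show "(D (Suc j) has_derivative (*) (D (Suc (Suc j)) y)) (at y)" for y
          using der[OF j(4)] by (simp add: has_field_derivative_def)
        show "norm (D (Suc (Suc j)) y * (z - t) - 0) \<le> M * \<bar>z - t\<bar>" for y
          using M[of "Suc (Suc j)" y] j(4) by (simp add: abs_mult mult_right_mono)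
      qed auto
      then show ?thesis by simp
    qed
    let ?S = "cball t \<bar>u\<bar>"
    have "norm (D j (t + u) - D j t - D (Suc j) t * u) \<le> M * u\<^sup>2"
    proof (rule mean_value_bound[where V = ?S and f = "D j" and x = t and y = "t + u"])
      show "(D j has_derivative (*) (D (Suc j) y)) (at y)" for y
        using der[OF j(3)] by (simp add: has_field_derivative_def)
      fix y assume y: "y \<in> ?S"
      have "\<bar>(D (Suc j) y - D (Suc j) t) * u\<bar> \<le> M * \<bar>u\<bar> * \<bar>u\<bar>"
        unfolding abs_mult using D1[of y] y M0
        by (intro mult_right_mono) (auto simp: dist_real_def abs_minus_commute intro: order_trans mult_left_mono)
      then show "norm (D (Suc j) y * (t + u - t) - D (Suc j) t * u) \<le> M * u\<^sup>2"
        by (simp add: algebra_simps power2_eq_square)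
    qed (auto simp: dist_real_def)
    then show ?thesis by simp
  qed
  let ?f' = "\<lambda>h. nemytskii D l b (Suc j) x (h # vs)"
  note app = apply_nemytskii[OF j(1)] apply_nemytskii[OF j(2)]
  show "((\<lambda>y. nemytskii D l b j y vs) has_derivative ?f') (at x)"
    unfolding has_derivative_at_alt
  proof (intro conjI allI impI)
    show "bounded_linear ?f'"
    proof (rule bounded_linear_intro[where K = "M * L * P * norm b"])
      show "?f' (h + k) = ?f' h + ?f' k" for h k
        by (rule bcontfun_eqI) (simp add: app linear_add[OF l(1)] algebra_simps)
      show "?f' (c *\<^sub>R h) = c *\<^sub>R ?f' h" for c h
        by (rule bcontfun_eqI) (simp add: app linear_scale[OF l(1)] algebra_simps)
      show "norm (?f' h) \<le> norm h * (M * L * P * norm b)" for h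
      proof (rule norm_bound)
        fix i
        have "prod_list (map (\<lambda>v. L * norm (apply_bcontfun v i)) (h # vs)) \<le> (L * norm h) * P"
          unfolding P_def using prod_list_norm_le[of i "h # vs"] by simp
        then have "M * prod_list (map (\<lambda>v. L * norm (apply_bcontfun v i)) (h # vs)) * norm b
            \<le> M * ((L * norm h) * P) * norm b"
          using M0 by (intro mult_left_mono mult_right_mono) auto
        then show "norm (apply_bcontfun (?f' h) i) \<le> norm h * (M * L * P * norm b)"
          using norm_nemytskii_le[OF j(2), of x "h # vs" i] by (simp add: mult_ac)
      qed
    qed
    fix e :: real assume e: "e > 0"
    define C where "C = M * L\<^sup>2 * P * norm b"
    have C0: "C \<ge> 0" using M0 P0 by (simp add: C_def)
    have "norm (nemytskii D l b j y vs - nemytskii D l b j x vs - ?f' (y - x)) \<le> C * (norm (y - x))\<^sup>2" for y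
    proof (rule norm_bound)
      fix i
      define t where "t = l (apply_bcontfun x i)"
      define u where "u = l (apply_bcontfun y i - apply_bcontfun x i)"
      define q where "q = prod_list (map (\<lambda>v. l (apply_bcontfun v i)) vs)"
      have ly: "l (apply_bcontfun y i) = t + u" by (simp add: t_def u_def linear_diff[OF l(1)])
      have "apply_bcontfun (nemytskii D l b j y vs - nemytskii D l b j x vs - ?f' (y - x)) i =
          ((D j (t + u) - D j t - D (Suc j) t * u) * q) *\<^sub>R b"
        by (simp add: app ly t_def[symmetric] q_def[symmetric] u_def[symmetric])
           (simp add: algebra_simps)
      then have "norm (apply_bcontfun (nemytskii D l b j y vs - nemytskii D l b j x vs - ?f' (y - x)) i) =
          \<bar>D j (t + u) - D j t - D (Suc j) t * u\<bar> * \<bar>q\<bar> * norm b" by (simp add: abs_mult)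
      also have "\<dots> \<le> (M * u\<^sup>2) * P * norm b"
        using taylor[of t u] P[of i] P0 M0 unfolding q_def by (intro mult_right_mono mult_mono) auto
      also have "\<dots> \<le> (M * (L * norm (y - x))\<^sup>2) * P * norm b"
      proof -
        have "\<bar>u\<bar> \<le> L * norm (y - x)" unfolding u_def
          using l(2)[of "apply_bcontfun (y - x) i"] mult_left_mono[OF norm_bounded[of "y - x" i] L] by simp
        then have "u\<^sup>2 \<le> (L * norm (y - x))\<^sup>2" by (metis abs_ge_zero power2_abs power_mono)
        then show ?thesis using M0 P0 by (intro mult_right_mono mult_left_mono) auto
      qed
      finally show "norm (apply_bcontfun (nemytskii D l b j y vs - nemytskii D l b j x vs - ?f' (y - x)) i)
          \<le> C * (norm (y - x))\<^sup>2" by (simp add: C_def power_mult_distrib mult_ac)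
    qed
    moreover have "C * (norm (y - x))\<^sup>2 \<le> e * norm (y - x)" if "norm (y - x) < e / (C + 1)" for y
    proof -
      have "C * norm (y - x) \<le> (C + 1) * norm (y - x)" by (simp add: algebra_simps)
      also have "\<dots> \<le> e" using that C0 by (simp add: field_simps)
      finally show ?thesis by (simp add: power2_eq_square mult_right_mono flip: mult.assoc)
    qed
    ultimately show "\<exists>d>0. \<forall>y. norm (y - x) < d \<longrightarrow>
        norm (nemytskii D l b j y vs - nemytskii D l b j x vs - ?f' (y - x)) \<le> e * norm (y - x)"
      using e C0 by (intro exI[of _ "e / (C + 1)"]) (auto intro: order_trans)
  qed
qed auto

end

subsection \<open>Decay and adapted gauges\<close>

lemma apply_bcontfun_sum:
  fixes f :: "'i \<Rightarrow> ('a::topological_space \<Rightarrow>\<^sub>C 'b::real_normed_vector)"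
  shows "apply_bcontfun (\<Sum>i\<in>I. f i) x = (\<Sum>i\<in>I. apply_bcontfun (f i) x)"
  by (induction I rule: infinite_finite_induct) simp_all

lemma prod_list_scale: "prod_list (map (\<lambda>v. L * f v) vs) = (L::real) ^ length vs * prod_list (map f vs)"
  by (induction vs) simp_all

text \<open>The scalar cutoff acts on each coordinate at each node. The last property is locality:
  at a node a derivative is bounded through its arguments at that node, which is what preserves
  decay.\<close>

lemma node_cutoff:
  fixes S :: "'v::real_normed_vector set"
  assumes S: "finite_basis S" and s: "s > 0"
  shows "\<exists>(\<Psi> :: nat \<Rightarrow> ('m::finite, 'v) ell_infty \<Rightarrow> ('m, 'v) ell_infty list \<Rightarrow> ('m, 'v) ell_infty) C \<rho>.
    smooth_family r UNIV \<Psi> \<and> 0 < \<rho> \<and> 0 \<le> C \<and>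
    (\<forall>x i. norm (apply_bcontfun (\<Psi> 0 x []) i) \<le> s) \<and>
    (\<forall>x. norm x \<le> \<rho> \<longrightarrow> \<Psi> 0 x [] = x) \<and>
    (\<forall>j x vs i. j \<le> r \<longrightarrow> length vs = j \<longrightarrow>
      norm (apply_bcontfun (\<Psi> j x vs) i) \<le> C * prod_list (map (\<lambda>v. norm (apply_bcontfun v i)) vs))"
proof -
  define n where "n = Suc (Suc r)"
  obtain D \<rho>0 where \<rho>0: "0 < \<rho>0"
    and der: "\<And>j t. j < n \<Longrightarrow> (D j has_real_derivative D (Suc j) t) (at t)"
    and bd: "\<And>j. j \<le> n \<Longrightarrow> \<exists>M. \<forall>t. \<bar>D j t\<bar> \<le> M"
    and one: "\<And>t. \<bar>D 0 t\<bar> \<le> (1::real)" and ident: "\<And>t. \<bar>t\<bar> \<le> \<rho>0 \<Longrightarrow> D 0 t = t"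
    using smooth_cutoff_real[of n] by metis
  obtain m where m: "\<And>j t. j \<le> n \<Longrightarrow> \<bar>D j t\<bar> \<le> m j" using bd by metis
  define M where "M = Max (m ` {..n})"
  have M: "\<bar>D j t\<bar> \<le> M" if "j \<le> n" for j t
  proof -
    have "m j \<le> M" unfolding M_def using that by (intro Max_ge) auto
    then show ?thesis using m[OF that, of t] by linarith
  qed
  have M0: "0 \<le> M" using M[OF le0, of 0] by simp
  obtain c where c: "c > 0" "\<And>x. (\<Sum>b\<in>S. \<bar>representation S x b\<bar>) \<le> c * norm x"
    using finite_basis_coords_bound[OF S] by blast
  have fin: "finite S" using S by (simp add: finite_basis_def)
  have rep: "\<bar>representation S x b\<bar> \<le> c * norm x" if "b \<in> S" for x b
    using order_trans[OF member_le_sum[of b S "\<lambda>b. \<bar>representation S x b\<bar>"] c(2)] that fin by simp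
  \<comment> \<open>Shares the bound \<open>s\<close> among the basis vectors, each scaled
    coordinate being cut off at 1.\<close>
  define s1 where "s1 = s / ((\<Sum>b\<in>S. norm b) + 1)"
  have sb: "(\<Sum>b\<in>S. norm b) \<ge> 0" by (simp add: sum_nonneg)
  have s1: "s1 > 0" using s sb by (simp add: s1_def)
  define l where "l b y = representation S y b / s1" for b y
  define L where "L = c / s1"
  have L: "0 \<le> L" using c s1 by (simp add: L_def)
  have llin: "linear (l b)" if "b \<in> S" for b
    using bounded_linear.linear[OF bounded_linear_representation[OF S that]]
    by (auto simp: l_def linear_iff add_divide_distrib)
  have lb: "\<bar>l b y\<bar> \<le> L * norm y" if "b \<in> S" for b y
    using rep[OF that, of y] s1 by (simp add: l_def L_def divide_right_mono)
  define \<Psi> where "\<Psi> j x vs = (\<Sum>b\<in>S. nemytskii D (l b) (s1 *\<^sub>R b) j x vs)"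
    for j and x :: "('m, 'v) ell_infty" and vs
  define C where "C = (\<Sum>b\<in>S. M * max 1 L ^ r * norm (s1 *\<^sub>R b))"
  \<comment> \<open>Below the radius \<open>\<rho>0 * s1 / c\<close> every scaled coordinate lies
    where the scalar cutoff is the identity.\<close>
  show ?thesis
  proof (rule exI[of _ \<Psi>], rule exI[of _ C], rule exI[of _ "\<rho>0 * s1 / c"], intro conjI allI impI)
    have "smooth_family r UNIV (nemytskii D (l b) (s1 *\<^sub>R b) :: _ \<Rightarrow> ('m, 'v) ell_infty \<Rightarrow> _)"
      if b: "b \<in> S" for b
      by (rule smooth_family_nemytskii[where D = D, OF llin[OF b] lb[OF b] L M der n_def])
    then show "smooth_family r UNIV \<Psi>" unfolding \<Psi>_def by (rule smooth_family_sum)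
    show "0 < \<rho>0 * s1 / c" using \<rho>0 s1 c by simp
    show "0 \<le> C" unfolding C_def using M0 by (intro sum_nonneg) auto
    have app: "apply_bcontfun (nemytskii D (l b) (s1 *\<^sub>R b) 0 x []) i = D 0 (l b (apply_bcontfun x i)) *\<^sub>R s1 *\<^sub>R b"
      if "b \<in> S" for b and x :: "('m, 'v) ell_infty" and i
      by (subst apply_nemytskii[where D = D, OF llin[OF that] lb[OF that] L M le0]) simp_all
    show "norm (apply_bcontfun (\<Psi> 0 x []) i) \<le> s" for x i
    proof -
      have "norm (apply_bcontfun (\<Psi> 0 x []) i) \<le> (\<Sum>b\<in>S. s1 * norm b)"
        unfolding \<Psi>_def apply_bcontfun_sum
      proof (rule sum_norm_le)
        fix b assume "b \<in> S"
        then show "norm (apply_bcontfun (nemytskii D (l b) (s1 *\<^sub>R b) 0 x []) i) \<le> s1 * norm b"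
          using mult_right_mono[OF one[of "l b (apply_bcontfun x i)"], of "s1 * norm b"] s1
          by (simp add: app abs_mult mult.assoc)
      qed
      also have "\<dots> = s * ((\<Sum>b\<in>S. norm b) / ((\<Sum>b\<in>S. norm b) + 1))" by (simp only: s1_def sum_distrib_left[symmetric]) simp
      also have "\<dots> \<le> s" using s sb by (intro mult_right_le_one_le) auto
      finally show ?thesis .
    qed
    show "\<Psi> 0 x [] = x" if x: "norm x \<le> \<rho>0 * s1 / c" for x
    proof (rule bcontfun_eqI)
      fix i
      have "D 0 (l b (apply_bcontfun x i)) = l b (apply_bcontfun x i)" if b: "b \<in> S" for b
      proof (rule ident)
        have "L * norm (apply_bcontfun x i) \<le> L * (\<rho>0 * s1 / c)"
          using L norm_bounded[of x i] x by (intro mult_left_mono) auto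
        then show "\<bar>l b (apply_bcontfun x i)\<bar> \<le> \<rho>0"
          using lb[OF b, of "apply_bcontfun x i"] c s1 by (simp add: L_def)
      qed
      then have "apply_bcontfun (\<Psi> 0 x []) i = (\<Sum>b\<in>S. l b (apply_bcontfun x i) *\<^sub>R s1 *\<^sub>R b)"
        by (simp add: \<Psi>_def apply_bcontfun_sum app)
      also have "\<dots> = (\<Sum>b\<in>S. representation S (apply_bcontfun x i) b *\<^sub>R b)"
        using s1 by (intro sum.cong) (auto simp: l_def)
      also have "\<dots> = apply_bcontfun x i" by (rule sum_representation[OF S])
      finally show "apply_bcontfun (\<Psi> 0 x []) i = apply_bcontfun x i" .
    qed
    show "norm (apply_bcontfun (\<Psi> j x vs) i) \<le> C * prod_list (map (\<lambda>v. norm (apply_bcontfun v i)) vs)"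
      if j: "j \<le> r" "length vs = j" for j x vs i
    proof -
      let ?p = "prod_list (map (\<lambda>v. norm (apply_bcontfun v i)) vs)"
      have p0: "0 \<le> ?p" by (intro prod_list_nonneg) auto
      have jn: "j \<le> n" using j by (simp add: n_def)
      have "L ^ j \<le> max 1 L ^ j" using L by (intro power_mono) auto
      also have "\<dots> \<le> max 1 L ^ r" using j by (intro power_increasing) auto
      finally have Lj: "L ^ j \<le> max 1 L ^ r" .
      have "norm (apply_bcontfun (\<Psi> j x vs) i) \<le> (\<Sum>b\<in>S. M * max 1 L ^ r * norm (s1 *\<^sub>R b) * ?p)"
        unfolding \<Psi>_def apply_bcontfun_sum
      proof (rule sum_norm_le)
        fix b assume b: "b \<in> S"
        have "norm (apply_bcontfun (nemytskii D (l b) (s1 *\<^sub>R b) j x vs) i) \<le> M * (L ^ j * ?p) * norm (s1 *\<^sub>R b)"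
          using norm_nemytskii_le[where D = D, OF llin[OF b] lb[OF b] L M jn, of "s1 *\<^sub>R b" x vs i] j
          by (simp only: prod_list_scale)
        also have "\<dots> \<le> M * (max 1 L ^ r * ?p) * norm (s1 *\<^sub>R b)"
          using M0 p0 Lj by (intro mult_right_mono mult_left_mono) auto
        finally show "norm (apply_bcontfun (nemytskii D (l b) (s1 *\<^sub>R b) j x vs) i) \<le> M * max 1 L ^ r * norm (s1 *\<^sub>R b) * ?p"
          by (simp add: mult_ac)
      qed
      then show ?thesis by (simp add: C_def sum_distrib_right)
    qed
  qed
qed

text \<open>The jets of the map \<open>x\<close> to \<open>F (\<delta> x) / \<delta>\<close>. Order
  j carries the power j - 1 of \<open>\<delta>\<close>, written as a quotient so that order 0 comes
  out right.\<close>

lemma smooth_family_rescale: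
  fixes D :: "nat \<Rightarrow> 'a::real_normed_vector \<Rightarrow> 'a list \<Rightarrow> 'b::real_normed_vector"
  assumes D: "smooth_family r U D" and \<delta>: "\<delta> > 0" and V: "\<And>x. x \<in> V \<Longrightarrow> \<delta> *\<^sub>R x \<in> U" and U: "open U"
  shows "smooth_family r V (\<lambda>j x vs. (\<delta> ^ j / \<delta>) *\<^sub>R D j (\<delta> *\<^sub>R x) vs)"
proof (rule smooth_familyI)
  have scale: "op_bound j (\<delta> ^ j / \<delta> * C) (\<lambda>vs. (\<delta> ^ j / \<delta>) *\<^sub>R A vs)" if "op_bound j C A"
    for j C and A :: "'a list \<Rightarrow> 'b"
    using that \<delta> by (auto simp: op_bound_def intro!: mult_left_mono divide_right_mono)
  fix j assume j: "j \<le> r"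
  obtain C where C: "\<And>x. x \<in> U \<Longrightarrow> op_bound j C (D j x)" using smooth_family_bound[OF D j] by blast
  show "\<exists>C. \<forall>x\<in>V. op_bound j C (\<lambda>vs. (\<delta> ^ j / \<delta>) *\<^sub>R D j (\<delta> *\<^sub>R x) vs)"
    using scale[OF C] V by blast
  fix x and e :: real assume x: "x \<in> V" and e: "e > 0"
  define e' where "e' = e / (\<delta> ^ j / \<delta>)"
  have e': "e' > 0" "\<delta> ^ j / \<delta> * e' = e" using e \<delta> by (simp_all add: e'_def)
  obtain d where d: "d > 0" "\<forall>y\<in>U. norm (y - \<delta> *\<^sub>R x) < d \<longrightarrow> op_bound j e' (\<lambda>vs. D j y vs - D j (\<delta> *\<^sub>R x) vs)"
    using smooth_family_cont[OF D j V[OF x] e'(1)] by blast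
  have "op_bound j e (\<lambda>vs. (\<delta> ^ j / \<delta>) *\<^sub>R D j (\<delta> *\<^sub>R y) vs - (\<delta> ^ j / \<delta>) *\<^sub>R D j (\<delta> *\<^sub>R x) vs)"
    if y: "y \<in> V" "norm (y - x) < d / \<delta>" for y
  proof -
    have "norm (\<delta> *\<^sub>R y - \<delta> *\<^sub>R x) = \<delta> * norm (y - x)" using \<delta> by (simp flip: scaleR_diff_right)
    then have "norm (\<delta> *\<^sub>R y - \<delta> *\<^sub>R x) < d" using y \<delta> by (simp add: field_simps)
    then have "op_bound j e' (\<lambda>vs. D j (\<delta> *\<^sub>R y) vs - D j (\<delta> *\<^sub>R x) vs)" using d V y by blast
    from scale[OF this] show ?thesis by (simp only: e'(2) scaleR_diff_right)
  qed
  then show "\<exists>d>0. \<forall>y\<in>V. norm (y - x) < d \<longrightarrow>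
      op_bound j e (\<lambda>vs. (\<delta> ^ j / \<delta>) *\<^sub>R D j (\<delta> *\<^sub>R y) vs - (\<delta> ^ j / \<delta>) *\<^sub>R D j (\<delta> *\<^sub>R x) vs)"
    using d(1) \<delta> by (intro exI[of _ "d / \<delta>"]) simp
next
  fix j x and vs :: "'a list" assume j: "j < r" and x: "x \<in> V" and len: "length vs = j"
  have ml: "multilinear (Suc j) (D (Suc j) (\<delta> *\<^sub>R x))"
    using smooth_family_multilinear[OF D U _ V[OF x]] j by simp
  have "((\<lambda>x. \<delta> *\<^sub>R x) has_derivative (\<lambda>h. \<delta> *\<^sub>R h)) (at x)"
    by (intro has_derivative_scaleR_right has_derivative_ident)
  from has_derivative_compose[OF this smooth_family_deriv[OF D j V[OF x] len]]
  have "((\<lambda>y. (\<delta> ^ j / \<delta>) *\<^sub>R D j (\<delta> *\<^sub>R y) vs) has_derivative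
      (\<lambda>h. (\<delta> ^ j / \<delta>) *\<^sub>R D (Suc j) (\<delta> *\<^sub>R x) (\<delta> *\<^sub>R h # vs))) (at x)"
    by (intro has_derivative_scaleR_right)
  moreover have "D (Suc j) (\<delta> *\<^sub>R x) (\<delta> *\<^sub>R h # vs) = \<delta> *\<^sub>R D (Suc j) (\<delta> *\<^sub>R x) (h # vs)" for h
    by (rule linear_scale[OF multilinear_Cons_head[OF ml len]])
  ultimately show "((\<lambda>y. (\<delta> ^ j / \<delta>) *\<^sub>R D j (\<delta> *\<^sub>R y) vs) has_derivative
      (\<lambda>h. (\<delta> ^ Suc j / \<delta>) *\<^sub>R D (Suc j) (\<delta> *\<^sub>R x) (h # vs))) (at x)"
    by (simp add: mult.commute)
qed

section \<open>Sums against a decay function\<close>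

lemma decay_functionD:
  assumes "decay_function \<Gamma>"
  shows "\<Gamma> k > 0" "\<Gamma> summable_on UNIV" "(\<Sum>\<^sub>\<infinity>k. \<Gamma> k) \<le> 1"
    "(\<Sum>\<^sub>\<infinity>k. \<Gamma> (i - k) * \<Gamma> (k - j)) \<le> \<Gamma> (i - j)"
  using assms by (auto simp: decay_function_def)

lemma decay_function_finite_sum_le:
  assumes "decay_function \<Gamma>" "finite T"
  shows "sum \<Gamma> T \<le> 1"
  using finite_sum_le_infsum[OF decay_functionD(2)[OF assms(1)] assms(2)] decay_functionD(1,3)[OF assms(1)]
  by (meson less_imp_le order_trans subset_UNIV)

lemma decay_function_le_1: "decay_function \<Gamma> \<Longrightarrow> \<Gamma> k \<le> 1"
  using decay_function_finite_sum_le[of \<Gamma> "{k}"] by simp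

text \<open>Total mass at most 1 leaves at most 1 / e sites where \<open>\<Gamma>\<close> is at
  least \<open>e\<close>.\<close>

lemma decay_function_finite_level:
  assumes \<Gamma>: "decay_function \<Gamma>" and e: "e > 0"
  shows "finite {k. e \<le> \<Gamma> (k - l)}"
proof -
  have "finite {k. e \<le> \<Gamma> k}"
  proof (rule conjunct1[OF finite_if_finite_subsets_card_bdd])
    fix T assume T: "T \<subseteq> {k. e \<le> \<Gamma> k}" "finite T"
    have "real (card T) * e \<le> sum \<Gamma> T" using sum_mono[of T "\<lambda>_. e" \<Gamma>] T by auto
    also have "\<dots> \<le> 1" by (rule decay_function_finite_sum_le[OF \<Gamma> T(2)])
    finally have "real (card T) \<le> 1 / e" using e by (simp add: field_simps)
    then show "card T \<le> nat \<lfloor>1 / e\<rfloor>" by (simp add: le_nat_floor)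
  qed
  moreover have "{k. e \<le> \<Gamma> (k - l)} = (\<lambda>k. k + l) ` {k. e \<le> \<Gamma> k}"
    by (auto simp: image_iff intro!: exI[of _ "_ - l"])
  ultimately show ?thesis by simp
qed

text \<open>Comparing a finite sum with the infinite one requires summability, which
  \<open>\<Gamma> \<le> 1\<close> provides.\<close>

lemma decay_function_convolution:
  assumes \<Gamma>: "decay_function \<Gamma>" and T: "finite T"
  shows "(\<Sum>k\<in>T. \<Gamma> (i - k) * \<Gamma> (k - l)) \<le> \<Gamma> (i - l)"
proof -
  have "bij_betw (\<lambda>k. k - l) UNIV UNIV" by (rule bij_betw_byWitness[where f' = "\<lambda>k. k + l"]) auto
  then have "(\<lambda>k. \<Gamma> (k - l)) summable_on UNIV"
    using summable_on_reindex_bij_betw[of "\<lambda>k. k - l" UNIV UNIV \<Gamma>] decay_functionD(2)[OF \<Gamma>] by simp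
  then have "(\<lambda>k. \<Gamma> (i - k) * \<Gamma> (k - l)) summable_on UNIV"
    by (rule summable_on_comparison_test)
       (use decay_functionD(1)[OF \<Gamma>] decay_function_le_1[OF \<Gamma>] in
         \<open>simp_all add: less_imp_le mult_left_le_one_le\<close>)
  from finite_sum_le_infsum[OF this T] show ?thesis
    using decay_functionD(1,4)[OF \<Gamma>] by (meson less_imp_le mult_pos_pos order_trans subset_UNIV)
qed

lemma proj_add: "proj i (x + y) = proj i x + proj i y"
  and proj_diff: "proj i (x - y) = proj i x - proj i y"
  and proj_scale: "proj i (c *\<^sub>R x) = c *\<^sub>R proj i x"
  and proj_zero: "proj i 0 = 0"
  by (simp_all add: proj_def)

lemma norm_proj_le: "norm (proj i x) \<le> norm x"
  by (simp add: proj_def norm_bounded)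

lemma norm_emb_le: "norm (emb k y) \<le> norm y"
  by (rule norm_bound) (simp add: proj_emb flip: proj_def)

lemma supported_at_emb: "supported_at (emb k y) k"
  by (simp add: supported_at_def proj_emb)

lemma proj_sum: "proj i (\<Sum>k\<in>T. f k) = (\<Sum>k\<in>T. proj i (f k))"
  by (simp add: proj_def apply_bcontfun_sum)

text \<open>A sequence decaying like \<open>\<Gamma>\<close> away from \<open>l\<close> is the norm limit of its finite truncations,
  because \<open>\<Gamma>\<close> vanishes at infinity; hence the decay of \<open>f\<close> on single sites determines \<open>f\<close> on it.\<close>

lemma decay_convolution_bound:
  fixes f :: "('m::finite, 'v::real_normed_vector) ell_infty \<Rightarrow> 'v"
  assumes \<Gamma>: "decay_function \<Gamma>" and f: "linear f" and C: "0 \<le> C"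
    and nf: "\<And>w. norm (f w) \<le> C * norm w"
    and site: "\<And>k w. supported_at w k \<Longrightarrow> norm w \<le> 1 \<Longrightarrow> norm (f w) \<le> C * \<Gamma> (i - k)"
    and v: "\<And>k. norm (proj k v) \<le> \<Gamma> (k - l)"
  shows "norm (f v) \<le> C * \<Gamma> (i - l)"
proof (rule field_le_epsilon)
  fix e :: real assume e: "e > 0"
  define e' where "e' = e / (C + 1)"
  have e': "e' > 0" using e C by (simp add: e'_def)
  \<comment> \<open>Outside \<open>T\<close> the entries of \<open>v\<close> are below
    \<open>e'\<close>, so truncating \<open>v\<close> to \<open>T\<close> changes its image under
    \<open>f\<close> by at most \<open>C * e'\<close>.\<close>
  define T where "T = {k. e' \<le> \<Gamma> (k - l)}"
  have T: "finite T" unfolding T_def by (rule decay_function_finite_level[OF \<Gamma> e'])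
  define u where "u = (\<Sum>k\<in>T. emb k (proj k v))"
  have "norm (f (emb k (proj k v))) \<le> C * (\<Gamma> (i - k) * \<Gamma> (k - l))" for k
  proof (cases "proj k v = 0")
    case True
    have "emb k (0::'v) = 0" by (rule bcontfun_eqI) (simp add: proj_emb flip: proj_def add: proj_zero)
    then show ?thesis using True linear_0[OF f] C decay_functionD(1)[OF \<Gamma>] by (simp add: less_imp_le)
  next
    case False
    define y where "y = (1 / norm (proj k v)) *\<^sub>R proj k v"
    have y1: "norm y = 1" using False by (simp add: y_def)
    have "emb k (proj k v) = norm (proj k v) *\<^sub>R emb k y"
      by (rule bcontfun_eqI) (use False in \<open>simp add: proj_emb y_def flip: proj_def add: proj_scale\<close>)
    then have "norm (f (emb k (proj k v))) = norm (proj k v) * norm (f (emb k y))"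
      by (simp add: linear_scale[OF f])
    also have "\<dots> \<le> \<Gamma> (k - l) * (C * \<Gamma> (i - k))"
    proof (rule mult_mono[OF v])
      show "norm (f (emb k y)) \<le> C * \<Gamma> (i - k)"
        using site[OF supported_at_emb, of k y] norm_emb_le[of k y] y1 by simp
    qed (use decay_functionD(1)[OF \<Gamma>] in \<open>simp_all add: less_imp_le\<close>)
    finally show ?thesis by (simp add: mult_ac)
  qed
  then have "norm (f u) \<le> (\<Sum>k\<in>T. C * (\<Gamma> (i - k) * \<Gamma> (k - l)))"
    unfolding u_def linear_sum[OF f] by (intro sum_norm_le) auto
  also have "\<dots> \<le> C * \<Gamma> (i - l)"
    unfolding sum_distrib_left[symmetric] by (intro mult_left_mono decay_function_convolution[OF \<Gamma> T] C)
  finally have 1: "norm (f u) \<le> C * \<Gamma> (i - l)" .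
  have "norm (v - u) \<le> e'"
  proof (rule norm_bound)
    fix k
    have "apply_bcontfun (v - u) k = (if k \<in> T then 0 else proj k v)"
      using T by (simp add: u_def proj_emb proj_sum flip: proj_def add: proj_diff)
    then show "norm (apply_bcontfun (v - u) k) \<le> e'" using v[of k] e' by (auto simp: T_def)
  qed
  then have "norm (f (v - u)) \<le> C * e'" using nf[of "v - u"] C by (meson mult_left_mono order_trans)
  also have "\<dots> \<le> e" using C e by (simp add: e'_def field_simps)
  finally have "norm (f (v - u)) \<le> e" .
  then show "norm (f v) \<le> C * \<Gamma> (i - l) + e"
    using 1 norm_triangle_ineq[of "f u" "f (v - u)"] by (simp add: linear_diff[OF f])
qed

definition site_weight :: "(int^'m::finite \<Rightarrow> real) \<Rightarrow> (int^'m) option \<Rightarrow> int^'m \<Rightarrow> real" where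
  "site_weight \<Gamma> w i = (case w of None \<Rightarrow> 1 | Some l \<Rightarrow> \<Gamma> (i - l))"

text \<open>The gauge of \<open>None\<close> is the supremum over the sites of the norm
  \<open>y \<mapsto> sup\<^sub>k max (\<parallel>a\<^sup>k y\<parallel> / \<theta>\<^sup>k) (\<parallel>a\<^sup>-\<^sup>k y\<parallel> / \<theta>'\<^sup>k)\<close>, which is adapted to \<open>a\<close> and to its inverse at once;
  the gauge of \<open>Some l\<close> measures decay away from the site \<open>l\<close> in the same norm.\<close>

definition gauge_maps ::
  "(int^'m::finite \<Rightarrow> real) \<Rightarrow> ('v \<Rightarrow> 'v) \<Rightarrow> ('v \<Rightarrow> 'v) \<Rightarrow> real \<Rightarrow> real \<Rightarrow> (int^'m) option \<Rightarrow>
    (('m, 'v::real_normed_vector) ell_infty \<Rightarrow> 'v) set" where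
  "gauge_maps \<Gamma> a ai \<theta> \<theta>' w =
     range (\<lambda>(k, i) x. (1 / (\<theta> ^ k * site_weight \<Gamma> w i)) *\<^sub>R (a ^^ k) (apply_bcontfun x i)) \<union>
     range (\<lambda>(k, i) x. (1 / (\<theta>' ^ k * site_weight \<Gamma> w i)) *\<^sub>R (ai ^^ k) (apply_bcontfun x i))"

text \<open>The library has completeness of this type only over a metric space; the index set is just a
  topological space here.\<close>

instance bcontfun :: (topological_space, complete_space) complete_space
proof
  fix f :: "nat \<Rightarrow> 'a \<Rightarrow>\<^sub>C 'b"
  assume f: "Cauchy f"
  have "uniformly_Cauchy_on UNIV (\<lambda>n. apply_bcontfun (f n))"
    unfolding uniformly_Cauchy_on_def
  proof (intro allI impI)
    fix e :: real assume "e > 0"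
    then obtain M where "\<And>m n. m \<ge> M \<Longrightarrow> n \<ge> M \<Longrightarrow> dist (f m) (f n) < e"
      using f unfolding Cauchy_def by meson
    then show "\<exists>M. \<forall>x\<in>UNIV. \<forall>m\<ge>M. \<forall>n\<ge>M. dist (apply_bcontfun (f m) x) (apply_bcontfun (f n) x) < e"
      using dist_bounded le_less_trans by blast
  qed
  then obtain g where "uniform_limit UNIV f g sequentially"
    using Cauchy_uniformly_convergent unfolding uniformly_convergent_on_def by blast
  then obtain l where "f \<longlonglongrightarrow> l" by (rule uniform_limit_bcontfunE) simp_all
  then show "convergent f" by (rule convergentI)
qed

instance bcontfun :: (topological_space, banach) banach ..

text \<open>\<open>growth\<close> makes the adapted norm equivalent to the given one with constant
  \<open>K\<close>. \<open>prod_ge\<close> reconciles the two rates: applying \<open>a\<close>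
  cancels one power of \<open>ai\<close>, which loses a factor \<open>\<theta>'\<close>, and the
  rate \<open>\<theta>\<close> for \<open>a\<close> still holds because
  \<open>\<theta> * \<theta>'\<close> is at least 1.\<close>

locale adapted =
  fixes \<Gamma> :: "int^'m::finite \<Rightarrow> real" and a ai :: "'v::banach \<Rightarrow> 'v" and \<theta> \<theta>' K :: real
  assumes \<Gamma>: "decay_function \<Gamma>" and a: "bounded_linear a" and ai: "bounded_linear ai"
    and a_ai: "a (ai x) = x" and ai_a: "ai (a x) = x"
    and pos: "0 < \<theta>" "0 < \<theta>'" and prod_ge: "1 \<le> \<theta> * \<theta>'" and K1: "1 \<le> K"
    and growth: "norm ((a ^^ k) x) \<le> K * \<theta> ^ k * norm x" "norm ((ai ^^ k) x) \<le> K * \<theta>' ^ k * norm x"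
begin

abbreviation maps where "maps \<equiv> gauge_maps \<Gamma> a ai \<theta> \<theta>'"

definition pbound :: "real \<Rightarrow> 'v \<Rightarrow> bool" where
  "pbound c y \<longleftrightarrow> (\<forall>k. norm ((a ^^ k) y) \<le> c * \<theta> ^ k \<and> norm ((ai ^^ k) y) \<le> c * \<theta>' ^ k)"

lemma weight_pos: "0 < site_weight \<Gamma> w i"
  using decay_functionD(1)[OF \<Gamma>] by (cases w) (auto simp: site_weight_def)

lemma maps_bound_iff:
  "(\<forall>T\<in>maps w. norm (T x) \<le> c) \<longleftrightarrow> (\<forall>i. pbound (c * site_weight \<Gamma> w i) (apply_bcontfun x i))"
proof -
  have "norm ((1 / (t ^ k * site_weight \<Gamma> w i)) *\<^sub>R y) \<le> c \<longleftrightarrow> norm y \<le> c * site_weight \<Gamma> w i * t ^ k"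
    if "0 < t" for t k i and y :: 'v
    using that weight_pos[of w i] by (simp add: divide_le_eq mult_ac)
  then show ?thesis unfolding gauge_maps_def pbound_def using pos by (auto simp: ball_Un)
qed

lemma pbound_mono: "pbound c y \<Longrightarrow> c \<le> d \<Longrightarrow> pbound d y"
  unfolding pbound_def using pos by (meson less_imp_le mult_right_mono order_trans zero_le_power)

sublocale gauges maps None
proof (rule gauges.intro)
  show "bounded_linear T" if T: "T \<in> maps w" for T w
  proof -
    have pow: "bounded_linear (f ^^ k)" if "bounded_linear f" for f :: "'v \<Rightarrow> 'v" and k
    proof (induction k)
      case 0
      show ?case using bounded_linear_ident by (simp add: id_def)
    next
      case (Suc k)
      then show ?case using bounded_linear_compose[OF that Suc] by (simp add: o_def)
    qed
    have ev: "bounded_linear (\<lambda>x. apply_bcontfun x i)" for i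
      by (rule bounded_linear_intro[where K = 1]) (simp_all add: norm_bounded)
    have "bounded_linear (\<lambda>x. c *\<^sub>R (f ^^ k) (apply_bcontfun x i))" if "bounded_linear f" for f :: "'v \<Rightarrow> 'v" and c k i
      by (rule bounded_linear_compose[OF bounded_linear_scaleR_right bounded_linear_compose[OF pow[OF that] ev]])
    then show ?thesis using T a ai by (auto simp: gauge_maps_def)
  qed
qed

lemma bnd_iff: "bnd w c x \<longleftrightarrow> 0 \<le> c \<and> (\<forall>i. pbound (c * site_weight \<Gamma> w i) (apply_bcontfun x i))"
  unfolding bnd_def maps_bound_iff ..

lemma pbound_norm: "pbound c y \<Longrightarrow> norm y \<le> c"
  unfolding pbound_def by (auto dest!: spec[of _ 0])

lemma norm_pbound: "norm y \<le> d \<Longrightarrow> pbound (K * d) y"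
  unfolding pbound_def
proof (intro allI conjI)
  fix k assume y: "norm y \<le> d"
  have "K * \<theta> ^ k * norm y \<le> K * \<theta> ^ k * d" "K * \<theta>' ^ k * norm y \<le> K * \<theta>' ^ k * d"
    using y K1 pos by (auto intro!: mult_left_mono)
  then show "norm ((a ^^ k) y) \<le> K * d * \<theta> ^ k" "norm ((ai ^^ k) y) \<le> K * d * \<theta>' ^ k"
    using growth[of k y] by (simp_all add: mult_ac)
qed

lemma pbound_a:
  assumes "pbound c y"
  shows "pbound (\<theta> * c) (a y)"
  unfolding pbound_def
proof (intro allI conjI)
  have c: "0 \<le> c" using pbound_norm[OF assms] norm_ge_zero order_trans by blast
  fix k
  show "norm ((a ^^ k) (a y)) \<le> \<theta> * c * \<theta> ^ k"
    using assms[unfolded pbound_def, rule_format, of "Suc k"] by (simp add: funpow_swap1 mult_ac)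
  show "norm ((ai ^^ k) (a y)) \<le> \<theta> * c * \<theta>' ^ k"
  proof (cases k)
    case 0
    then show ?thesis using assms[unfolded pbound_def, rule_format, of 1] by (simp add: mult.commute)
  next
    case (Suc m)
    have "norm ((ai ^^ k) (a y)) = norm ((ai ^^ m) y)" by (simp add: Suc funpow_Suc_right ai_a del: funpow.simps)
    also have "\<dots> \<le> c * \<theta>' ^ m" using assms unfolding pbound_def by blast
    also have "\<dots> \<le> (c * \<theta>' ^ m) * (\<theta> * \<theta>')" using mult_left_mono[OF prod_ge, of "c * \<theta>' ^ m"] c pos by simp
    finally show ?thesis by (simp add: Suc mult_ac)
  qed
qed

lemma pbound_ai:
  assumes "pbound c y"
  shows "pbound (\<theta>' * c) (ai y)"
  unfolding pbound_def
proof (intro allI conjI)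
  have c: "0 \<le> c" using pbound_norm[OF assms] norm_ge_zero order_trans by blast
  fix k
  show "norm ((ai ^^ k) (ai y)) \<le> \<theta>' * c * \<theta>' ^ k"
    using assms[unfolded pbound_def, rule_format, of "Suc k"] by (simp add: funpow_swap1 mult_ac)
  show "norm ((a ^^ k) (ai y)) \<le> \<theta>' * c * \<theta> ^ k"
  proof (cases k)
    case 0
    then show ?thesis using assms[unfolded pbound_def, rule_format, of 1] by (simp add: mult.commute)
  next
    case (Suc m)
    have "norm ((a ^^ k) (ai y)) = norm ((a ^^ m) y)" by (simp add: Suc funpow_Suc_right a_ai del: funpow.simps)
    also have "\<dots> \<le> c * \<theta> ^ m" using assms unfolding pbound_def by blast
    also have "\<dots> \<le> (c * \<theta> ^ m) * (\<theta> * \<theta>')" using mult_left_mono[OF prod_ge, of "c * \<theta> ^ m"] c pos by simp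
    finally show ?thesis by (simp add: Suc mult_ac)
  qed
qed

sublocale gauge_space maps None K
proof (rule gauge_space.intro[OF gauges_axioms], rule gauge_space_axioms.intro)
  show "0 < K" using K1 by simp
  show "bnd None (K * norm x) x" for x
    unfolding bnd_iff using K1 by (auto simp: site_weight_def intro!: norm_pbound norm_bounded)
  show "norm x \<le> K * c" if x: "bnd None c x" for c x
  proof -
    have "norm x \<le> c"
    proof (rule norm_bound)
      fix i
      have "pbound c (apply_bcontfun x i)" using x by (simp add: bnd_iff site_weight_def)
      then show "norm (apply_bcontfun x i) \<le> c" by (rule pbound_norm)
    qed
    moreover have "c \<le> K * c" using K1 bnd_nonneg[OF x] by (simp add: mult_le_cancel_right1)
    ultimately show ?thesis by simp
  qed
qed

lemma bnd_norm_le: "bnd None c x \<Longrightarrow> norm x \<le> c"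
  by (rule norm_bound) (auto simp: bnd_iff site_weight_def intro: pbound_norm)

lemma bnd_Some_norm: "bnd (Some l) c x \<Longrightarrow> norm (proj i x) \<le> c * \<Gamma> (i - l)"
  using pbound_norm by (auto simp: bnd_iff site_weight_def proj_def)

lemma unitl_unit_list: "unitl w vs \<Longrightarrow> vs \<in> unit_lists (length vs)"
  by (auto simp: unitl_def unit_lists_def intro: bnd_norm_le)

text \<open>Norm estimates suffice up to the factor \<open>K\<close>: bounds in a gauge imply the
  same bounds in norm, and \<open>norm_pbound\<close> leads back at the cost of
  \<open>K\<close>.\<close>

lemma admwI:
  assumes C: "0 \<le> C" and n: "\<And>vs. vs \<in> unit_lists j \<Longrightarrow> norm (A vs) \<le> C"
    and g: "\<And>vs l i p. vs \<in> unit_lists j \<Longrightarrow> p < j \<Longrightarrow> (\<And>k. norm (proj k (vs ! p)) \<le> \<Gamma> (k - l)) \<Longrightarrow>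
      norm (proj i (A vs)) \<le> C * \<Gamma> (i - l)"
  shows "admw w (K * C) j A"
  unfolding admw_def
proof (intro allI impI)
  fix vs assume len: "length vs = j" and u: "unitl w vs"
  have vs: "vs \<in> unit_lists j" using unitl_unit_list[OF u] len by simp
  have "norm (apply_bcontfun (A vs) i) \<le> C * site_weight \<Gamma> w i" for i
  proof (cases w)
    case None
    then show ?thesis using n[OF vs] norm_bounded[of "A vs" i] by (simp add: site_weight_def)
  next
    case (Some l)
    then obtain v where "v \<in> set vs" "bnd (Some l) 1 v" using u by (auto simp: unitl_def)
    then obtain p where p: "p < j" "bnd (Some l) 1 (vs ! p)" using len by (auto simp: in_set_conv_nth)
    then have "norm (proj k (vs ! p)) \<le> \<Gamma> (k - l)" for k using bnd_Some_norm[of l 1] by simp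
    from g[OF vs p(1) this] show ?thesis using Some by (simp add: site_weight_def proj_def)
  qed
  from norm_pbound[OF this] show "bnd w (K * C) (A vs)"
    unfolding bnd_iff using C K1 by (simp add: mult.assoc)
qed

text \<open>\<open>gamma_multi\<close> tests single-site arguments. Freezing the other slots and
  summing over the sites with \<open>decay_convolution_bound\<close> extends it to an argument that
  decays like \<open>\<Gamma>\<close>.\<close>

lemma L_multi_admw:
  assumes A: "multilinear j A" and C: "0 \<le> C" "norm_multi \<Gamma> j A \<le> ennreal C"
  shows "admw w (K * C) j A"
proof (rule admwI[OF C(1)])
  have ob: "op_bound j C A" using C by (simp add: norm_multi_def op_norm_le_iff)
  then show "norm (A vs) \<le> C" if "vs \<in> unit_lists j" for vs using that by (simp add: op_bound_def)
  fix vs :: "('m, 'v) ell_infty list" and l i p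
  assume vs: "vs \<in> unit_lists j" and p: "p < j" and v: "\<And>k. norm (proj k (vs ! p)) \<le> \<Gamma> (k - l)"
  have len: "length vs = j" using vs by (simp add: unit_lists_def)
  define f where "f u = proj i (A (vs[p := u]))" for u
  have lin: "linear (\<lambda>u. A (vs[p := u]))" by (rule multilinearD[OF A len p])
  have "norm (f (vs ! p)) \<le> C * \<Gamma> (i - l)"
  proof (rule decay_convolution_bound[OF \<Gamma> _ C(1) _ _ v])
    show "linear f" unfolding f_def
      by (rule linearI) (simp_all add: linear_add[OF lin] linear_scale[OF lin] proj_add proj_scale)
    show "norm (f u) \<le> C * norm u" for u
    proof (cases "u = 0")
      case True
      then show ?thesis by (simp add: f_def linear_0[OF lin] proj_zero)
    next
      case False
      have "vs[p := sgn u] \<in> unit_lists j"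
        using vs by (auto simp: unit_lists_def norm_sgn dest!: set_update_subset_insert[THEN subsetD])
      then have "norm (A (vs[p := sgn u])) \<le> C" using ob by (simp add: op_bound_def)
      then have "norm (f (sgn u)) \<le> C" unfolding f_def using norm_proj_le order_trans by blast
      moreover have "f u = norm u *\<^sub>R f (sgn u)"
        using False by (simp add: f_def sgn_div_norm linear_scale[OF lin] proj_scale)
      ultimately show ?thesis by (simp add: mult.commute[of C] mult_left_mono)
    qed
    show "norm (f w) \<le> C * \<Gamma> (i - k)" if w: "supported_at w k" "norm w \<le> 1" for k w
    proof -
      \<comment> \<open>\<open>gamma_multi\<close> inserts \<open>w\<close> into a list of length j
        - 1, so slot p is removed first.\<close>
      define us where "us = take p vs @ drop (Suc p) vs"
      have us: "us \<in> unit_lists (j - 1)" using vs p len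
        by (auto simp: us_def unit_lists_def dest!: in_set_takeD in_set_dropD)
      have eq: "vs[p := w] = take p us @ w # drop p us"
        using p len by (simp add: us_def upd_conv_take_nth_drop)
      have "ennreal (norm (proj i (A (take p us @ w # drop p us))) / \<Gamma> (i - k)) \<le> gamma_multi \<Gamma> j A"
        unfolding gamma_multi_def
        by (rule SUP_upper2[of p], use p in simp, rule SUP_upper2[of i], simp, rule SUP_upper2[of k], simp,
            rule SUP_upper2[of w], use w in simp, rule SUP_upper[OF us])
      also have "\<dots> \<le> ennreal C" using C(2) by (simp add: norm_multi_def)
      finally have "norm (f w) / \<Gamma> (i - k) \<le> C" using C(1) by (simp add: eq f_def)
      then show ?thesis using decay_functionD(1)[OF \<Gamma>, of "i - k"] by (simp add: divide_le_eq)
    qed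
  qed
  then show "norm (proj i (A vs)) \<le> C * \<Gamma> (i - l)" by (simp add: f_def)
qed

lemma norm_lin_admw:
  assumes C: "0 \<le> C" "norm_lin \<Gamma> B \<le> ennreal C"
  shows "admw w (K * C) 1 (\<lambda>vs. blinfun_apply B (hd vs))"
proof (rule admwI[OF C(1)])
  have nB: "norm B \<le> C" using C by (simp add: norm_lin_def)
  have le: "norm (blinfun_apply B u) \<le> C * norm u" for u
    using order_trans[OF norm_blinfun[of B u] mult_right_mono[OF nB norm_ge_zero]] .
  show "norm (blinfun_apply B (hd vs)) \<le> C" if "vs \<in> unit_lists 1" for vs
  proof -
    have "norm (hd vs) \<le> 1" using that by (cases vs) (auto simp: unit_lists_def)
    then show ?thesis using le[of "hd vs"] C(1) by (meson mult_left_le order_trans)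
  qed
  fix vs :: "('m, 'v) ell_infty list" and l i p
  assume vs: "vs \<in> unit_lists 1" and p: "p < 1" and v: "\<And>k. norm (proj k (vs ! p)) \<le> \<Gamma> (k - l)"
  have hd: "hd vs = vs ! p" using vs p by (cases vs) (auto simp: unit_lists_def)
  have "norm (proj i (blinfun_apply B (vs ! p))) \<le> C * \<Gamma> (i - l)"
  proof (rule decay_convolution_bound[OF \<Gamma> _ C(1) _ _ v])
    show "linear (\<lambda>u. proj i (blinfun_apply B u))"
      by (rule linearI) (simp_all add: blinfun.add_right blinfun.scaleR_right proj_add proj_scale)
    show "norm (proj i (blinfun_apply B u)) \<le> C * norm u" for u
      using order_trans[OF norm_proj_le le] .
    show "norm (proj i (blinfun_apply B u)) \<le> C * \<Gamma> (i - k)" if u: "supported_at u k" "norm u \<le> 1" for k u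
    proof -
      have "ennreal (norm (proj i (blinfun_apply B u)) / \<Gamma> (i - k)) \<le> gamma_lin \<Gamma> B"
        unfolding gamma_lin_def
        by (rule SUP_upper2[of i], simp, rule SUP_upper2[of k], simp, rule SUP_upper) (use u in simp)
      also have "\<dots> \<le> ennreal C" using C(2) by (simp add: norm_lin_def)
      finally have "norm (proj i (blinfun_apply B u)) / \<Gamma> (i - k) \<le> C" using C(1) by simp
      then show ?thesis using decay_functionD(1)[OF \<Gamma>, of "i - k"] by (simp add: divide_le_eq)
    qed
  qed
  then show "norm (proj i (blinfun_apply B (hd vs))) \<le> C * \<Gamma> (i - l)" by (simp add: hd)
qed

text \<open>The way back: a vector supported at \<open>l\<close> of norm at most 1 has gauge at most
  \<open>K / \<Gamma> 0\<close> for \<open>Some l\<close>, the weight at \<open>l\<close> itself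
  being \<open>\<Gamma> 0\<close>.\<close>

lemma admw_L_multi:
  assumes A: "multilinear j A" and adm: "\<And>w. admw w c j A" and c: "0 \<le> c"
  shows "A \<in> L_multi \<Gamma> j" "norm_multi \<Gamma> j A \<le> ennreal (max (K * c * K ^ j) (c * (K / \<Gamma> 0) ^ j))"
proof -
  have op: "op_norm j A \<le> ennreal (K * c * K ^ j)"
    using admw_imp_op_bound[OF A adm] c K by (subst op_norm_le_iff) auto
  have \<Gamma>0: "0 < \<Gamma> 0" "\<Gamma> 0 \<le> 1" using decay_functionD(1)[OF \<Gamma>] decay_function_le_1[OF \<Gamma>] by auto
  have KG: "K \<le> K / \<Gamma> 0" using \<Gamma>0 K1 by (simp add: le_divide_eq mult_left_le)
  have "norm (proj i (A (take p vs @ u # drop p vs))) / \<Gamma> (i - l) \<le> c * (K / \<Gamma> 0) ^ j"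
    if p: "p < j" and u: "norm u \<le> 1" "supported_at u l" and vs: "vs \<in> unit_lists (j - 1)" for p i l u vs
  proof -
    define us where "us = take p vs @ u # drop p vs"
    have len: "length us = j" using p vs by (simp add: us_def unit_lists_def)
    have un: "us ! p = u" using p vs by (simp add: us_def unit_lists_def nth_append)
    have us1: "norm (us ! q) \<le> 1" if "q < j" for q
    proof -
      have "us ! q \<in> set us" using that len by simp
      then show ?thesis using u(1) vs
        by (auto simp: us_def unit_lists_def dest!: in_set_takeD in_set_dropD)
    qed
    have b0: "bnd None (K / \<Gamma> 0) (us ! q)" if "q < j" for q
      using bnd_mono[OF bnd_norm[of "us ! q"], of "K / \<Gamma> 0"] us1[OF that] K1 KG
      by (meson less_le_trans mult_left_le order_trans zero_less_one less_imp_le)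
    have bl: "bnd (Some l) (K / \<Gamma> 0) u"
      unfolding bnd_iff
    proof (intro conjI allI)
      show "0 \<le> K / \<Gamma> 0" using K1 \<Gamma>0 by simp
      fix i
      show "pbound (K / \<Gamma> 0 * site_weight \<Gamma> (Some l) i) (apply_bcontfun u i)"
      proof (cases "i = l")
        case True
        then show ?thesis using norm_pbound[of "apply_bcontfun u i" 1] norm_bounded[of u i] u(1) \<Gamma>0
          by (simp add: site_weight_def)
      next
        case False
        then have "apply_bcontfun u i = 0" using u(2) by (simp add: supported_at_def proj_def)
        then show ?thesis using norm_pbound[of "0::'v" 0]
          by (simp, elim pbound_mono) (use K1 \<Gamma>0 weight_pos[of "Some l" i] in simp)
      qed
    qed
    have "bnd (Some l) (c * prod_list (replicate j (K / \<Gamma> 0))) (A us)"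
      by (rule admw_scaled[OF A adm len]) (use b0 bl un p K1 \<Gamma>0 in auto)
    from bnd_Some_norm[OF this, of i] show ?thesis
      using decay_functionD(1)[OF \<Gamma>, of "i - l"] by (simp add: us_def divide_le_eq)
  qed
  then have "gamma_multi \<Gamma> j A \<le> ennreal (c * (K / \<Gamma> 0) ^ j)"
    unfolding gamma_multi_def by (intro SUP_least ennreal_leI) auto
  with op show le: "norm_multi \<Gamma> j A \<le> ennreal (max (K * c * K ^ j) (c * (K / \<Gamma> 0) ^ j))"
    unfolding norm_multi_def
    by (intro max.boundedI) (erule order_trans, intro ennreal_leI, simp)+
  have "norm_multi \<Gamma> j A < \<infinity>" using le by (simp add: le_less_trans)
  moreover have "op_norm j A < \<infinity>" using op by (simp add: le_less_trans)
  ultimately show "A \<in> L_multi \<Gamma> j" using A by (simp add: L_multi_def bounded_multilinear_def)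
qed

end

subsection \<open>Conjugacy with decay\<close>

lemma multilinear_scaleR: "multilinear k A \<Longrightarrow> multilinear k (\<lambda>vs. c *\<^sub>R A vs)"
  by (auto simp: multilinear_def intro: linear_compose_scale_right)

lemma multilinear_replicate:
  assumes "multilinear k A"
  shows "A (replicate k (c *\<^sub>R y)) = c ^ k *\<^sub>R A (replicate k y)"
  using multilinear_scale[OF assms, of "replicate k y" "replicate k c"] by simp

text \<open>Along a ray the i-th component of \<open>F\<close> sees only the i-th entry, so
  \<open>u\<close> may be replaced by \<open>emb i (proj i u)\<close>. This yields the action of
  \<open>A\<close> on all bounded families, which its blocks alone do not determine.\<close>

lemma uncoupled_derivative:
  fixes F :: "('m::finite, 'v::real_normed_vector) ell_infty \<Rightarrow> ('m, 'v) ell_infty"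
  assumes U: "open U" "0 \<in> U" and F: "uncoupled U F" and A: "(F has_derivative blinfun_apply A) (at 0)"
  shows "proj i (blinfun_apply A u) = proj i (blinfun_apply A (emb i (proj i u)))"
proof -
  define d where "d = u - emb i (proj i u)"
  have ray: "((\<lambda>t. proj i (F (t *\<^sub>R w))) has_derivative (\<lambda>t. t *\<^sub>R proj i (blinfun_apply A w))) (at 0)" for w
  proof -
    have "((\<lambda>t::real. t *\<^sub>R w) has_derivative (\<lambda>t. t *\<^sub>R w)) (at 0)"
      by (intro has_derivative_scaleR_left has_derivative_ident)
    moreover have "(F has_derivative blinfun_apply A) (at ((0::real) *\<^sub>R w))" using A by simp
    ultimately have "((\<lambda>t::real. F (t *\<^sub>R w)) has_derivative (\<lambda>t. blinfun_apply A (t *\<^sub>R w))) (at 0)"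
      by (rule has_derivative_compose)
    moreover have "bounded_linear (\<lambda>x :: ('m, 'v) ell_infty. proj i x)"
      by (rule bounded_linear_intro[where K = 1]) (simp_all add: proj_add proj_scale norm_proj_le)
    ultimately show ?thesis using bounded_linear.has_derivative
      by (fastforce simp: blinfun.scaleR_right proj_scale)
  qed
  obtain g where g: "\<And>x. x \<in> U \<Longrightarrow> proj i (F x) = g (proj i x)" using F unfolding uncoupled_def by blast
  obtain e where e: "e > 0" "ball 0 e \<subseteq> U" using U by (meson openE)
  \<comment> \<open>For times below \<open>c\<close> both rays stay in \<open>U\<close>, where
    \<open>g\<close> represents the component.\<close>
  define c where "c = e / (norm u + norm (emb i (proj i u)) + 1)"
  have pos: "norm u + norm (emb i (proj i u)) + 1 > 0" by (simp add: add_nonneg_pos)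
  have c: "c > 0" using e pos by (simp add: c_def)
  have inU: "t *\<^sub>R w \<in> U" if "\<bar>t\<bar> < c" "w = u \<or> w = emb i (proj i u)" for t w
  proof -
    have "norm w < norm u + norm (emb i (proj i u)) + 1"
      using that(2) norm_ge_zero[of u] norm_ge_zero[of "emb i (proj i u)"] by (elim disjE; simp only:; linarith)
    then have "\<bar>t\<bar> * norm w \<le> \<bar>t\<bar> * (norm u + norm (emb i (proj i u)) + 1)" by (intro mult_left_mono) auto
    also have "\<dots> < c * (norm u + norm (emb i (proj i u)) + 1)" using that(1) pos by (rule mult_strict_right_mono)
    also have "\<dots> = e" using pos by (simp add: c_def)
    finally show ?thesis using e(2) by (auto simp: subset_iff)
  qed
  have "((\<lambda>t. proj i (F (t *\<^sub>R emb i (proj i u)))) has_derivative (\<lambda>t. t *\<^sub>R proj i (blinfun_apply A u))) (at 0)"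
  proof (rule has_derivative_transform_within_open[OF ray[of u]])
    show "open (ball (0::real) c)" "0 \<in> ball (0::real) c" using c by auto
    fix t :: real assume "t \<in> ball 0 c"
    then have "\<bar>t\<bar> < c" by simp
    from inU[OF this] show "proj i (F (t *\<^sub>R u)) = proj i (F (t *\<^sub>R emb i (proj i u)))"
      by (simp add: g proj_scale proj_emb)
  qed
  from fun_cong[OF has_derivative_unique[OF this ray], of 1] show ?thesis by simp
qed

context gauges
begin

lemma admw_scaleR: "admw w c j A \<Longrightarrow> admw w (\<bar>s\<bar> * c) j (\<lambda>vs. s *\<^sub>R A vs)"
  unfolding admw_def by (simp add: bnd_scale)

lemma admw_cong: "admw w c j A \<Longrightarrow> (\<And>vs. length vs = j \<Longrightarrow> A vs = B vs) \<Longrightarrow> admw w c j B"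
  unfolding admw_def by simp

lemma admw_sum:
  "(\<And>i. i \<in> I \<Longrightarrow> admw w (c i) j (A i)) \<Longrightarrow> admw w (sum c I) j (\<lambda>vs. \<Sum>i\<in>I. A i vs)"
  unfolding admw_def by (simp add: bnd_sum)

lemma admw_hd:
  assumes "\<And>x. bnd w 1 x \<Longrightarrow> bnd w c (T x)"
  shows "admw w c 1 (\<lambda>vs. T (hd vs))"
  unfolding admw_def
proof (intro allI impI)
  fix vs assume "length vs = 1" "unitl w vs"
  then have "bnd w 1 (hd vs)" by (cases vs) (auto simp: unitl_def)
  then show "bnd w c (T (hd vs))" by (rule assms)
qed

text \<open>For derivatives of a polynomial at \<open>x\<close>: the copies of \<open>x\<close> are
  controlled in \<open>w0\<close> only, so the argument small in \<open>w\<close> has to be among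
  the \<open>vs\<close>, whence \<open>1 \<le> j\<close>.\<close>

lemma admw_append_replicate:
  assumes A: "multilinear (j + n) A" "admw w c (j + n) A" and x: "bnd w0 \<rho> x" "0 < \<rho>" and j: "1 \<le> j"
  shows "admw w (c * \<rho> ^ n) j (\<lambda>vs. A (vs @ replicate n x))"
  unfolding admw_def
proof (intro allI impI)
  fix vs assume len: "length vs = j" and u: "unitl w vs"
  let ?fs = "replicate j 1 @ replicate n \<rho>"
  have "bnd w (c * prod_list ?fs) (A (vs @ replicate n x))"
  proof (rule admw_scaled[OF A])
    show "0 < ?fs ! q \<and> bnd w0 (?fs ! q) ((vs @ replicate n x) ! q)" if "q < j + n" for q
      using that x u len by (auto simp: nth_append unitl_def)
    show "w = w0 \<or> (\<exists>q<j + n. bnd w (?fs ! q) ((vs @ replicate n x) ! q))"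
    proof (cases "w = w0")
      case False
      then obtain v where "v \<in> set vs" "bnd w 1 v" using u by (auto simp: unitl_def)
      then obtain q where "q < j" "bnd w 1 (vs ! q)" using len by (auto simp: in_set_conv_nth)
      then show ?thesis using len by (intro disjI2 exI[of _ q]) (simp add: nth_append)
    qed simp
  qed (use len in auto)
  then show "bnd w (c * \<rho> ^ n) (A (vs @ replicate n x))" by simp
qed

end

context adapted
begin

lemma admw_nodewise:
  assumes "\<And>y c. pbound c y \<Longrightarrow> pbound (t * c) (f y)" "0 \<le> t"
    and "\<And>x i. apply_bcontfun (T x) i = f (apply_bcontfun x i)" "bnd w c x"
  shows "bnd w (t * c) (T x)"
  using assms unfolding bnd_iff by (simp add: mult.assoc)

text \<open>A decaying argument contributes its value at node i as a factor of the bound at node i;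
  the other factors are at most 1.\<close>

lemma admw_of_local_bound:
  assumes C: "0 \<le> C" and A: "\<And>vs i. length vs = j \<Longrightarrow>
      norm (apply_bcontfun (A vs) i) \<le> C * prod_list (map (\<lambda>v. norm (apply_bcontfun v i)) vs)"
  shows "admw w (K * C) j A"
proof (rule admwI[OF C])
  have le1: "norm (apply_bcontfun v i) \<le> 1" if "vs \<in> unit_lists j" "v \<in> set vs" for vs :: "('m, 'v) ell_infty list" and v i
    using that norm_bounded[of v i] by (auto simp: unit_lists_def)
  have prod1: "prod_list (map (\<lambda>v. norm (apply_bcontfun v i)) us) \<le> 1"
    if "vs \<in> unit_lists j" "set us \<subseteq> set vs" for vs us :: "('m, 'v) ell_infty list" and i
  proof -
    have "prod_list (map (\<lambda>v. norm (apply_bcontfun v i)) us) \<le> 1 ^ length (map (\<lambda>v. norm (apply_bcontfun v i)) us)"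
      by (rule prod_list_le_power) (use that le1 in auto)
    then show ?thesis by simp
  qed
  show "norm (A vs) \<le> C" if vs: "vs \<in> unit_lists j" for vs
  proof (rule norm_bound)
    fix i
    have "C * prod_list (map (\<lambda>v. norm (apply_bcontfun v i)) vs) \<le> C * 1"
      using prod1[OF vs order_refl] C by (intro mult_left_mono)
    then show "norm (apply_bcontfun (A vs) i) \<le> C" using A[of vs i] vs by (simp add: unit_lists_def)
  qed
  fix vs :: "('m, 'v) ell_infty list" and l i p
  assume vs: "vs \<in> unit_lists j" and p: "p < j" and v: "\<And>k. norm (proj k (vs ! p)) \<le> \<Gamma> (k - l)"
  have len: "length vs = j" using vs by (simp add: unit_lists_def)
  let ?n = "\<lambda>v :: ('m, 'v) ell_infty. norm (apply_bcontfun v i)"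
  have split: "vs = take p vs @ vs ! p # drop (Suc p) vs" using p len by (simp add: id_take_nth_drop)
  have sub: "set (take p vs @ drop (Suc p) vs) \<subseteq> set vs" by (auto dest: in_set_takeD in_set_dropD)
  have "prod_list (map ?n vs) = ?n (vs ! p) * prod_list (map ?n (take p vs @ drop (Suc p) vs))"
    by (subst split) simp
  also have "\<dots> \<le> \<Gamma> (i - l) * 1"
    using v[of i] prod1[OF vs sub] decay_functionD(1)[OF \<Gamma>]
    by (intro mult_mono prod_list_nonneg) (auto simp: proj_def less_imp_le)
  finally have "C * prod_list (map ?n vs) \<le> C * \<Gamma> (i - l)" using C by (intro mult_left_mono) auto
  then show "norm (proj i (A vs)) \<le> C * \<Gamma> (i - l)" using A[OF len, of i] by (simp add: proj_def)
qed

text \<open>The gap between \<open>\<theta>\<close> and \<open>\<theta>2\<close> leaves room for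
  \<open>B\<close> and for the variation of the first derivative, so that the nonlinear map still
  contracts at rate \<open>\<theta>2\<close>.\<close>

theorem decay_conjugacy:
  fixes S :: "'v set"
  assumes S: "finite_basis S" and \<theta>2: "\<theta> < \<theta>2" "\<theta>2 < 1" "\<theta>' * \<theta>2 ^ s < 1" and s: "2 \<le> s" "s \<le> r"
  shows "\<exists>\<epsilon>>0. \<forall>(U :: ('m, 'v) ell_infty set) F F\<^sub>0 F\<^sub>1 A B.
    open U \<and> 0 \<in> U \<and>
    F \<in> C_decay \<Gamma> r U \<and> (\<forall>x\<in>U. F x = F\<^sub>0 x + F\<^sub>1 x) \<and>
    uncoupled U F\<^sub>0 \<and> F\<^sub>0 0 = 0 \<and> F\<^sub>1 0 = 0 \<and>
    (F\<^sub>0 has_derivative blinfun_apply A) (at 0) \<and>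
    (F\<^sub>1 has_derivative blinfun_apply B) (at 0) \<and>
    (\<forall>i j v. proj i (blinfun_apply A (emb j v)) = (if i = j then a v else 0)) \<and>
    norm_lin \<Gamma> B < ennreal \<epsilon>
    \<longrightarrow> (\<exists>H R U\<^sub>1. polynomial_decay \<Gamma> s H \<and>
          R \<in> C_decay \<Gamma> r UNIV \<and> R 0 = 0 \<and> (R has_derivative id) (at 0) \<and>
          open U\<^sub>1 \<and> 0 \<in> U\<^sub>1 \<and> U\<^sub>1 \<subseteq> U \<and> (\<forall>x\<in>U\<^sub>1. R (F x) = H (R x)))"
proof -
  have \<theta>2pos: "0 < \<theta>2" using pos \<theta>2 by simp
  show ?thesis
  proof (rule conjugacy[OF \<theta>2pos \<theta>2(2) pos(2) \<theta>2(3) s])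
    fix \<eta> :: real assume \<eta>: "0 < \<eta>" "\<eta> \<le> 1" and conj: "\<And>F N A B.
        smooth_family r (gball 1) F \<Longrightarrow> F 0 0 [] = 0 \<Longrightarrow>
        (\<And>w x. x \<in> gball 1 \<Longrightarrow> admw w \<theta>2 1 (F 1 x)) \<Longrightarrow>
        (\<And>w j x. x \<in> gball 1 \<Longrightarrow> 2 \<le> j \<Longrightarrow> j \<le> r \<Longrightarrow> admw w \<eta> j (F j x)) \<Longrightarrow>
        smooth_family (Suc r) (gball 3) N \<Longrightarrow>
        (\<And>w j x. x \<in> gball 3 \<Longrightarrow> 1 \<le> j \<Longrightarrow> j \<le> Suc r \<Longrightarrow> admw w \<eta> j (N j x)) \<Longrightarrow>
        linear A \<Longrightarrow> bounded_linear B \<Longrightarrow> (\<And>x. A (B x) = x) \<Longrightarrow> (\<And>x. B (A x) = x) \<Longrightarrow>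
        (\<And>w c x. bnd w c x \<Longrightarrow> bnd w (\<theta>' * c) (B x)) \<Longrightarrow>
        (\<And>j vs. j < s \<Longrightarrow> length vs = j \<Longrightarrow> F j 0 vs = N j 0 vs + A (id_family j 0 vs)) \<Longrightarrow>
        \<exists>R. smooth_family r (gball 1) R \<and> R 0 0 [] = 0 \<and> (\<forall>h. R 1 0 [h] = h) \<and>
          (\<forall>w j. \<forall>x\<in>gball 1. j \<le> r \<longrightarrow> admw w 2 j (R j x)) \<and>
          (\<forall>x\<in>gball 1. R 0 (F 0 x []) [] = A (R 0 x []) + N 0 (R 0 x []) [])"
    \<comment> \<open>\<open>K * \<epsilon>\<close> bounds \<open>B\<close> in every gauge. It may
      use half of \<open>\<theta>2 - \<theta>\<close> and half of \<open>\<eta>\<close>; the other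
      halves go to the nonlinear terms through \<open>\<delta>\<close>.\<close>
    define \<epsilon> where "\<epsilon> = min (\<theta>2 - \<theta>) \<eta> / (2 * K)"
    have \<epsilon>: "\<epsilon> > 0" "K * \<epsilon> \<le> (\<theta>2 - \<theta>) / 2" "K * \<epsilon> \<le> \<eta> / 2"
      using \<theta>2 \<eta> K1 by (auto simp: \<epsilon>_def field_simps)
    have r: "1 \<le> r" "2 \<le> r" "0 < r" "1 < r" using s by auto
    show ?thesis
    proof (intro exI[of _ \<epsilon>] conjI \<epsilon>(1) allI impI; elim conjE)
      fix U :: "('m, 'v) ell_infty set" and F F\<^sub>0 F\<^sub>1 and A B :: "('m, 'v) ell_infty \<Rightarrow>\<^sub>L ('m, 'v) ell_infty"
      assume U: "open U" "0 \<in> U" and F: "F \<in> C_decay \<Gamma> r U" and F01: "\<forall>x\<in>U. F x = F\<^sub>0 x + F\<^sub>1 x"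
        and F\<^sub>0: "uncoupled U F\<^sub>0" "F\<^sub>0 0 = 0" and F\<^sub>1: "F\<^sub>1 0 = 0"
        and A: "(F\<^sub>0 has_derivative blinfun_apply A) (at 0)" and B: "(F\<^sub>1 has_derivative blinfun_apply B) (at 0)"
        and blocks: "\<forall>i j v. proj i (blinfun_apply A (emb j v)) = (if i = j then a v else 0)"
        and small: "norm_lin \<Gamma> B < ennreal \<epsilon>"
      obtain D where D: "frechet_derivs r U F D" and Fbd: "bounded (F ` U)"
        and DL: "\<forall>j\<in>{1..r}. (\<forall>x\<in>U. D j x \<in> L_multi \<Gamma> j) \<and> (SUP x\<in>U. norm_multi \<Gamma> j (D j x)) < \<infinity>"
        using F unfolding C_decay_def by blast
      have D0: "D 0 x [] = F x" if "x \<in> U" for x using D that unfolding frechet_derivs_def by blast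
      have F0: "F 0 = 0" using F01 F\<^sub>0 F\<^sub>1 U by simp
      have "\<exists>c\<ge>0. \<forall>x\<in>U. norm_multi \<Gamma> j (D j x) \<le> ennreal c" if "j \<in> {1..r}" for j
      proof -
        have fin: "(SUP x\<in>U. norm_multi \<Gamma> j (D j x)) < \<infinity>" using DL that by blast
        define c where "c = enn2real (SUP x\<in>U. norm_multi \<Gamma> j (D j x))"
        have "ennreal c = (SUP x\<in>U. norm_multi \<Gamma> j (D j x))"
          unfolding c_def by (rule ennreal_enn2real) (use fin in \<open>simp add: infinity_ennreal_def\<close>)
        then have "norm_multi \<Gamma> j (D j x) \<le> ennreal c" if "x \<in> U" for x
          using SUP_upper[OF that, of "\<lambda>x. norm_multi \<Gamma> j (D j x)"] by simp
        moreover have "0 \<le> c" by (simp add: c_def)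
        ultimately show ?thesis by blast
      qed
      then obtain cc where cc: "\<And>j. j \<in> {1..r} \<Longrightarrow> 0 \<le> cc j"
        "\<And>j x. j \<in> {1..r} \<Longrightarrow> x \<in> U \<Longrightarrow> norm_multi \<Gamma> j (D j x) \<le> ennreal (cc j)" by metis
      define C where "C = (\<Sum>j\<in>{1..r}. cc j)"
      have C0: "0 \<le> C" unfolding C_def using cc(1) by (intro sum_nonneg) auto
      have DC: "norm_multi \<Gamma> j (D j x) \<le> ennreal C" if "1 \<le> j" "j \<le> r" "x \<in> U" for j x
      proof -
        have "cc j \<le> C" unfolding C_def using cc(1) that by (intro member_le_sum) auto
        then show ?thesis using cc(2)[of j x] that ennreal_leI order_trans by fastforce
      qed
      have Dsm: "smooth_family r U D"
      proof (rule frechet_derivs_imp_smooth_family[OF D U(1)])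
        fix j assume j: "j \<le> r"
        show "\<exists>C. \<forall>x\<in>U. op_bound j C (D j x)"
        proof (cases "j = 0")
          case True
          obtain M where "\<And>x. x \<in> U \<Longrightarrow> norm (F x) \<le> M" using Fbd by (auto simp: bounded_iff)
          then show ?thesis using True by (intro exI[of _ M]) (auto simp: op_bound_def unit_lists_def D0)
        next
          case False
          then have "op_norm j (D j x) \<le> ennreal C" if "x \<in> U" for x
            using DC[of j x] j that by (simp add: norm_multi_def)
          then show ?thesis using op_norm_le_iff[OF C0] by blast
        qed
      qed
      note Dml = smooth_family_multilinear[OF Dsm U(1)]
      define C1 where "C1 = K * C"
      have C1: "0 \<le> C1" using C0 K1 by (simp add: C1_def)
      have Dadm: "admw w C1 j (D j x)" if "1 \<le> j" "j \<le> r" "x \<in> U" for w j x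
        unfolding C1_def by (rule L_multi_admw[OF Dml C0 DC]) (use that in auto)
      have D1: "D 1 0 [h] = blinfun_apply A h + blinfun_apply B h" for h
      proof -
        have "((\<lambda>x. F\<^sub>0 x + F\<^sub>1 x) has_derivative (\<lambda>h. blinfun_apply A h + blinfun_apply B h)) (at 0)"
          by (rule has_derivative_add[OF A B])
        then have "((\<lambda>x. D 0 x []) has_derivative (\<lambda>h. blinfun_apply A h + blinfun_apply B h)) (at 0)"
          by (rule has_derivative_transform_within_open[OF _ U]) (simp add: D0 F01)
        moreover have "((\<lambda>x. D 0 x []) has_derivative (\<lambda>h. D 1 0 [h])) (at 0)"
          using smooth_family_deriv[OF Dsm r(3) U(2), of "[]"] by simp
        ultimately have "(\<lambda>h. blinfun_apply A h + blinfun_apply B h) = (\<lambda>h. D 1 0 [h])"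
          by (rule has_derivative_unique)
        then show ?thesis by (simp add: fun_eq_iff)
      qed
      have Anode: "apply_bcontfun (blinfun_apply A u) i = a (apply_bcontfun u i)" for u i
        using uncoupled_derivative[OF U F\<^sub>0(1) A, of i u] blocks by (simp add: proj_def)
      have Abnd: "bnd w (\<theta> * c) (blinfun_apply A x)" if "bnd w c x" for w c x
        by (rule admw_nodewise[where f = a, OF pbound_a _ Anode that]) (use pos in auto)
      have Aadm: "admw w \<theta> 1 (\<lambda>vs. blinfun_apply A (hd vs))" for w
        using admw_hd[of w \<theta>] Abnd[of w 1] by simp
      have Badm: "admw w (K * \<epsilon>) 1 (\<lambda>vs. blinfun_apply B (hd vs))" for w
        by (rule norm_lin_admw) (use small \<epsilon> in auto)
      obtain e0 where e0: "e0 > 0" "ball 0 e0 \<subseteq> U" using U by (meson openE)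
      \<comment> \<open>At most \<open>s + 1\<close> Taylor terms, each with up to \<open>s\<close>
        copies of a point of gauge at most 3.\<close>
      define M where "M = real (s + 1) * 3 ^ s"
      have M1: "1 \<le> M"
      proof -
        have "(1::real) * 1 \<le> real (s + 1) * 3 ^ s" by (intro mult_mono) auto
        then show ?thesis by (simp add: M_def)
      qed
      \<comment> \<open>In this order: no enlargement; the scaled unit ball lies in
        \<open>U\<close>; the first derivative varies by at most half the gap; the Taylor terms from
        order 2 on stay below \<open>\<eta> / 2\<close>.\<close>
      define \<delta> where "\<delta> = min 1 (min (e0 / (2 * K)) (min ((\<theta>2 - \<theta>) / (2 * (C1 + 1))) (\<eta> / (2 * (C1 + 1) * M))))"
      have \<delta>: "0 < \<delta>" "\<delta> \<le> 1"
        using e0 K1 \<theta>2 \<eta> C1 M1 by (auto simp: \<delta>_def)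
      have \<delta>e0: "\<delta> * K < e0"
      proof -
        have "\<delta> \<le> e0 / (2 * K)" by (simp add: \<delta>_def)
        then have "\<delta> * K \<le> e0 / 2" using K1 by (simp add: field_simps)
        then show ?thesis using e0 by simp
      qed
      have \<delta>\<theta>: "\<delta> * C1 \<le> (\<theta>2 - \<theta>) / 2"
      proof -
        have "\<delta> * C1 \<le> \<delta> * (C1 + 1)" using \<delta> by simp
        also have "\<dots> \<le> (\<theta>2 - \<theta>) / (2 * (C1 + 1)) * (C1 + 1)"
          using C1 by (intro mult_right_mono) (auto simp: \<delta>_def)
        also have "\<dots> = (\<theta>2 - \<theta>) / 2" using C1 by (simp add: field_simps)
        finally show ?thesis .
      qed
      have \<delta>\<eta>: "\<delta> * C1 * M \<le> \<eta> / 2"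
      proof -
        have "\<delta> * C1 * M \<le> \<delta> * ((C1 + 1) * M)" using \<delta> M1 by (simp add: algebra_simps)
        also have "\<dots> \<le> \<eta> / (2 * (C1 + 1) * M) * ((C1 + 1) * M)"
          using C1 M1 by (intro mult_right_mono) (auto simp: \<delta>_def)
        also have "\<dots> = \<eta> / 2"
        proof -
          have "C1 + 1 \<noteq> 0" "M \<noteq> 0" using C1 M1 by auto
          then show ?thesis by (simp add: divide_simps)
        qed
        finally show ?thesis .
      qed
      have \<delta>\<eta>': "\<delta> * C1 \<le> \<eta>"
      proof -
        have "\<delta> * C1 * 1 \<le> \<delta> * C1 * M" using \<delta> C1 M1 by (intro mult_left_mono) auto
        then show ?thesis using \<delta>\<eta> \<eta> by simp
      qed
      have scaleU: "\<delta> *\<^sub>R x \<in> U" if x: "x \<in> gball 1" for x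
      proof -
        have "norm x \<le> K * 1" by (rule norm_le_bnd[OF gballD[OF x]])
        then have "\<delta> * norm x \<le> \<delta> * K" using \<delta> by (intro mult_left_mono) auto
        then have "\<delta> * norm x < e0" using \<delta>e0 by linarith
        then have "norm (\<delta> *\<^sub>R x) < e0" using \<delta> by simp
        then show ?thesis using e0(2) by (auto simp: subset_iff)
      qed
      \<comment> \<open>Rescaling leaves the linear part alone and multiplies every order from 2 on
        by at most \<open>\<delta>\<close>.\<close>
      define F' where "F' j x vs = (\<delta> ^ j / \<delta>) *\<^sub>R D j (\<delta> *\<^sub>R x) vs" for j x vs
      have F'sm: "smooth_family r (gball 1) F'"
        unfolding F'_def[abs_def] by (rule smooth_family_rescale[OF Dsm \<delta>(1) scaleU U(1)])
      note F'ml = smooth_family_multilinear[OF F'sm open_gball]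
      have z1: "0 \<in> gball 1" and z3: "0 \<in> gball 3" by (auto simp: zero_gball)
      have F'00: "F' 0 0 [] = 0" by (simp add: F'_def D0[OF U(2)] F0)
      have F'2: "admw w (\<delta> * C1) j (F' j x)" if "2 \<le> j" "j \<le> r" "x \<in> gball 1" for w j x
      proof -
        have "admw w (\<bar>\<delta> ^ j / \<delta>\<bar> * C1) j (F' j x)"
          unfolding F'_def by (rule admw_scaleR) (use Dadm scaleU that in auto)
        moreover have "\<bar>\<delta> ^ j / \<delta>\<bar> \<le> \<delta>"
        proof -
          have "\<delta> ^ j \<le> \<delta> ^ 2" using \<delta> that by (intro power_decreasing) auto
          then show ?thesis using \<delta> by (simp add: power2_eq_square divide_le_eq)
        qed
        ultimately show ?thesis using C1 by (elim admw_mono) (rule mult_right_mono)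
      qed
      have F'1: "F' 1 0 vs = blinfun_apply A (hd vs) + blinfun_apply B (hd vs)" if "length vs = 1" for vs
        using that \<delta> D1 by (cases vs) (auto simp: F'_def)
      \<comment> \<open>At 0 the first derivative is \<open>A + B\<close>, with bound
        \<open>\<theta> + K * \<epsilon>\<close>; over the ball the second derivative moves it by at
        most \<open>\<delta> * C1\<close>.\<close>
      have F'1adm: "admw w \<theta>2 1 (F' 1 x)" if x: "x \<in> gball 1" for w x
      proof -
        have "admw w (\<delta> * C1 * 1) 1 (\<lambda>vs. F' 1 x vs - F' 1 0 vs)"
          by (rule admw_lipschitz[OF convex_gball z1 x])
             (use smooth_family_deriv[OF F'sm r(4)] F'ml F'2 r gballD[OF x] in \<open>auto simp: numeral_2_eq_2\<close>)
        from admw_add[OF this admw_add[OF Aadm Badm]]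
        have "admw w (\<delta> * C1 * 1 + (\<theta> + K * \<epsilon>)) 1 (F' 1 x)"
          by (rule admw_cong) (simp add: F'1[simplified])
        then show ?thesis by (rule admw_mono) (use \<delta>\<theta> \<epsilon>(2) in simp)
      qed
      define L where "L = (\<lambda>m. F' m 0)"
      have Lml: "multilinear m (L m)" if "m \<le> s" for m using F'ml[OF _ z1] that s by (simp add: L_def)
      have Lbd: "\<exists>C. op_bound m C (L m)" if "m \<le> s" for m
        using smooth_family_ex_bound[OF F'sm, of m] z1 that s unfolding L_def by auto
      have Lsym: "L m us = L m vs" if "m \<le> s" "length us = m" "mset us = mset vs" for m us vs
        unfolding L_def using smooth_family_symmetric[OF F'sm open_gball _ z1 that(2,3)] that s by simp
      \<comment> \<open>The Taylor polynomial of the rescaled map without \<open>A\<close>; being a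
        polynomial it has the order \<open>Suc r\<close> that \<open>conjugacy\<close>
        demands.\<close>
      define N where "N j x vs = taylor_family s L j x vs - blinfun_apply A (id_family j x vs)" for j x vs
      have Nsm: "smooth_family (Suc r) (gball 3) N"
        unfolding N_def[abs_def]
        by (intro smooth_family_diff smooth_family_taylor[OF Lml Lbd Lsym] open_gball convex_gball bounded_gball
            smooth_family_linear[OF blinfun.bounded_linear_right] smooth_family_id)
      have Nadm: "admw w \<eta> j (N j x)" if x: "x \<in> gball 3" and j: "1 \<le> j" for w j x
      proof -
        \<comment> \<open>The orders from 2 on are small through \<open>\<delta>\<close>. The linear
          term occurs for \<open>j = 1\<close> only; there it leaves \<open>B\<close>, which is
          small through \<open>\<epsilon>\<close>.\<close>
        define I where "I = {max 2 j..s}"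
        have "admw w (\<delta> * C1 * 3 ^ s) j (\<lambda>vs. (1 / fact (m - j)) *\<^sub>R L m (vs @ replicate (m - j) x))" if m: "m \<in> I" for m
        proof -
          have m': "2 \<le> m" "j \<le> m" "m \<le> s" "m \<le> r" using m s by (auto simp: I_def)
          have "admw w (\<delta> * C1 * 3 ^ (m - j)) j (\<lambda>vs. L m (vs @ replicate (m - j) x))"
            by (rule admw_append_replicate) (use m' Lml F'2[OF m'(1,4) z1] gballD[OF x] j in \<open>auto simp: L_def\<close>)
          from admw_scaleR[OF this, of "1 / fact (m - j)"]
          have "admw w (\<bar>1 / fact (m - j)\<bar> * (\<delta> * C1 * 3 ^ (m - j))) j
              (\<lambda>vs. (1 / fact (m - j)) *\<^sub>R L m (vs @ replicate (m - j) x))" .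
          then show ?thesis
          proof (rule admw_mono)
            have "(1::real) / fact (m - j) \<le> 1" by (simp add: divide_le_eq_1)
            moreover have "(3::real) ^ (m - j) \<le> 3 ^ s" using m' by (intro power_increasing) auto
            ultimately have "1 / fact (m - j) * (\<delta> * C1 * 3 ^ (m - j)) \<le> 1 * (\<delta> * C1 * 3 ^ s)"
              using \<delta> C1 by (intro mult_mono) auto
            then show "\<bar>1 / fact (m - j)\<bar> * (\<delta> * C1 * 3 ^ (m - j)) \<le> \<delta> * C1 * 3 ^ s" by simp
          qed
        qed
        then have "admw w (\<Sum>m\<in>I. \<delta> * C1 * 3 ^ s) j (\<lambda>vs. \<Sum>m\<in>I. (1 / fact (m - j)) *\<^sub>R L m (vs @ replicate (m - j) x))"
          by (rule admw_sum)
        moreover have "(\<Sum>m\<in>I. \<delta> * C1 * 3 ^ s) \<le> \<eta> / 2"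
        proof -
          have "real (card I) \<le> real (s + 1)" by (simp add: I_def)
          then have "real (card I) * (\<delta> * C1 * 3 ^ s) \<le> real (s + 1) * (\<delta> * C1 * 3 ^ s)"
            using \<delta> C1 by (intro mult_right_mono) auto
          also have "\<dots> = \<delta> * C1 * M" by (simp add: M_def)
          also note \<delta>\<eta>
          finally show ?thesis by simp
        qed
        ultimately have 1: "admw w (\<eta> / 2) j (\<lambda>vs. \<Sum>m\<in>I. (1 / fact (m - j)) *\<^sub>R L m (vs @ replicate (m - j) x))"
          by (rule admw_mono)
        show ?thesis
        proof (cases "j = 1")
          case True
          have "N 1 x vs = (\<Sum>m\<in>I. (1 / fact (m - 1)) *\<^sub>R L m (vs @ replicate (m - 1) x)) + blinfun_apply B (hd vs)"
            if "length vs = 1" for vs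
          proof -
            have "{1..s} = insert 1 I" using s True by (auto simp: I_def)
            then show ?thesis using F'1[OF that] True
              by (simp add: N_def taylor_family_def L_def id_family_def I_def)
          qed
          moreover have "admw w (\<eta> / 2 + K * \<epsilon>) 1 (\<lambda>vs. (\<Sum>m\<in>I. (1 / fact (m - 1)) *\<^sub>R L m (vs @ replicate (m - 1) x)) +
              blinfun_apply B (hd vs))"
            using admw_add[OF 1[unfolded True] Badm] .
          ultimately have "admw w (\<eta> / 2 + K * \<epsilon>) 1 (N 1 x)" by (elim admw_cong) simp
          then show ?thesis unfolding True by (rule admw_mono) (use \<epsilon>(3) in simp)
        next
          case False
          with j have "I = {j..s}" "2 \<le> j" by (auto simp: I_def)
          then have "N j x = (\<lambda>vs. \<Sum>m\<in>I. (1 / fact (m - j)) *\<^sub>R L m (vs @ replicate (m - j) x))"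
            by (auto simp: N_def taylor_family_def id_family_def fun_eq_iff)
          then show ?thesis using admw_mono[OF 1, of \<eta>] \<eta> by simp
        qed
      qed
      \<comment> \<open>Since \<open>A\<close> acts by \<open>a\<close> at each node, its inverse
        acts by \<open>ai\<close> at each node.\<close>
      define Ai where "Ai = (\<lambda>u :: ('m, 'v) ell_infty. (Bcontfun (\<lambda>i. ai (apply_bcontfun u i)) :: ('m, 'v) ell_infty))"
      have ain: "norm (ai (apply_bcontfun u i)) \<le> K * \<theta>' * norm u" for u :: "('m, 'v) ell_infty" and i
      proof -
        have "norm (ai (apply_bcontfun u i)) \<le> K * \<theta>' * norm (apply_bcontfun u i)"
          using growth(2)[of 1 "apply_bcontfun u i"] by simp
        also have "\<dots> \<le> K * \<theta>' * norm u" using K1 pos by (intro mult_left_mono norm_bounded) auto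
        finally show ?thesis .
      qed
      have Ainode: "apply_bcontfun (Ai u) i = ai (apply_bcontfun u i)" for u i
        unfolding Ai_def by (subst apply_bounded_family[OF ain]) simp
      have Aibl: "bounded_linear Ai"
      proof (rule bounded_linear_intro[where K = "K * \<theta>'"])
        have lin: "linear ai" by (rule bounded_linear.linear[OF ai])
        show "Ai (x + y) = Ai x + Ai y" for x y
          by (rule bcontfun_eqI) (simp add: Ainode linear_add[OF lin])
        show "Ai (c *\<^sub>R x) = c *\<^sub>R Ai x" for c x
          by (rule bcontfun_eqI) (simp add: Ainode linear_scale[OF lin])
        show "norm (Ai x) \<le> norm x * (K * \<theta>')" for x
          by (rule norm_bound) (use ain in \<open>simp add: Ainode mult.commute\<close>)
      qed
      have AAi: "blinfun_apply A (Ai x) = x" for x by (rule bcontfun_eqI) (simp add: Anode Ainode a_ai)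
      have AiA: "Ai (blinfun_apply A x) = x" for x by (rule bcontfun_eqI) (simp add: Anode Ainode ai_a)
      have Aibnd: "bnd w (\<theta>' * c) (Ai x)" if "bnd w c x" for w c x
        by (rule admw_nodewise[where f = ai, OF pbound_ai _ Ainode that]) (use pos in auto)
      have jets: "F' j 0 vs = N j 0 vs + blinfun_apply A (id_family j 0 vs)" if "j < s" "length vs = j" for j vs
        using taylor_family_zero[of s L vs j, OF Lml] that by (simp add: N_def L_def)
      have "\<exists>R. smooth_family r (gball 1) R \<and> R 0 0 [] = 0 \<and> (\<forall>h. R 1 0 [h] = h) \<and>
            (\<forall>w j. \<forall>x\<in>gball 1. j \<le> r \<longrightarrow> admw w 2 j (R j x)) \<and>
            (\<forall>x\<in>gball 1. R 0 (F' 0 x []) [] = blinfun_apply A (R 0 x []) + N 0 (R 0 x []) [])"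
      proof (rule conj[OF F'sm F'00 F'1adm _ Nsm Nadm _ Aibl AAi AiA Aibnd jets])
        show "admw w \<eta> j (F' j x)" if "x \<in> gball 1" "2 \<le> j" "j \<le> r" for w j x
          using F'2[OF that(2,3,1)] \<delta>\<eta>' by (rule admw_mono)
        show "linear (blinfun_apply A)" by (rule bounded_linear.linear[OF blinfun.bounded_linear_right])
      qed
      then obtain R where R: "smooth_family r (gball 1) R" and R00: "R 0 0 [] = 0" and R1: "\<And>h. R 1 0 [h] = h"
        and Radm: "\<And>w j x. x \<in> gball 1 \<Longrightarrow> j \<le> r \<Longrightarrow> admw w 2 j (R j x)"
        and Req: "\<And>x. x \<in> gball 1 \<Longrightarrow> R 0 (F' 0 x []) [] = blinfun_apply A (R 0 x []) + N 0 (R 0 x []) []"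
        by blast
      \<comment> \<open>With entries of norm at most \<open>1 / (2 * K)\<close> the cut-off point
        has gauge at most 1/2, so it lies in the ball on which \<open>R\<close> is given.\<close>
      have sK: "1 / (2 * K) > 0" using K1 by simp
      obtain \<Psi> :: "nat \<Rightarrow> ('m, 'v) ell_infty \<Rightarrow> ('m, 'v) ell_infty list \<Rightarrow> ('m, 'v) ell_infty" and C\<Psi> \<rho> where
        \<Psi>: "smooth_family r UNIV \<Psi>" and \<rho>: "0 < \<rho>" and C\<Psi>: "0 \<le> C\<Psi>"
        and \<Psi>bd: "\<And>x i. norm (apply_bcontfun (\<Psi> 0 x []) i) \<le> 1 / (2 * K)"
        and \<Psi>id: "\<And>x. norm x \<le> \<rho> \<Longrightarrow> \<Psi> 0 x [] = x"
        and \<Psi>loc: "\<And>j x vs i. j \<le> r \<Longrightarrow> length vs = j \<Longrightarrow>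
          norm (apply_bcontfun (\<Psi> j x vs) i) \<le> C\<Psi> * prod_list (map (\<lambda>v. norm (apply_bcontfun v i)) vs)"
        using node_cutoff[OF S sK, of r] by (elim exE conjE) blast
      have \<Psi>ball: "\<Psi> 0 x [] \<in> gball 1" for x
      proof (rule gballI)
        show "bnd None (K * norm (\<Psi> 0 x [])) (\<Psi> 0 x [])" by (rule bnd_norm)
        have "norm (\<Psi> 0 x []) \<le> 1 / (2 * K)" by (rule norm_bound[OF \<Psi>bd])
        then have "K * norm (\<Psi> 0 x []) \<le> 1 / 2" using K1 by (simp add: field_simps)
        then show "K * norm (\<Psi> 0 x []) < 1" by simp
      qed
      \<comment> \<open>\<open>R\<close> is given on the unit ball only; the cutoff makes it global
        and changes nothing near 0.\<close>
      define E where "E = comp_family R \<Psi>"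
      have Esm: "smooth_family r UNIV E"
        unfolding E_def by (rule smooth_family_comp[OF R \<Psi> open_UNIV open_gball \<Psi>ball])
      define \<tau> where "\<tau> = 1 / \<delta>"
      have \<tau>: "0 < \<tau>" "\<tau> * \<delta> = 1" using \<delta> by (auto simp: \<tau>_def)
      \<comment> \<open>Undoes the rescaling: \<open>\<tau>\<close> is the inverse of
        \<open>\<delta>\<close>.\<close>
      define G where "G j x vs = (\<tau> ^ j / \<tau>) *\<^sub>R E j (\<tau> *\<^sub>R x) vs" for j x vs
      have Gsm: "smooth_family r UNIV G"
        unfolding G_def[abs_def] by (rule smooth_family_rescale[OF Esm \<tau>(1)]) auto
      define Rh where "Rh x = G 0 x []" for x
      have Rh: "Rh x = \<delta> *\<^sub>R R 0 (\<Psi> 0 (\<tau> *\<^sub>R x) []) []" for x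
        by (simp add: Rh_def G_def E_def comp_family_def \<tau>_def)
      define \<sigma> where "\<sigma> = max 1 (K * C\<Psi>)"
      have \<Psi>adm: "admw w \<sigma> j (\<Psi> j x)" if "j \<le> r" for w j x
        using admw_of_local_bound[OF C\<Psi> \<Psi>loc[OF that]] by (rule admw_mono) (simp_all add: \<sigma>_def)
      define cG where "cG j = \<bar>\<tau> ^ j / \<tau>\<bar> * (real (bell j) * (2 * \<sigma> ^ j))" for j
      have Gadm: "admw w (cG j) j (G j x)" if j: "j \<le> r" for w j x
        unfolding G_def cG_def E_def comp_family_def
      proof (intro admw_scaleR jcomp_bound)
        show "multilinear p (R p (\<Psi> 0 (\<tau> *\<^sub>R x) [])) \<and> admw w 2 p (R p (\<Psi> 0 (\<tau> *\<^sub>R x) []))" if "p \<le> j" for p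
          using smooth_family_multilinear[OF R open_gball _ \<Psi>ball] Radm[OF \<Psi>ball] that j by auto
      qed (use \<Psi>adm j in \<open>auto simp: \<sigma>_def\<close>)
      have cG0: "0 \<le> cG j" for j by (simp add: cG_def \<sigma>_def)
      have Gml: "multilinear j (G j x)" if "j \<le> r" for j x
        using smooth_family_multilinear[OF Gsm open_UNIV that] by simp
      have Rh_decay: "Rh \<in> C_decay \<Gamma> r UNIV"
        unfolding C_decay_def
      proof (intro CollectI exI[of _ G] conjI ballI)
        show "frechet_derivs r UNIV Rh G"
          by (rule smooth_family_imp_frechet_derivs[OF Gsm]) (auto simp: Rh_def)
        obtain b where "\<And>x. op_bound 0 b (G 0 x)" using smooth_family_bound[OF Gsm, of 0] by auto
        then have "norm (Rh x) \<le> b" for x by (simp add: op_bound_def unit_lists_def Rh_def)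
        then show "bounded (range Rh)" by (auto simp: bounded_iff)
        fix j assume j: "j \<in> {1..r}"
        then have jr: "j \<le> r" by simp
        show "G j x \<in> L_multi \<Gamma> j" for x by (rule admw_L_multi(1)[OF Gml[OF jr] Gadm[OF jr] cG0])
        have "(SUP x. norm_multi \<Gamma> j (G j x)) \<le> ennreal (max (K * cG j * K ^ j) (cG j * (K / \<Gamma> 0) ^ j))"
          by (rule SUP_least) (rule admw_L_multi(2)[OF Gml[OF jr] Gadm[OF jr] cG0])
        then show "(SUP x. norm_multi \<Gamma> j (G j x)) < \<infinity>" by (simp add: le_less_trans)
      qed
      have Rh0: "Rh 0 = 0" using \<Psi>id[of 0] \<rho> by (simp add: Rh R00)
      have Rh_near: "Rh x = \<delta> *\<^sub>R R 0 (\<tau> *\<^sub>R x) []" if "norm x \<le> \<delta> * \<rho>" for x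
      proof -
        have "norm (\<tau> *\<^sub>R x) \<le> \<rho>" using that \<delta> by (simp add: \<tau>_def field_simps)
        then show ?thesis by (simp add: Rh \<Psi>id)
      qed
      have Rh_deriv: "(Rh has_derivative id) (at 0)"
      proof -
        have "smooth_family r {x. \<tau> *\<^sub>R x \<in> gball 1} (\<lambda>j x vs. (\<tau> ^ j / \<tau>) *\<^sub>R R j (\<tau> *\<^sub>R x) vs)"
          by (rule smooth_family_rescale[OF R \<tau>(1) _ open_gball]) simp
        from smooth_family_deriv[OF this r(3), of 0 "[]"]
        have "((\<lambda>y. \<delta> *\<^sub>R R 0 (\<tau> *\<^sub>R y) []) has_derivative (\<lambda>h. h)) (at 0)"
          using z1 \<tau> R1 by (simp add: \<tau>_def)
        then have "(Rh has_derivative (\<lambda>h. h)) (at 0)"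
        proof (rule has_derivative_transform_within_open)
          show "open (ball (0 :: ('m, 'v) ell_infty) (\<delta> * \<rho>))" "0 \<in> ball (0 :: ('m, 'v) ell_infty) (\<delta> * \<rho>)"
            using \<delta> \<rho> by auto
        qed (simp add: Rh_near)
        then show ?thesis by (simp add: id_def)
      qed
      \<comment> \<open>The Taylor coefficients of the original \<open>F\<close>; its constant term
        is 0.\<close>
      define P where "P j vs = (1 / fact j) *\<^sub>R D j 0 vs" for j vs
      define H where "H x = 0 + (\<Sum>j=1..s. P j (replicate j x))" for x
      have H: "polynomial_decay \<Gamma> s H"
        unfolding polynomial_decay_def
      proof (intro exI[of _ 0] exI[of _ P] conjI ballI allI)
        fix j assume "j \<in> {1..s}"
        then have j: "1 \<le> j" "j \<le> r" using s by auto
        show "P j \<in> L_multi \<Gamma> j"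
          unfolding P_def[abs_def]
          by (rule admw_L_multi(1)[OF multilinear_scaleR[OF Dml[OF j(2) U(2)]] admw_scaleR[OF Dadm[OF j U(2)]]])
             (use C1 in simp)
      qed (simp add: H_def)
      \<comment> \<open>\<open>A + N\<close> is the Taylor polynomial of the rescaled map, and the
        powers of \<open>\<delta>\<close> make it \<open>H\<close> conjugated by the
        scaling.\<close>
      have H_taylor: "\<delta> *\<^sub>R (blinfun_apply A y + N 0 y []) = H (\<delta> *\<^sub>R y)" for y
      proof -
        have "blinfun_apply A y + N 0 y [] = (\<Sum>m\<in>{0..s}. (1 / fact m) *\<^sub>R L m (replicate m y))"
          by (simp add: N_def id_family_def taylor_family_def)
        also have "\<dots> = (\<Sum>m\<in>{1..s}. (1 / fact m) *\<^sub>R L m (replicate m y))"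
          using F'00 by (simp add: sum.atLeast_Suc_atMost L_def)
        finally have "\<delta> *\<^sub>R (blinfun_apply A y + N 0 y []) = (\<Sum>m\<in>{1..s}. \<delta> *\<^sub>R (1 / fact m) *\<^sub>R L m (replicate m y))"
          by (simp add: scaleR_sum_right)
        also have "\<dots> = (\<Sum>m\<in>{1..s}. P m (replicate m (\<delta> *\<^sub>R y)))"
        proof (rule sum.cong[OF refl])
          fix m assume "m \<in> {1..s}"
          then have "m \<le> r" using s by simp
          from multilinear_replicate[OF Dml[OF this U(2)], of \<delta> y]
          show "\<delta> *\<^sub>R (1 / fact m) *\<^sub>R L m (replicate m y) = P m (replicate m (\<delta> *\<^sub>R y))"
            using \<delta> by (simp add: P_def L_def F'_def)
        qed
        finally show ?thesis by (simp add: H_def)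
      qed
      have "isCont F 0"
      proof -
        have "((\<lambda>x. D 0 x []) has_derivative (\<lambda>h. D 1 0 [h])) (at 0)"
          using smooth_family_deriv[OF Dsm r(3) U(2), of "[]"] by simp
        then have "(F has_derivative (\<lambda>h. D 1 0 [h])) (at 0)"
          by (rule has_derivative_transform_within_open[OF _ U]) (rule D0)
        then show ?thesis by (rule has_derivative_continuous)
      qed
      moreover have "0 < \<delta> * \<rho>" using \<delta> \<rho> by simp
      ultimately obtain d where d: "d > 0" "\<And>x. norm x < d \<Longrightarrow> norm (F x) < \<delta> * \<rho>"
        unfolding continuous_at_eps_delta using F0 by (metis diff_zero dist_norm)
      \<comment> \<open>The four radii put \<open>x\<close> in \<open>U\<close>, \<open>F x\<close>
        and then \<open>x\<close> where the cutoff is the identity, and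
        \<open>\<tau> *\<^sub>R x\<close> in the unit ball.\<close>
      define e1 where "e1 = min (min e0 d) (min (\<delta> * \<rho>) (\<delta> / (2 * K)))"
      have e1: "e1 > 0" using e0 d \<delta> \<rho> K1 by (simp add: e1_def)
      have "Rh (F x) = H (Rh x)" if x: "x \<in> ball 0 e1" for x
      proof -
        have nx: "norm x < e0" "norm x < d" "norm x \<le> \<delta> * \<rho>" "norm x \<le> \<delta> / (2 * K)"
          using x by (auto simp: e1_def)
        have xU: "x \<in> U" using nx(1) e0(2) by (auto simp: subset_iff)
        have xb: "\<tau> *\<^sub>R x \<in> gball 1"
        proof (rule gballI[OF bnd_norm])
          have "K * norm (\<tau> *\<^sub>R x) = K * norm x / \<delta>" using \<delta> by (simp add: \<tau>_def)
          also have "\<dots> \<le> 1 / 2" using nx(4) K1 \<delta> by (simp add: field_simps)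
          finally show "K * norm (\<tau> *\<^sub>R x) < 1" by simp
        qed
        have "F' 0 (\<tau> *\<^sub>R x) [] = \<tau> *\<^sub>R F x"
          using \<tau> D0[OF xU] by (simp add: F'_def \<tau>_def)
        then have "Rh (F x) = \<delta> *\<^sub>R R 0 (F' 0 (\<tau> *\<^sub>R x) []) []"
          using Rh_near[of "F x"] d(2)[OF nx(2)] by simp
        also have "\<dots> = H (\<delta> *\<^sub>R R 0 (\<tau> *\<^sub>R x) [])"
          by (simp only: Req[OF xb] H_taylor)
        also have "\<dots> = H (Rh x)" by (simp only: Rh_near[OF nx(3)])
        finally show ?thesis .
      qed
      moreover have "ball 0 e1 \<subseteq> U" using e0(2) by (auto simp: e1_def subset_iff)
      ultimately show "\<exists>H R U\<^sub>1. polynomial_decay \<Gamma> s H \<and>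
            R \<in> C_decay \<Gamma> r UNIV \<and> R 0 = 0 \<and> (R has_derivative id) (at 0) \<and>
            open U\<^sub>1 \<and> 0 \<in> U\<^sub>1 \<and> U\<^sub>1 \<subseteq> U \<and> (\<forall>x\<in>U\<^sub>1. R (F x) = H (R x))"
        using H Rh_decay Rh0 Rh_deriv e1
        by (intro exI[of _ H] exI[of _ Rh] exI[of _ "ball 0 e1"] conjI ballI) simp_all
    qed
  qed
qed

end

text \<open>What remains is to turn the spectrum into rates: \<open>\<nu> < r\<^sub>0\<close> means
  \<open>\<beta> ^ r\<^sub>0 < \<alpha>\<close>, and the strict inequality leaves room for growth
  rates slightly beyond the spectral bounds.\<close>

theorem theorem7:
  fixes \<Gamma> :: "int^'m::finite \<Rightarrow> real"
    and a :: "'v::banach \<Rightarrow>\<^sub>L 'v"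
    and ev :: "nat \<Rightarrow> complex"
    and \<alpha> \<beta> \<nu> :: real
    and n r r\<^sub>0 :: nat
  assumes "n \<ge> 1" and "dim (UNIV :: 'v set) = n"
    and "decay_function \<Gamma>"
    and "complex_spectrum a = ev ` {1..n}"
    and "\<alpha> = Min ((\<lambda>i. cmod (ev i)) ` {1..n})"
    and "\<beta> = Max ((\<lambda>i. cmod (ev i)) ` {1..n})"
    and "\<nu> = ln \<alpha> / ln \<beta>"
    and "r\<^sub>0 = nat \<lfloor>\<nu>\<rfloor> + 1"
    and "\<forall>i\<in>{1..n}. 0 < cmod (ev i) \<and> cmod (ev i) < 1"
    and "r \<ge> r\<^sub>0"
  shows "\<exists>\<epsilon>>0. \<forall>(U :: ('m, 'v) ell_infty set) F F\<^sub>0 F\<^sub>1 A B.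
    open U \<and> 0 \<in> U \<and>
    F \<in> C_decay \<Gamma> r U \<and> (\<forall>x\<in>U. F x = F\<^sub>0 x + F\<^sub>1 x) \<and>
    uncoupled U F\<^sub>0 \<and> F\<^sub>0 0 = 0 \<and> F\<^sub>1 0 = 0 \<and>
    (F\<^sub>0 has_derivative blinfun_apply A) (at 0) \<and>
    (F\<^sub>1 has_derivative blinfun_apply B) (at 0) \<and>
    (\<forall>i j v. proj i (blinfun_apply A (emb j v)) = (if i = j then blinfun_apply a v else 0)) \<and>
    norm_lin \<Gamma> B < ennreal \<epsilon>
    \<longrightarrow> (\<exists>H R U\<^sub>1. polynomial_decay \<Gamma> r\<^sub>0 H \<and>
          R \<in> C_decay \<Gamma> r UNIV \<and> R 0 = 0 \<and> (R has_derivative id) (at 0) \<and>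
          open U\<^sub>1 \<and> 0 \<in> U\<^sub>1 \<and> U\<^sub>1 \<subseteq> U \<and> (\<forall>x\<in>U\<^sub>1. R (F x) = H (R x)))"
proof -
  have ne: "(\<lambda>i. cmod (ev i)) ` {1..n} \<noteq> {}" using assms(1) by simp
  have fin: "finite ((\<lambda>i. cmod (ev i)) ` {1..n})" by simp
  have \<alpha>\<beta>: "0 < \<alpha>" "\<alpha> \<le> \<beta>" "\<beta> < 1"
  proof -
    show "0 < \<alpha>" unfolding assms(5) using assms(9) ne by (subst Min_gr_iff[OF fin ne]) auto
    show "\<beta> < 1" unfolding assms(6) using assms(9) ne by (subst Max_less_iff[OF fin ne]) auto
    show "\<alpha> \<le> \<beta>" unfolding assms(5,6) using Min_le[OF fin] Max_ge[OF fin] ne by (meson ex_in_conv order_trans)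
  qed
  have ev: "\<alpha> \<le> cmod z \<and> cmod z \<le> \<beta>" if "z \<in> complex_spectrum a" for z
    using that unfolding assms(4-6) by (auto intro: Min_le Max_ge)
  have "\<nu> \<ge> 1" "\<beta> ^ r\<^sub>0 < \<alpha>"
  proof -
    have ln\<beta>: "ln \<beta> < 0" "ln \<alpha> \<le> ln \<beta>" using \<alpha>\<beta> by auto
    then show \<nu>: "\<nu> \<ge> 1" by (simp add: assms(7) neg_le_divide_eq)
    have "\<nu> < real r\<^sub>0" unfolding assms(8) using \<nu> by linarith
    \<comment> \<open>Multiplication by the negative number \<open>ln \<beta>\<close> reverses
      \<open>\<nu> < r\<^sub>0\<close>.\<close>
    then have "real r\<^sub>0 * ln \<beta> < ln \<alpha>" using ln\<beta> by (simp add: assms(7) neg_divide_less_eq)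
    then have "ln (\<beta> ^ r\<^sub>0) < ln \<alpha>" using \<alpha>\<beta> by (simp add: ln_realpow)
    then show "\<beta> ^ r\<^sub>0 < \<alpha>" using \<alpha>\<beta> by (subst (asm) ln_less_cancel_iff) auto
  qed
  then have r0: "2 \<le> r\<^sub>0" unfolding assms(8) by linarith
  \<comment> \<open>The factor \<open>t\<close> has to satisfy \<open>t < 1 / \<beta>\<close> and
    \<open>t ^ (r\<^sub>0 + 1) < \<alpha> / \<beta> ^ r\<^sub>0\<close>. A root of order
    \<open>r\<^sub>0 + 2\<close> of the smaller right-hand side gives both strictly.\<close>
  define y where "y = min (\<alpha> / \<beta> ^ r\<^sub>0) (1 / \<beta>)"
  have y: "1 < y" using \<alpha>\<beta> \<open>\<beta> ^ r\<^sub>0 < \<alpha>\<close> by (simp add: y_def)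
  define t where "t = root (r\<^sub>0 + 2) y"
  have t: "1 < t" "t ^ (r\<^sub>0 + 2) = y"
    using y real_root_pow_pos2[of "r\<^sub>0 + 2" y] by (simp_all add: t_def del: power_Suc power_add)
  have ty: "t ^ (r\<^sub>0 + 1) < y" "t < y"
  proof -
    show "t ^ (r\<^sub>0 + 1) < y" unfolding t(2)[symmetric] using t(1) by (intro power_strict_increasing) auto
    show "t < y" unfolding t(2)[symmetric] using power_strict_increasing[of 1 "r\<^sub>0 + 2" t] t(1) by simp
  qed
  \<comment> \<open>Strictly between 1 and \<open>t\<close>: the rates \<open>t1 * \<beta>\<close>
    and \<open>t1 / \<alpha>\<close> lie beyond the spectral bounds, and \<open>t * \<beta>\<close>
    serves as the larger rate \<open>\<theta>2\<close>.\<close>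
  define t1 where "t1 = (1 + t) / 2"
  have t1: "1 < t1" "t1 < t" using t by (auto simp: t1_def)
  obtain S :: "'v set" where S: "finite_basis S"
    using finite_spanning_set[where 'v = 'v] assms(1,2) unfolding finite_basis_def by auto
  obtain ai where ai: "bounded_linear ai" "\<And>x. a (ai x) = x" "\<And>x. ai (a x) = x"
    and ga: "\<And>\<rho>. \<rho> > \<beta> \<Longrightarrow> \<exists>C>0. \<forall>k x. norm ((blinfun_apply a ^^ k) x) \<le> C * \<rho> ^ k * norm x"
    and gai: "\<And>\<rho>. \<rho> > 1 / \<alpha> \<Longrightarrow> \<exists>C>0. \<forall>k x. norm ((ai ^^ k) x) \<le> C * \<rho> ^ k * norm x"
    using spectral_bounds[OF S \<alpha>\<beta>(1,2) ev] by metis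
  have "\<beta> < t1 * \<beta>" "1 / \<alpha> < t1 / \<alpha>" using t1 \<alpha>\<beta> by (auto simp: divide_strict_right_mono)
  then obtain K1 K2 where K1: "K1 > 0" "\<And>k x. norm ((blinfun_apply a ^^ k) x) \<le> K1 * (t1 * \<beta>) ^ k * norm x"
    and K2: "K2 > 0" "\<And>k x. norm ((ai ^^ k) x) \<le> K2 * (t1 / \<alpha>) ^ k * norm x"
    using ga[of "t1 * \<beta>"] gai[of "t1 / \<alpha>"] by auto
  define K where "K = max 1 (max K1 K2)"
  have pos: "0 < t1 * \<beta>" "0 < t1 / \<alpha>" using t1 \<alpha>\<beta> by auto
  interpret adapted \<Gamma> "blinfun_apply a" ai "t1 * \<beta>" "t1 / \<alpha>" K
  proof (rule adapted.intro)
    show "1 \<le> t1 * \<beta> * (t1 / \<alpha>)"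
    proof -
      have "1 \<le> t1 * t1" "1 \<le> \<beta> / \<alpha>" using t1 \<alpha>\<beta> mult_mono[of 1 t1 1 t1] by auto
      from mult_mono[OF this] have "1 \<le> (t1 * t1) * (\<beta> / \<alpha>)" using t1 by simp
      then show ?thesis by (simp add: mult_ac)
    qed
    show "norm ((blinfun_apply a ^^ k) x) \<le> K * (t1 * \<beta>) ^ k * norm x" for k x
    proof -
      have "K1 * (t1 * \<beta>) ^ k * norm x \<le> K * (t1 * \<beta>) ^ k * norm x"
        using pos by (intro mult_right_mono) (auto simp: K_def)
      then show ?thesis using K1(2)[of k x] by linarith
    qed
    show "norm ((ai ^^ k) x) \<le> K * (t1 / \<alpha>) ^ k * norm x" for k x
    proof -
      have "K2 * (t1 / \<alpha>) ^ k * norm x \<le> K * (t1 / \<alpha>) ^ k * norm x"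
        using pos by (intro mult_right_mono) (auto simp: K_def)
      then show ?thesis using K2(2)[of k x] by linarith
    qed
  qed (use assms(3) ai pos in \<open>auto simp: K_def blinfun.bounded_linear_right\<close>)
  have "t * \<beta> < 1"
  proof -
    have "t * \<beta> < y * \<beta>" using ty \<alpha>\<beta> by simp
    also have "\<dots> \<le> 1 / \<beta> * \<beta>" using \<alpha>\<beta> by (intro mult_right_mono) (auto simp: y_def)
    finally show ?thesis using \<alpha>\<beta> by simp
  qed
  moreover have "t1 / \<alpha> * (t * \<beta>) ^ r\<^sub>0 < 1"
  proof -
    have "t1 / \<alpha> * (t * \<beta>) ^ r\<^sub>0 \<le> t / \<alpha> * (t * \<beta>) ^ r\<^sub>0"
      using t1 t \<alpha>\<beta> by (intro mult_right_mono divide_right_mono) auto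
    also have "\<dots> = t ^ (r\<^sub>0 + 1) * (\<beta> ^ r\<^sub>0 / \<alpha>)" by (simp add: power_mult_distrib)
    also have "\<dots> < y * (\<beta> ^ r\<^sub>0 / \<alpha>)" using ty(1) \<alpha>\<beta> by (intro mult_strict_right_mono) auto
    also have "\<dots> \<le> (\<alpha> / \<beta> ^ r\<^sub>0) * (\<beta> ^ r\<^sub>0 / \<alpha>)" using \<alpha>\<beta> by (intro mult_right_mono) (auto simp: y_def)
    also have "\<dots> = 1" using \<alpha>\<beta> by simp
    finally show ?thesis .
  qed
  moreover have "t1 * \<beta> < t * \<beta>" using t1 \<alpha>\<beta> by simp
  ultimately show ?thesis using r0 assms(10) by (intro decay_conjugacy[OF S])
qed

end
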